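(* Let $G$ be a connected reductive group defined over $\mathbb{R}$ and let $\Gamma=\mathrm{Gal}(\mathbb{C}/\mathbb{R})$. The category of strong real forms of $G(\mathbb{C})\rtimes\Gamma$ is equivalent to the category $RI(G)$ of rigid inner twists of $G$.
   Context: Strong real forms. Let $\sigma\in\Gamma$ be complex conjugation. A strong real form of $G(\mathbb{C})\rtimes\Gamma$ is an element $\delta$ of the coset $G(\mathbb{C})\rtimes\sigma$ whose square is a central element of finite order in $G(\mathbb{C})$. The category of strong real forms has these as objects, with $\mathrm{Hom}(\delta,\delta')=\{g\in G(\mathbb{C}):\delta'=g\delta g^{-1}\}$. The groups $u$, $W$ (for $F=\mathbb{R}$, $\bar F=\mathbb{C}$). For $E\in\{\mathbb{R},\mathbb{C}\}$ and $n\ge1$, let $R_{E/F}[n]=\mathrm{Res}_{E/F}\mu_n$, with $\bar F$-points $\mathrm{Maps}(\Gamma_{E/F},\mu_n(\bar F))$ and $(\sigma f)(\tau)=\sigma(f(\sigma^{-1}\tau))$; $u_{E/F,n}$ is its quotient by the diagonally embedded $\mu_n$. For $E\subset K$, $n\mid m$, the map $(pf)(a)=\prod_{b\mapsto a}f(b)^{m/n}$ induces $u_{K/F,m}\to u_{E/F,n}$, and $u=\varprojlim u_{E/F,n}$, with profinite topology and continuous $\Gamma$-action. One has $H^1(\Gamma,u)=0$ and $H^2(\Gamma,u)\cong\mathbb{Z}/2\mathbb{Z}$; let $\xi$ be the non-trivial class and fix an extension of profinite groups $1\to u\to W\to\Gamma\to1$ of class $\xi$. Rigid inner twists. For a finite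 central subgroup $Z\subset G$ over $F$, $Z^1(u\to W,Z\to G)$ is the set of continuous 1-cocycles $W\to G(\bar F)$ (discrete topology, $W$ acting through $\Gamma$) whose restriction to $u$ is an algebraic homomorphism $u\to Z$ (factoring through some $u_{E/F,n}$). A rigid inner twist $(\psi,z):G\to G'$ realized by $Z$ consists of a connected reductive $F$-group $G'$, an isomorphism $\psi:G\to G'$ over $\bar F$, and $z\in Z^1(u\to W,Z\to G)$ such that $\psi^{-1}\sigma(\psi)=\mathrm{Ad}(\bar z(\sigma))$ for all $\sigma\in\Gamma$, where $\bar z\in Z^1(\Gamma,G_{\mathrm{ad}})$ is the image of $z$. An isomorphism $(f,g):(\psi_1,z_1)\to(\psi_2,z_2)$ of rigid inner twists $(\psi_i,z_i):G\to G_i$ consists of $g\in G(\bar F)$ and an $F$-isomorphism $f:G_1\to G_2$ with $z_2(w)=gz_1(w)w(g^{-1})$ for all $w\in W$ and $f\circ\psi_1=\psi_2\circ\mathrm{Ad}(g)$. $RI_Z(G)$ is the category of rigid inner twists realized by $Z$ with isomorphisms as morphisms; for $Z\subset Z'$ there is a fully faithful functor $RI_Z(G)\to RI_{Z'}(G)$, and $RI(G)=\varinjlim_ZRI_Z(G)$ over all finite central subgroups $Z$ defined over $F$. *)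

theory Defs
  imports
    "HOL-Algebra.Product_Groups"
    "HOL-Analysis.Abstract_Topological_Spaces"
    "Jordan_Normal_Form.Determinant"
begin

section \<open>Categories\<close>

text \<open>
  Hom-sets of different pairs of objects need not be disjoint, so composition and the arrow part
  of a functor take the objects as arguments. \<open>Comp C X Y Z g f\<close> is \<open>g\<close> after \<open>f\<close>,
  where \<open>f : X \<rightarrow> Y\<close> and \<open>g : Y \<rightarrow> Z\<close>.
\<close>

record ('o, 'a) precat =
  Obj :: "'o set"
  Hom :: "'o \<Rightarrow> 'o \<Rightarrow> 'a set"
  Ident :: "'o \<Rightarrow> 'a"
  Comp :: "'o \<Rightarrow> 'o \<Rightarrow> 'o \<Rightarrow> 'a \<Rightarrow> 'a \<Rightarrow> 'a"

definition category :: "('o, 'a) precat \<Rightarrow> bool" where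
  "category C \<longleftrightarrow>
     (\<forall>X\<in>Obj C. Ident C X \<in> Hom C X X) \<and>
     (\<forall>X\<in>Obj C. \<forall>Y\<in>Obj C. \<forall>Z\<in>Obj C. \<forall>f\<in>Hom C X Y. \<forall>g\<in>Hom C Y Z.
        Comp C X Y Z g f \<in> Hom C X Z) \<and>
     (\<forall>X\<in>Obj C. \<forall>Y\<in>Obj C. \<forall>f\<in>Hom C X Y.
        Comp C X Y Y (Ident C Y) f = f \<and> Comp C X X Y f (Ident C X) = f) \<and>
     (\<forall>X\<in>Obj C. \<forall>Y\<in>Obj C. \<forall>Z\<in>Obj C. \<forall>V\<in>Obj C.
        \<forall>f\<in>Hom C X Y. \<forall>g\<in>Hom C Y Z. \<forall>h\<in>Hom C Z V.
          Comp C X Z V h (Comp C X Y Z g f) = Comp C X Y V (Comp C Y Z V h g) f)"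

record ('o, 'a, 'p, 'b) func =
  on_obj :: "'o \<Rightarrow> 'p"
  on_hom :: "'o \<Rightarrow> 'o \<Rightarrow> 'a \<Rightarrow> 'b"

definition is_functor :: "('o, 'a) precat \<Rightarrow> ('p, 'b) precat \<Rightarrow> ('o, 'a, 'p, 'b) func \<Rightarrow> bool" where
  "is_functor C D F \<longleftrightarrow>
     (\<forall>X\<in>Obj C. on_obj F X \<in> Obj D) \<and>
     (\<forall>X\<in>Obj C. \<forall>Y\<in>Obj C. \<forall>f\<in>Hom C X Y.
        on_hom F X Y f \<in> Hom D (on_obj F X) (on_obj F Y)) \<and>
     (\<forall>X\<in>Obj C. on_hom F X X (Ident C X) = Ident D (on_obj F X)) \<and>
     (\<forall>X\<in>Obj C. \<forall>Y\<in>Obj C. \<forall>Z\<in>Obj C. \<forall>f\<in>Hom C X Y. \<forall>g\<in>Hom C Y Z.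
        on_hom F X Z (Comp C X Y Z g f) =
        Comp D (on_obj F X) (on_obj F Y) (on_obj F Z) (on_hom F Y Z g) (on_hom F X Y f))"

definition id_func :: "('o, 'a, 'o, 'a) func" where
  "id_func = \<lparr>on_obj = (\<lambda>X. X), on_hom = (\<lambda>X Y f. f)\<rparr>"

definition comp_func ::
    "('p, 'b, 'q, 'c) func \<Rightarrow> ('o, 'a, 'p, 'b) func \<Rightarrow> ('o, 'a, 'q, 'c) func" where
  "comp_func F' F =
     \<lparr>on_obj = (\<lambda>X. on_obj F' (on_obj F X)),
      on_hom = (\<lambda>X Y f. on_hom F' (on_obj F X) (on_obj F Y) (on_hom F X Y f))\<rparr>"

definition is_iso_in :: "('o, 'a) precat \<Rightarrow> 'o \<Rightarrow> 'o \<Rightarrow> 'a \<Rightarrow> bool" where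
  "is_iso_in C X Y f \<longleftrightarrow>
     f \<in> Hom C X Y \<and>
     (\<exists>g\<in>Hom C Y X. Comp C X Y X g f = Ident C X \<and> Comp C Y X Y f g = Ident C Y)"

definition natural_iso ::
    "('o, 'a) precat \<Rightarrow> ('p, 'b) precat \<Rightarrow> ('o, 'a, 'p, 'b) func \<Rightarrow> ('o, 'a, 'p, 'b) func \<Rightarrow>
     ('o \<Rightarrow> 'b) \<Rightarrow> bool" where
  "natural_iso C D F F' \<eta> \<longleftrightarrow>
     (\<forall>X\<in>Obj C. is_iso_in D (on_obj F X) (on_obj F' X) (\<eta> X)) \<and>
     (\<forall>X\<in>Obj C. \<forall>Y\<in>Obj C. \<forall>f\<in>Hom C X Y.
        Comp D (on_obj F X) (on_obj F Y) (on_obj F' Y) (\<eta> Y) (on_hom F X Y f) =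
        Comp D (on_obj F X) (on_obj F' X) (on_obj F' Y) (on_hom F' X Y f) (\<eta> X))"

definition equivalent_categories :: "('o, 'a) precat \<Rightarrow> ('p, 'b) precat \<Rightarrow> bool" where
  "equivalent_categories C D \<longleftrightarrow>
     category C \<and> category D \<and>
     (\<exists>F F' \<eta> \<epsilon>. is_functor C D F \<and> is_functor D C F' \<and>
        natural_iso C C id_func (comp_func F' F) \<eta> \<and>
        natural_iso D D (comp_func F F') id_func \<epsilon>)"


section \<open>Linear algebraic groups\<close>

definition GL :: "nat \<Rightarrow> complex mat monoid" where
  "GL n = units_of (ring_mat TYPE(complex) n ())"

text \<open>
  \<open>coord_ring K n\<close> is the coordinate ring \<open>K[x\<^sub>i\<^sub>j, 1/det]\<close> of the general linear group over a
  subfield \<open>K\<close> of the complex numbers, as a ring of functions on complex matrices.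
\<close>

inductive_set coord_ring :: "complex set \<Rightarrow> nat \<Rightarrow> (complex mat \<Rightarrow> complex) set"
  for K :: "complex set" and n :: nat where
  const: "c \<in> K \<Longrightarrow> (\<lambda>A. c) \<in> coord_ring K n"
| entry: "i < n \<Longrightarrow> j < n \<Longrightarrow> (\<lambda>A. A $$ (i, j)) \<in> coord_ring K n"
| inv_det: "(\<lambda>A. inverse (det A)) \<in> coord_ring K n"
| add: "p \<in> coord_ring K n \<Longrightarrow> q \<in> coord_ring K n \<Longrightarrow> (\<lambda>A. p A + q A) \<in> coord_ring K n"
| mult: "p \<in> coord_ring K n \<Longrightarrow> q \<in> coord_ring K n \<Longrightarrow> (\<lambda>A. p A * q A) \<in> coord_ring K n"

definition zariski_closed :: "complex set \<Rightarrow> nat \<Rightarrow> complex mat set \<Rightarrow> bool" where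
  "zariski_closed K n V \<longleftrightarrow>
     (\<exists>P \<subseteq> coord_ring K n. V = {A \<in> carrier (GL n). \<forall>p\<in>P. p A = 0})"

definition zariski_connected :: "nat \<Rightarrow> complex mat set \<Rightarrow> bool" where
  "zariski_connected n V \<longleftrightarrow>
     (\<forall>V1 V2. zariski_closed UNIV n V1 \<and> zariski_closed UNIV n V2 \<and>
        V1 \<union> V2 = V \<and> V1 \<inter> V2 = {} \<longrightarrow> V1 = {} \<or> V2 = {})"

text \<open>
  A pair \<open>(n, G)\<close> is a group of invertible complex matrices of size \<open>n\<close>. A linear algebraic
  group over the reals is identified with its group of complex points, embedded in some general
  linear group by a closed embedding over the reals, that is, as the zero locus of functions with
  real coefficients. As affine group schemes in characteristic 0 are reduced, this loses nothing.
\<close>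

type_synonym lin_group = "nat \<times> complex mat set"

definition pts :: "lin_group \<Rightarrow> complex mat monoid" where
  "pts H = (GL (fst H))\<lparr>carrier := snd H\<rparr>"

definition real_alg_group :: "lin_group \<Rightarrow> bool" where
  "real_alg_group H \<longleftrightarrow> subgroup (snd H) (GL (fst H)) \<and> zariski_closed \<real> (fst H) (snd H)"

definition unipotent_set :: "nat \<Rightarrow> complex mat set \<Rightarrow> bool" where
  "unipotent_set n U \<longleftrightarrow> (\<forall>A\<in>U. \<exists>k. (A - 1\<^sub>m n) ^\<^sub>m k = 0\<^sub>m n n)"

definition trivial_unipotent_radical :: "lin_group \<Rightarrow> bool" where
  "trivial_unipotent_radical H \<longleftrightarrow>
     (\<forall>U. U \<lhd> pts H \<and> zariski_closed UNIV (fst H) U \<and> zariski_connected (fst H) U \<and>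
          unipotent_set (fst H) U \<longrightarrow> U = {\<one>\<^bsub>pts H\<^esub>})"

definition connected_reductive :: "lin_group \<Rightarrow> bool" where
  "connected_reductive H \<longleftrightarrow>
     real_alg_group H \<and> zariski_connected (fst H) (snd H) \<and> trivial_unipotent_radical H"

text \<open>
  Regular functions on a closed subset of the general linear group are restrictions of elements of
  the coordinate ring.
\<close>

definition regular_map :: "complex set \<Rightarrow> lin_group \<Rightarrow> lin_group \<Rightarrow> (complex mat \<Rightarrow> complex mat) \<Rightarrow> bool" where
  "regular_map K H H' f \<longleftrightarrow>
     f \<in> snd H \<rightarrow> snd H' \<and>
     (\<forall>i<fst H'. \<forall>j<fst H'. \<exists>p\<in>coord_ring K (fst H). \<forall>A\<in>snd H. f A $$ (i, j) = p A)"

definition alg_iso :: "complex set \<Rightarrow> lin_group \<Rightarrow> lin_group \<Rightarrow> (complex mat \<Rightarrow> complex mat) \<Rightarrow> bool" where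
  "alg_iso K H H' f \<longleftrightarrow>
     f \<in> extensional (snd H) \<and> f \<in> iso (pts H) (pts H') \<and>
     regular_map K H H' f \<and> regular_map K H' H (inv_into (snd H) f)"

definition center_of :: "('a, 'b) monoid_scheme \<Rightarrow> 'a set" where
  "center_of G = {c \<in> carrier G. \<forall>x\<in>carrier G. c \<otimes>\<^bsub>G\<^esub> x = x \<otimes>\<^bsub>G\<^esub> c}"

definition finite_central_subgroup :: "lin_group \<Rightarrow> complex mat set \<Rightarrow> bool" where
  "finite_central_subgroup G Z \<longleftrightarrow>
     subgroup Z (pts G) \<and> finite Z \<and> Z \<subseteq> center_of (pts G) \<and> zariski_closed \<real> (fst G) Z"


section \<open>Galois groups and strong real forms\<close>

text \<open>
  \<open>galois E\<close> is the Galois group over the reals of a field \<open>E\<close> between \<open>\<real>\<close> and the complex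
  numbers.
\<close>

definition galois :: "complex set \<Rightarrow> (complex \<Rightarrow> complex) monoid" where
  "galois E =
     \<lparr>carrier = {s \<in> extensional E. bij_betw s E E \<and>
        (\<forall>x\<in>E. \<forall>y\<in>E. s (x + y) = s x + s y \<and> s (x * y) = s x * s y) \<and>
        (\<forall>r. s (complex_of_real r) = complex_of_real r)},
      monoid.mult = compose E,
      one = (\<lambda>x\<in>E. x)\<rparr>"

abbreviation \<Gamma> :: "(complex \<Rightarrow> complex) monoid" where
  "\<Gamma> \<equiv> galois UNIV"

definition semidirect_galois :: "lin_group \<Rightarrow> (complex mat \<times> (complex \<Rightarrow> complex)) monoid" where
  "semidirect_galois G =
     \<lparr>carrier = snd G \<times> carrier \<Gamma>,
      monoid.mult = (\<lambda>(g, s) (h, t). (g \<otimes>\<^bsub>pts G\<^esub> map_mat s h, s \<otimes>\<^bsub>\<Gamma>\<^esub> t)),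
      one = (\<one>\<^bsub>pts G\<^esub>, \<one>\<^bsub>\<Gamma>\<^esub>)\<rparr>"

definition strong_real_form :: "lin_group \<Rightarrow> complex mat \<times> (complex \<Rightarrow> complex) \<Rightarrow> bool" where
  "strong_real_form G \<delta> \<longleftrightarrow>
     \<delta> \<in> snd G \<times> {cnj} \<and>
     (\<exists>c\<in>center_of (pts G). \<delta> \<otimes>\<^bsub>semidirect_galois G\<^esub> \<delta> = (c, \<one>\<^bsub>\<Gamma>\<^esub>) \<and>
        (\<exists>k::nat. k > 0 \<and> c [^]\<^bsub>pts G\<^esub> k = \<one>\<^bsub>pts G\<^esub>))"

definition strong_real_forms ::
    "lin_group \<Rightarrow> (complex mat \<times> (complex \<Rightarrow> complex), complex mat) precat" where
  "strong_real_forms G =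
     \<lparr>Obj = {\<delta>. strong_real_form G \<delta>},
      Hom = (\<lambda>\<delta> \<delta>'. {g \<in> snd G.
        \<delta>' = (g, \<one>\<^bsub>\<Gamma>\<^esub>) \<otimes>\<^bsub>semidirect_galois G\<^esub> \<delta> \<otimes>\<^bsub>semidirect_galois G\<^esub>
             inv\<^bsub>semidirect_galois G\<^esub> (g, \<one>\<^bsub>\<Gamma>\<^esub>)}),
      Ident = (\<lambda>\<delta>. \<one>\<^bsub>pts G\<^esub>),
      Comp = (\<lambda>\<delta>1 \<delta>2 \<delta>3 h g. h \<otimes>\<^bsub>pts G\<^esub> g)\<rparr>"


section \<open>The profinite group u\<close>

definition mu :: "nat \<Rightarrow> complex monoid" where
  "mu n = \<lparr>carrier = {z. z ^ n = 1}, monoid.mult = (*), one = 1\<rparr>"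

definition res_mu :: "complex set \<times> nat \<Rightarrow> ((complex \<Rightarrow> complex) \<Rightarrow> complex) monoid" where
  "res_mu i = product_group (carrier (galois (fst i))) (\<lambda>_. mu (snd i))"

definition diag_mu :: "complex set \<times> nat \<Rightarrow> ((complex \<Rightarrow> complex) \<Rightarrow> complex) set" where
  "diag_mu i = (\<lambda>z. \<lambda>\<tau>\<in>carrier (galois (fst i)). z) ` carrier (mu (snd i))"

definition u_level :: "complex set \<times> nat \<Rightarrow> ((complex \<Rightarrow> complex) \<Rightarrow> complex) set monoid" where
  "u_level i = res_mu i Mod diag_mu i"

definition u_index :: "(complex set \<times> nat) set" where
  "u_index = {\<real>, UNIV} \<times> {n. n \<ge> 1}"

definition u_le :: "complex set \<times> nat \<Rightarrow> complex set \<times> nat \<Rightarrow> bool" where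
  "u_le i j \<longleftrightarrow> fst i \<subseteq> fst j \<and> snd i dvd snd j"

definition res_trans ::
    "complex set \<times> nat \<Rightarrow> complex set \<times> nat \<Rightarrow>
     ((complex \<Rightarrow> complex) \<Rightarrow> complex) \<Rightarrow> ((complex \<Rightarrow> complex) \<Rightarrow> complex)" where
  "res_trans j i f = (\<lambda>a\<in>carrier (galois (fst i)).
     \<Prod>b\<in>{b \<in> carrier (galois (fst j)). restrict b (fst i) = a}. f b ^ (snd j div snd i))"

text \<open>
  The image of a coset under \<open>res_trans\<close> can be smaller than a full coset; multiplying with the
  diagonal subgroup gives the coset containing it.
\<close>

definition u_trans ::
    "complex set \<times> nat \<Rightarrow> complex set \<times> nat \<Rightarrow>
     ((complex \<Rightarrow> complex) \<Rightarrow> complex) set \<Rightarrow> ((complex \<Rightarrow> complex) \<Rightarrow> complex) set" where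
  "u_trans j i c = diag_mu i <#>\<^bsub>res_mu i\<^esub> (res_trans j i ` c)"

type_synonym u_elem = "complex set \<times> nat \<Rightarrow> ((complex \<Rightarrow> complex) \<Rightarrow> complex) set"

definition u_grp :: "u_elem monoid" where
  "u_grp = (product_group u_index u_level)
     \<lparr>carrier := {x \<in> (\<Pi>\<^sub>E i\<in>u_index. carrier (u_level i)).
        \<forall>i\<in>u_index. \<forall>j\<in>u_index. u_le i j \<longrightarrow> u_trans j i (x j) = x i}\<rparr>"

definition u_top :: "u_elem topology" where
  "u_top = subtopology
     (product_topology (\<lambda>i. discrete_topology (carrier (u_level i))) u_index) (carrier u_grp)"

definition res_act ::
    "complex set \<times> nat \<Rightarrow> (complex \<Rightarrow> complex) \<Rightarrow>
     ((complex \<Rightarrow> complex) \<Rightarrow> complex) \<Rightarrow> ((complex \<Rightarrow> complex) \<Rightarrow> complex)" where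
  "res_act i s f = (\<lambda>\<tau>\<in>carrier (galois (fst i)).
     s (f (inv\<^bsub>galois (fst i)\<^esub> (restrict s (fst i)) \<otimes>\<^bsub>galois (fst i)\<^esub> \<tau>)))"

definition u_act :: "(complex \<Rightarrow> complex) \<Rightarrow> u_elem \<Rightarrow> u_elem" where
  "u_act s x = (\<lambda>i\<in>u_index. res_act i s ` x i)"


section \<open>Second cohomology and extensions\<close>

text \<open>
  All cochains on the finite discrete group \<open>\<Gamma>\<close> are continuous, so no continuity condition
  appears in the definition of the second continuous cohomology group.
\<close>

definition cochains2 :: "((complex \<Rightarrow> complex) \<times> (complex \<Rightarrow> complex) \<Rightarrow> u_elem) monoid" where
  "cochains2 = product_group (carrier \<Gamma> \<times> carrier \<Gamma>) (\<lambda>_. u_grp)"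

definition cocycles2 :: "((complex \<Rightarrow> complex) \<times> (complex \<Rightarrow> complex) \<Rightarrow> u_elem) monoid" where
  "cocycles2 = cochains2\<lparr>carrier := {c \<in> carrier cochains2.
     \<forall>r\<in>carrier \<Gamma>. \<forall>s\<in>carrier \<Gamma>. \<forall>t\<in>carrier \<Gamma>.
       u_act r (c (s, t)) \<otimes>\<^bsub>u_grp\<^esub> c (r, s \<otimes>\<^bsub>\<Gamma>\<^esub> t) = c (r, s) \<otimes>\<^bsub>u_grp\<^esub> c (r \<otimes>\<^bsub>\<Gamma>\<^esub> s, t)}\<rparr>"

definition coboundaries2 :: "((complex \<Rightarrow> complex) \<times> (complex \<Rightarrow> complex) \<Rightarrow> u_elem) set" where
  "coboundaries2 =
     (\<lambda>f. \<lambda>(s, t)\<in>carrier \<Gamma> \<times> carrier \<Gamma>.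
        u_act s (f t) \<otimes>\<^bsub>u_grp\<^esub> inv\<^bsub>u_grp\<^esub> (f (s \<otimes>\<^bsub>\<Gamma>\<^esub> t)) \<otimes>\<^bsub>u_grp\<^esub> f s) `
     (carrier \<Gamma> \<rightarrow>\<^sub>E carrier u_grp)"

definition H2_u :: "((complex \<Rightarrow> complex) \<times> (complex \<Rightarrow> complex) \<Rightarrow> u_elem) set monoid" where
  "H2_u = cocycles2 Mod coboundaries2"

definition topological_group :: "('a, 'b) monoid_scheme \<Rightarrow> 'a topology \<Rightarrow> bool" where
  "topological_group G T \<longleftrightarrow>
     group G \<and> topspace T = carrier G \<and>
     continuous_map (prod_topology T T) T (\<lambda>(x, y). x \<otimes>\<^bsub>G\<^esub> y) \<and>
     continuous_map T T (\<lambda>x. inv\<^bsub>G\<^esub> x)"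

definition profinite_group :: "('a, 'b) monoid_scheme \<Rightarrow> 'a topology \<Rightarrow> bool" where
  "profinite_group G T \<longleftrightarrow>
     topological_group G T \<and> compact_space T \<and> Hausdorff_space T \<and>
     (\<forall>x\<in>topspace T. connected_component_of_set T x = {x})"

record 'w extension =
  ext_grp :: "'w monoid"
  ext_top :: "'w topology"
  ext_incl :: "u_elem \<Rightarrow> 'w"
  ext_proj :: "'w \<Rightarrow> complex \<Rightarrow> complex"

definition profinite_extension :: "'w extension \<Rightarrow> bool" where
  "profinite_extension W \<longleftrightarrow>
     profinite_group (ext_grp W) (ext_top W) \<and>
     ext_incl W \<in> hom u_grp (ext_grp W) \<and> inj_on (ext_incl W) (carrier u_grp) \<and>
     continuous_map u_top (ext_top W) (ext_incl W) \<and>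
     ext_proj W \<in> hom (ext_grp W) \<Gamma> \<and> ext_proj W ` carrier (ext_grp W) = carrier \<Gamma> \<and>
     continuous_map (ext_top W) (discrete_topology (carrier \<Gamma>)) (ext_proj W) \<and>
     ext_incl W ` carrier u_grp = kernel (ext_grp W) \<Gamma> (ext_proj W) \<and>
     (\<forall>w\<in>carrier (ext_grp W). \<forall>x\<in>carrier u_grp.
        w \<otimes>\<^bsub>ext_grp W\<^esub> ext_incl W x \<otimes>\<^bsub>ext_grp W\<^esub> inv\<^bsub>ext_grp W\<^esub> w = ext_incl W (u_act (ext_proj W w) x))"

text \<open>The class of an extension is the class of the factor set of any set-theoretic section \<open>s\<close>.\<close>

definition extension_of_class ::
    "'w extension \<Rightarrow> ((complex \<Rightarrow> complex) \<times> (complex \<Rightarrow> complex) \<Rightarrow> u_elem) set \<Rightarrow> bool" where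
  "extension_of_class W \<xi> \<longleftrightarrow>
     profinite_extension W \<and>
     (\<exists>s\<in>carrier \<Gamma> \<rightarrow> carrier (ext_grp W). \<exists>c\<in>\<xi>.
        (\<forall>a\<in>carrier \<Gamma>. ext_proj W (s a) = a) \<and>
        (\<forall>a\<in>carrier \<Gamma>. \<forall>b\<in>carrier \<Gamma>.
           s a \<otimes>\<^bsub>ext_grp W\<^esub> s b = ext_incl W (c (a, b)) \<otimes>\<^bsub>ext_grp W\<^esub> s (a \<otimes>\<^bsub>\<Gamma>\<^esub> b)))"


section \<open>Rigid inner twists\<close>

text \<open>
  Elements of \<open>Z\<^sup>1(u \<rightarrow> W, Z \<rightarrow> G)\<close>. Homomorphisms between finite groups of complex points
  are automatically algebraic.
\<close>

definition rigid_cocycle :: "lin_group \<Rightarrow> 'w extension \<Rightarrow> complex mat set \<Rightarrow> ('w \<Rightarrow> complex mat) \<Rightarrow> bool" where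
  "rigid_cocycle G W Z z \<longleftrightarrow>
     z \<in> carrier (ext_grp W) \<rightarrow>\<^sub>E snd G \<and>
     continuous_map (ext_top W) (discrete_topology (snd G)) z \<and>
     (\<forall>w\<in>carrier (ext_grp W). \<forall>w'\<in>carrier (ext_grp W).
        z (w \<otimes>\<^bsub>ext_grp W\<^esub> w') = z w \<otimes>\<^bsub>pts G\<^esub> map_mat (ext_proj W w) (z w')) \<and>
     (\<exists>i\<in>u_index. \<exists>\<phi>\<in>hom (u_level i) ((pts G)\<lparr>carrier := Z\<rparr>).
        \<forall>x\<in>carrier u_grp. z (ext_incl W x) = \<phi> (x i))"

text \<open>The object \<open>(G', \<psi>, z)\<close> is the rigid inner twist \<open>(\<psi>, z) : G \<rightarrow> G'\<close>.\<close>

type_synonym 'w twist = "lin_group \<times> (complex mat \<Rightarrow> complex mat) \<times> ('w \<Rightarrow> complex mat)"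

text \<open>
  In the last clause, \<open>w\<close> runs over all elements of \<open>W\<close> and \<open>\<sigma> = ext_proj W w\<close> over all of \<open>\<Gamma>\<close>. The
  automorphism \<open>Ad (z w)\<close> depends only on \<open>\<sigma>\<close>, because \<open>z\<close> maps \<open>u\<close> to the centre of \<open>G\<close>: it
  is \<open>Ad\<close> of the value at \<open>\<sigma>\<close> of the image of \<open>z\<close> in \<open>Z\<^sup>1(\<Gamma>, G\<^sub>a\<^sub>d)\<close>. The Galois conjugate of
  \<open>\<psi>\<close> by \<open>\<sigma>\<close> is \<open>\<sigma> \<circ> \<psi> \<circ> \<sigma>\<^sup>-\<^sup>1\<close>.
\<close>

definition rigid_inner_twist :: "lin_group \<Rightarrow> 'w extension \<Rightarrow> complex mat set \<Rightarrow> 'w twist \<Rightarrow> bool" where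
  "rigid_inner_twist G W Z = (\<lambda>(G', \<psi>, z).
     connected_reductive G' \<and> alg_iso UNIV G G' \<psi> \<and> rigid_cocycle G W Z z \<and>
     (\<forall>w\<in>carrier (ext_grp W). \<forall>x\<in>snd G.
        inv_into (snd G) \<psi> (map_mat (ext_proj W w) (\<psi> (map_mat (inv\<^bsub>\<Gamma>\<^esub> (ext_proj W w)) x))) =
        z w \<otimes>\<^bsub>pts G\<^esub> x \<otimes>\<^bsub>pts G\<^esub> inv\<^bsub>pts G\<^esub> (z w)))"

definition rigid_hom ::
    "lin_group \<Rightarrow> 'w extension \<Rightarrow> 'w twist \<Rightarrow> 'w twist \<Rightarrow>
     ((complex mat \<Rightarrow> complex mat) \<times> complex mat) set" where
  "rigid_hom G W = (\<lambda>(G1, \<psi>1, z1) (G2, \<psi>2, z2).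
     {(f, g). g \<in> snd G \<and> alg_iso \<real> G1 G2 f \<and>
        (\<forall>w\<in>carrier (ext_grp W).
           z2 w = g \<otimes>\<^bsub>pts G\<^esub> z1 w \<otimes>\<^bsub>pts G\<^esub> map_mat (ext_proj W w) (inv\<^bsub>pts G\<^esub> g)) \<and>
        (\<forall>x\<in>snd G. f (\<psi>1 x) = \<psi>2 (g \<otimes>\<^bsub>pts G\<^esub> x \<otimes>\<^bsub>pts G\<^esub> inv\<^bsub>pts G\<^esub> g))})"

definition RI_over ::
    "lin_group \<Rightarrow> 'w extension \<Rightarrow> complex mat set \<Rightarrow>
     ('w twist, (complex mat \<Rightarrow> complex mat) \<times> complex mat) precat" where
  "RI_over G W Z =
     \<lparr>Obj = {X. rigid_inner_twist G W Z X},
      Hom = rigid_hom G W,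
      Ident = (\<lambda>X. ((\<lambda>x\<in>snd (fst X). x), \<one>\<^bsub>pts G\<^esub>)),
      Comp = (\<lambda>X Y V (f', g') (f, g). (compose (snd (fst X)) f' f, g' \<otimes>\<^bsub>pts G\<^esub> g))\<rparr>"

lemma RI_over_full_subcategory:
  assumes "Z \<subseteq> Z'"
  shows "Obj (RI_over G W Z) \<subseteq> Obj (RI_over G W Z')"
    and "Hom (RI_over G W Z) = Hom (RI_over G W Z')"
    and "Ident (RI_over G W Z) = Ident (RI_over G W Z')"
    and "Comp (RI_over G W Z) = Comp (RI_over G W Z')"
proof -
  have "hom A ((pts G)\<lparr>carrier := Z\<rparr>) \<subseteq> hom A ((pts G)\<lparr>carrier := Z'\<rparr>)"
    for A :: "((complex \<Rightarrow> complex) \<Rightarrow> complex) set monoid"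
    using assms by (auto simp: hom_def)
  then show "Obj (RI_over G W Z) \<subseteq> Obj (RI_over G W Z')"
    by (fastforce simp: RI_over_def rigid_inner_twist_def rigid_cocycle_def)
qed (simp_all add: RI_over_def)

text \<open>
  The finite central subgroups over the reals are directed under inclusion, and the transition
  functors are, by the lemma above, inclusions of full subcategories. So the direct limit is the
  union.
\<close>

definition RI ::
    "lin_group \<Rightarrow> 'w extension \<Rightarrow>
     ('w twist, (complex mat \<Rightarrow> complex mat) \<times> complex mat) precat" where
  "RI G W =
     \<lparr>Obj = (\<Union>Z\<in>{Z. finite_central_subgroup G Z}. Obj (RI_over G W Z)),
      Hom = rigid_hom G W,
      Ident = (\<lambda>X. ((\<lambda>x\<in>snd (fst X). x), \<one>\<^bsub>pts G\<^esub>)),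
      Comp = (\<lambda>X Y V (f', g') (f, g). (compose (snd (fst X)) f' f, g' \<otimes>\<^bsub>pts G\<^esub> g))\<rparr>"

end

theory Submission
  imports Defs "HOL-Algebra.Multiplicative_Group"
begin

text \<open>
  Let \<open>\<sigma>\<close> be complex conjugation. The group \<open>\<Gamma>\<close> acts trivially on \<open>u\<close>, which is the limit of the
  groups \<open>\<mu>\<^sub>n\<close> under the maps \<open>z \<mapsto> z\<^sup>m\<^sup>/\<^sup>n\<close>; so \<open>H\<^sup>2(\<Gamma>, u) = u / u\<^sup>2\<close> has order 2, and because the class of \<open>W\<close>
  is non-trivial, \<open>\<sigma>\<close> has a lift \<open>s \<in> W\<close> whose square is the generator \<open>\<zeta> = (exp (2\<pi>i/n))\<^sub>n\<close> of \<open>u\<close>.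

  The equivalence sends \<open>(\<psi>, z)\<close> to \<open>z(s)\<sigma>\<close>. A rigid cocycle \<open>z\<close> is determined by \<open>h = z(s)\<close>, since
  \<open>z(\<zeta>) = h \<sigma>(h)\<close> and \<open>z\<close> factors on \<open>u\<close> through some \<open>\<mu>\<^sub>n\<close>, which \<open>\<zeta>\<close> generates. Conversely, if
  \<open>h \<sigma>(h)\<close> is central of order dividing \<open>k\<close>, then \<open>exp (2\<pi>i/k) \<mapsto> h \<sigma>(h)\<close> and \<open>s \<mapsto> h\<close> define a rigid
  cocycle. It remains to realize the form of \<open>G\<close> twisted by \<open>h\<close> as a group of matrices: it is the image
  of \<open>y \<mapsto> y \<oplus> \<sigma>(h) y \<sigma>(h)\<^sup>-\<^sup>1\<close>, written in a basis for which the real structure is the standard one.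
\<close>

section \<open>Transport of structure along a fully faithful functor\<close>

text \<open>The action on u is trivial because \<sigma> both exchanges the two coordinates of a pair
  (x, y) and inverts roots of unity, so the ratio x / y survives. Hence u is central in W, and
  replacing a lift t of \<sigma> by v t multiplies its square by v^2: only the class modulo squares
  is an invariant, and it is visible at level 2. In a morphism (f, g) of twists f is forced by g, so
  the functor is bijective on Hom sets; it is also surjective on objects themselves, not merely up
  to isomorphism. The obstacle is this surjectivity. Real groups are closed sets of matrices stable
  under the standard conjugation, and the twisted conjugation x -> h \<sigma>(x) h^-1 of G is not of
  that kind. So G is embedded in the Weil restriction of GL(n), whose complex points are pairs of
  matrices, with exchange and conjugation as real structure. The second block \<sigma>(h) y
  \<sigma>(h)^-1 is the ordinary conjugate of the twisted conjugate of y; as h \<sigma>(h) is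
  central, twisted conjugation is an involution, and the image is stable.\<close>

lemma category_Ident:
  "category C \<Longrightarrow> X \<in> Obj C \<Longrightarrow> Ident C X \<in> Hom C X X"
  by (simp add: category_def)

lemma category_Comp:
  "category C \<Longrightarrow> X \<in> Obj C \<Longrightarrow> Y \<in> Obj C \<Longrightarrow> Z \<in> Obj C \<Longrightarrow> f \<in> Hom C X Y \<Longrightarrow> g \<in> Hom C Y Z
    \<Longrightarrow> Comp C X Y Z g f \<in> Hom C X Z"
  by (simp add: category_def)

lemma category_Ident_left:
  "category C \<Longrightarrow> X \<in> Obj C \<Longrightarrow> Y \<in> Obj C \<Longrightarrow> f \<in> Hom C X Y \<Longrightarrow> Comp C X Y Y (Ident C Y) f = f"
  by (simp add: category_def)

lemma category_Ident_right:
  "category C \<Longrightarrow> X \<in> Obj C \<Longrightarrow> Y \<in> Obj C \<Longrightarrow> f \<in> Hom C X Y \<Longrightarrow> Comp C X X Y f (Ident C X) = f"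
  by (simp add: category_def)

lemma category_assoc:
  "category C \<Longrightarrow> X \<in> Obj C \<Longrightarrow> Y \<in> Obj C \<Longrightarrow> Z \<in> Obj C \<Longrightarrow> V \<in> Obj C \<Longrightarrow>
    f \<in> Hom C X Y \<Longrightarrow> g \<in> Hom C Y Z \<Longrightarrow> h \<in> Hom C Z V \<Longrightarrow>
    Comp C X Z V h (Comp C X Y Z g f) = Comp C X Y V (Comp C Y Z V h g) f"
  unfolding category_def by blast

text \<open>All structure of \<open>D\<close> is read off in \<open>C\<close> through the bijections
  \<open>T\<close>, so the category axioms of \<open>D\<close> come out as a conclusion. A choice
  \<open>S\<close> of preimages under \<open>P\<close> gives the functor from \<open>C\<close>, and
  \<open>P\<close> with the inverses of \<open>T\<close> is its quasi-inverse.\<close>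

lemma equivalent_categories_transport:
  fixes C :: "('o, 'a) precat" and D :: "('p, 'b) precat"
    and P :: "'p \<Rightarrow> 'o" and T :: "'p \<Rightarrow> 'p \<Rightarrow> 'a \<Rightarrow> 'b"
  assumes C: "category C"
    and surj: "P ` Obj D = Obj C"
    and Hom: "\<And>X Y. X \<in> Obj D \<Longrightarrow> Y \<in> Obj D \<Longrightarrow> Hom D X Y = T X Y ` Hom C (P X) (P Y)"
    and inj: "\<And>X Y. X \<in> Obj D \<Longrightarrow> Y \<in> Obj D \<Longrightarrow> inj_on (T X Y) (Hom C (P X) (P Y))"
    and Ident: "\<And>X. X \<in> Obj D \<Longrightarrow> T X X (Ident C (P X)) = Ident D X"
    and Comp: "\<And>X Y Z f g. X \<in> Obj D \<Longrightarrow> Y \<in> Obj D \<Longrightarrow> Z \<in> Obj D \<Longrightarrow>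
       f \<in> Hom C (P X) (P Y) \<Longrightarrow> g \<in> Hom C (P Y) (P Z) \<Longrightarrow>
       T X Z (Comp C (P X) (P Y) (P Z) g f) = Comp D X Y Z (T Y Z g) (T X Y f)"
  shows "equivalent_categories C D"
proof -
  note CI = category_Ident[OF C] and CC = category_Comp[OF C] and CL = category_Ident_left[OF C]
    and CR = category_Ident_right[OF C] and CA = category_assoc[OF C]
  have P: "P X \<in> Obj C" if "X \<in> Obj D" for X using surj that by blast
  have T: "T X Y f \<in> Hom D X Y" if "X \<in> Obj D" "Y \<in> Obj D" "f \<in> Hom C (P X) (P Y)" for X Y f
    using that Hom by blast
  have D: "category D"
    unfolding category_def
  proof (intro conjI ballI)
    fix X assume X: "X \<in> Obj D"
    show "Ident D X \<in> Hom D X X"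
      using T[OF X X CI[OF P[OF X]]] Ident[OF X] by simp
  next
    fix X Y Z f g assume o: "X \<in> Obj D" "Y \<in> Obj D" "Z \<in> Obj D"
      and f: "f \<in> Hom D X Y" and g: "g \<in> Hom D Y Z"
    obtain f' where f': "f' \<in> Hom C (P X) (P Y)" "f = T X Y f'" using f Hom o by auto
    obtain g' where g': "g' \<in> Hom C (P Y) (P Z)" "g = T Y Z g'" using g Hom o by auto
    show "Comp D X Y Z g f \<in> Hom D X Z"
      using T[OF o(1,3) CC[OF o[THEN P] f'(1) g'(1)]] Comp[OF o f'(1) g'(1)] f' g' by simp
  next
    fix X Y f assume o: "X \<in> Obj D" "Y \<in> Obj D" and f: "f \<in> Hom D X Y"
    obtain f' where f': "f' \<in> Hom C (P X) (P Y)" "f = T X Y f'" using f Hom o by auto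
    show "Comp D X Y Y (Ident D Y) f = f"
      using Comp[OF o(1,2,2) f'(1) CI[OF P[OF o(2)]]] CL[OF o[THEN P] f'(1)] f' Ident[OF o(2)] by simp
    show "Comp D X X Y f (Ident D X) = f"
      using Comp[OF o(1,1,2) CI[OF P[OF o(1)]] f'(1)] CR[OF o[THEN P] f'(1)] f' Ident[OF o(1)] by simp
  next
    fix X Y Z V f g h assume o: "X \<in> Obj D" "Y \<in> Obj D" "Z \<in> Obj D" "V \<in> Obj D"
      and f: "f \<in> Hom D X Y" and g: "g \<in> Hom D Y Z" and h: "h \<in> Hom D Z V"
    obtain f' where f': "f' \<in> Hom C (P X) (P Y)" "f = T X Y f'" using f Hom o by auto
    obtain g' where g': "g' \<in> Hom C (P Y) (P Z)" "g = T Y Z g'" using g Hom o by auto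
    obtain h' where h': "h' \<in> Hom C (P Z) (P V)" "h = T Z V h'" using h Hom o by auto
    show "Comp D X Z V h (Comp D X Y Z g f) = Comp D X Y V (Comp D Y Z V h g) f"
      using CA[OF o[THEN P] f'(1) g'(1) h'(1)] f'(2) g'(2) h'(2)
        Comp[OF o(1,2,3) f'(1) g'(1)] Comp[OF o(2,3,4) g'(1) h'(1)]
        Comp[OF o(1,3,4) CC[OF o(1-3)[THEN P] f'(1) g'(1)] h'(1)]
        Comp[OF o(1,2,4) f'(1) CC[OF o(2-4)[THEN P] g'(1) h'(1)]] by simp
  qed
  define S where "S = inv_into (Obj D) P"
  have S: "S A \<in> Obj D" "P (S A) = A" if "A \<in> Obj C" for A
    using that surj unfolding S_def by (metis inv_into_into, metis f_inv_into_f)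
  define F :: "('o, 'a, 'p, 'b) func" where
    "F = \<lparr>on_obj = S, on_hom = (\<lambda>A B. T (S A) (S B))\<rparr>"
  define I where "I X Y = inv_into (Hom C (P X) (P Y)) (T X Y)" for X Y
  have IT: "I X Y (T X Y f) = f"
    if "X \<in> Obj D" "Y \<in> Obj D" "f \<in> Hom C (P X) (P Y)" for X Y f
    using inj that by (simp add: I_def)
  define F' :: "('p, 'b, 'o, 'a) func" where "F' = \<lparr>on_obj = P, on_hom = I\<rparr>"
  have F: "is_functor C D F"
    unfolding is_functor_def F_def using S T Comp Ident by simp (metis Comp S)
  have F': "is_functor D C F'"
    unfolding is_functor_def F'_def func.simps
  proof (intro conjI ballI)
    fix X Y f assume o: "X \<in> Obj D" "Y \<in> Obj D" and f: "f \<in> Hom D X Y"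
    obtain f' where f': "f' \<in> Hom C (P X) (P Y)" "f = T X Y f'" using f Hom o by auto
    then show "I X Y f \<in> Hom C (P X) (P Y)" using IT o by simp
  next
    fix X assume X: "X \<in> Obj D"
    show "I X X (Ident D X) = Ident C (P X)"
      using IT[OF X X CI[OF P[OF X]]] Ident[OF X] by simp
  next
    fix X Y Z f g assume o: "X \<in> Obj D" "Y \<in> Obj D" "Z \<in> Obj D"
      and f: "f \<in> Hom D X Y" and g: "g \<in> Hom D Y Z"
    obtain f' where f': "f' \<in> Hom C (P X) (P Y)" "f = T X Y f'" using f Hom o by auto
    obtain g' where g': "g' \<in> Hom C (P Y) (P Z)" "g = T Y Z g'" using g Hom o by auto
    show "I X Z (Comp D X Y Z g f) = Comp C (P X) (P Y) (P Z) (I Y Z g) (I X Y f)"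
      using IT[OF o(1,3) CC[OF o[THEN P] f'(1) g'(1)]] Comp[OF o f'(1) g'(1)] f' g' IT o by simp
  qed (use P in auto)
  have eta: "natural_iso C C id_func (comp_func F' F) (Ident C)"
    unfolding natural_iso_def id_func_def comp_func_def F_def F'_def is_iso_in_def func.simps
  proof (intro conjI ballI)
    fix A assume A: "A \<in> Obj C"
    show "Ident C A \<in> Hom C A (P (S A))" using CI A S by simp
    show "\<exists>g\<in>Hom C (P (S A)) A. Comp C A (P (S A)) A g (Ident C A) = Ident C A \<and>
        Comp C (P (S A)) A (P (S A)) (Ident C A) g = Ident C (P (S A))"
      using CI A S CL[OF A A CI[OF A]] by (intro bexI[of _ "Ident C A"]) auto
  next
    fix A B f assume o: "A \<in> Obj C" "B \<in> Obj C" and f: "f \<in> Hom C A B"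
    show "Comp C A B (P (S B)) (Ident C B) f =
        Comp C A (P (S A)) (P (S B)) (I (S A) (S B) (T (S A) (S B) f)) (Ident C A)"
      using S o f IT CL CR by simp
  qed
  \<comment> \<open>\<open>S (P X)\<close> and \<open>X\<close> lie over the same object of
    \<open>C\<close>, so the identity of \<open>P X\<close> lifts to mutually inverse morphisms
    between them.\<close>
  have eps: "natural_iso D D (comp_func F F') id_func (\<lambda>X. T (S (P X)) X (Ident C (P X)))"
    unfolding natural_iso_def id_func_def comp_func_def F_def F'_def is_iso_in_def func.simps
  proof (intro conjI ballI)
    fix X assume X: "X \<in> Obj D"
    note s = S[OF P[OF X]]
    have i: "Ident C (P X) \<in> Hom C (P (S (P X))) (P X)" "Ident C (P X) \<in> Hom C (P X) (P (S (P X)))"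
      using CI[OF P[OF X]] s by auto
    note ii = CL[OF P[OF X] P[OF X] CI[OF P[OF X]]]
    show "T (S (P X)) X (Ident C (P X)) \<in> Hom D (S (P X)) X"
      using T[OF s(1) X i(1)] .
    show "\<exists>g\<in>Hom D X (S (P X)). Comp D (S (P X)) X (S (P X)) g (T (S (P X)) X (Ident C (P X))) =
         Ident D (S (P X)) \<and> Comp D X (S (P X)) X (T (S (P X)) X (Ident C (P X))) g = Ident D X"
      using T[OF X s(1) i(2)] Comp[OF s(1) X s(1) i(1) i(2)] Comp[OF X s(1) X i(2) i(1)] ii
        Ident[OF X] Ident[OF s(1)] s(2)
      by (intro bexI[of _ "T X (S (P X)) (Ident C (P X))"]) auto
  next
    fix X Y f assume o: "X \<in> Obj D" "Y \<in> Obj D" and f: "f \<in> Hom D X Y"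
    obtain f' where f': "f' \<in> Hom C (P X) (P Y)" "f = T X Y f'" using f Hom o by auto
    note sX = S[OF P[OF o(1)]] and sY = S[OF P[OF o(2)]]
    show "Comp D (S (P X)) (S (P Y)) Y (T (S (P Y)) Y (Ident C (P Y)))
           (T (S (P X)) (S (P Y)) (I X Y f)) =
         Comp D (S (P X)) X Y f (T (S (P X)) X (Ident C (P X)))"
      using Comp[OF sX(1) sY(1) o(2), of f' "Ident C (P Y)"]
        Comp[OF sX(1) o, of "Ident C (P X)" f'] sX(2) sY(2) f' IT[OF o f'(1)]
        CI[OF P[OF o(1)]] CI[OF P[OF o(2)]] CL[OF o[THEN P] f'(1)] CR[OF o[THEN P] f'(1)]
      by simp
  qed
  show ?thesis
    unfolding equivalent_categories_def using C D F F' eta eps by blast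
qed

section \<open>Matrix groups and regular functions\<close>

lemma carrier_GL: "carrier (GL n) = {A \<in> carrier_mat n n. det A \<noteq> 0}"
  using unit_imp_det_non_zero[of _ n "()"] det_non_zero_imp_unit[of _ n "()"]
  by (auto simp: GL_def units_of_def) (auto simp: Units_def ring_mat_def)

lemma mult_GL [simp]: "x \<otimes>\<^bsub>GL n\<^esub> y = x * y"
  by (simp add: GL_def units_of_def ring_mat_def)

lemma one_GL [simp]: "\<one>\<^bsub>GL n\<^esub> = 1\<^sub>m n"
  by (simp add: GL_def units_of_def ring_mat_def)

lemma group_GL: "group (GL n)"
proof -
  interpret ring "ring_mat TYPE(complex) n ()" by (rule ring_mat)
  show ?thesis unfolding GL_def by (rule units_group)
qed

lemma carrier_GL_D: "A \<in> carrier (GL n) \<Longrightarrow> A \<in> carrier_mat n n"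
  by (simp add: carrier_GL)

lemma inv_GL:
  assumes "A \<in> carrier (GL n)"
  shows "inv\<^bsub>GL n\<^esub> A \<in> carrier (GL n)" "inv\<^bsub>GL n\<^esub> A * A = 1\<^sub>m n" "A * inv\<^bsub>GL n\<^esub> A = 1\<^sub>m n"
  using group.inv_closed[OF group_GL assms] group.l_inv[OF group_GL assms]
    group.r_inv[OF group_GL assms] by auto

lemma det_inv_GL:
  assumes "A \<in> carrier (GL n)"
  shows "det (inv\<^bsub>GL n\<^esub> A) = inverse (det A)"
proof -
  have "det (inv\<^bsub>GL n\<^esub> A) * det A = 1"
    using arg_cong[OF inv_GL(2)[OF assms], of det] inv_GL(1)[OF assms] assms
    by (simp add: det_mult[of _ n] carrier_GL_D)
  then show ?thesis using inverse_unique mult.commute by metis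
qed

lemma inv_GL_eqI:
  "A \<in> carrier (GL n) \<Longrightarrow> B \<in> carrier (GL n) \<Longrightarrow> B * A = 1\<^sub>m n \<Longrightarrow> inv\<^bsub>GL n\<^esub> A = B"
  by (rule group.inv_equality[OF group_GL]) simp_all

text \<open>Cramer's rule; it writes the entries of the inverse in terms of the generators of the
  coordinate ring.\<close>

lemma inv_GL_index:
  assumes A: "A \<in> carrier (GL n)" and ij: "i < n" "j < n"
  shows "(inv\<^bsub>GL n\<^esub> A) $$ (i, j) = inverse (det A) * cofactor A j i"
proof -
  have An: "A \<in> carrier_mat n n" and d: "det A \<noteq> 0" using A by (auto simp: carrier_GL)
  let ?B = "inverse (det A) \<cdot>\<^sub>m adj_mat A"
  have B: "?B \<in> carrier_mat n n" using adj_mat(1)[OF An] by simp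
  have 1: "?B * A = 1\<^sub>m n"
    using adj_mat(3)[OF An] mult_smult_assoc_mat[OF adj_mat(1)[OF An] An] d adj_mat(1)[OF An] by (intro eq_matI) auto
  have "det ?B * det A = 1" using arg_cong[OF 1, of det] det_mult[OF B An] by simp
  then have "?B \<in> carrier (GL n)" using B by (auto simp: carrier_GL)
  from inv_GL_eqI[OF A this 1] have "(inv\<^bsub>GL n\<^esub> A) = ?B" .
  then show ?thesis using ij An by (simp add: adj_mat_def)
qed

section \<open>Regular functions on sets of invertible matrices\<close>

definition regular_on :: "complex set \<Rightarrow> nat \<Rightarrow> complex mat set \<Rightarrow> (complex mat \<Rightarrow> complex) \<Rightarrow> bool" where
  "regular_on K n S f \<longleftrightarrow> (\<exists>p\<in>coord_ring K n. \<forall>A\<in>S. f A = p A)"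

lemma regular_on_cong:
  "regular_on K n S f \<Longrightarrow> (\<And>A. A \<in> S \<Longrightarrow> f A = g A) \<Longrightarrow> regular_on K n S g"
  unfolding regular_on_def by metis

lemma regular_on_coord_ring: "p \<in> coord_ring K n \<Longrightarrow> regular_on K n S p"
  unfolding regular_on_def by blast

lemma regular_on_const: "c \<in> K \<Longrightarrow> regular_on K n S (\<lambda>_. c)"
  by (rule regular_on_coord_ring, rule coord_ring.const)

lemma regular_on_entry: "i < n \<Longrightarrow> j < n \<Longrightarrow> regular_on K n S (\<lambda>A. A $$ (i, j))"
  by (rule regular_on_coord_ring, rule coord_ring.entry)

lemma regular_on_inverse_det: "regular_on K n S (\<lambda>A. inverse (det A))"
  by (rule regular_on_coord_ring, rule coord_ring.inv_det)

lemma regular_on_add: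
  assumes "regular_on K n S f" "regular_on K n S g"
  shows "regular_on K n S (\<lambda>A. f A + g A)"
proof -
  obtain p q where "p \<in> coord_ring K n" "q \<in> coord_ring K n" "\<forall>A\<in>S. f A = p A" "\<forall>A\<in>S. g A = q A"
    using assms unfolding regular_on_def by blast
  then show ?thesis
    unfolding regular_on_def by (intro bexI[of _ "\<lambda>A. p A + q A"]) (auto intro: coord_ring.add)
qed

lemma regular_on_mult:
  assumes "regular_on K n S f" "regular_on K n S g"
  shows "regular_on K n S (\<lambda>A. f A * g A)"
proof -
  obtain p q where "p \<in> coord_ring K n" "q \<in> coord_ring K n" "\<forall>A\<in>S. f A = p A" "\<forall>A\<in>S. g A = q A"
    using assms unfolding regular_on_def by blast
  then show ?thesis
    unfolding regular_on_def by (intro bexI[of _ "\<lambda>A. p A * q A"]) (auto intro: coord_ring.mult)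
qed

lemma regular_on_diff:
  assumes "-1 \<in> K" "regular_on K n S f" "regular_on K n S g"
  shows "regular_on K n S (\<lambda>A. f A - g A)"
  using regular_on_add[OF assms(2) regular_on_mult[OF regular_on_const[OF assms(1)] assms(3)]]
  by simp

lemma regular_on_sum:
  assumes "0 \<in> K" "\<And>i. i \<in> I \<Longrightarrow> regular_on K n S (f i)"
  shows "regular_on K n S (\<lambda>A. \<Sum>i\<in>I. f i A)"
proof (cases "finite I")
  case True
  then show ?thesis using assms(2)
    by (induction I) (auto intro: regular_on_const[OF assms(1)] regular_on_add)
qed (auto intro: regular_on_const[OF assms(1)])

lemma regular_on_prod:
  assumes "1 \<in> K" "\<And>i. i \<in> I \<Longrightarrow> regular_on K n S (f i)"
  shows "regular_on K n S (\<lambda>A. \<Prod>i\<in>I. f i A)"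
proof (cases "finite I")
  case True
  then show ?thesis using assms(2)
    by (induction I) (auto intro: regular_on_const[OF assms(1)] regular_on_mult)
qed (auto intro: regular_on_const[OF assms(1)])

text \<open>Leibniz formula; its signs are the reason for having -1 in \<open>K\<close>.\<close>

lemma regular_on_det:
  assumes K: "0 \<in> K" "1 \<in> K" "-1 \<in> K"
    and F: "\<And>A. A \<in> S \<Longrightarrow> F A \<in> carrier_mat m m"
    and reg: "\<And>i j. i < m \<Longrightarrow> j < m \<Longrightarrow> regular_on K n S (\<lambda>A. F A $$ (i, j))"
  shows "regular_on K n S (\<lambda>A. det (F A))"
proof (rule regular_on_cong)
  show "regular_on K n S (\<lambda>A. \<Sum>p | p permutes {0..<m}.
      signof p * (\<Prod>i = 0..<m. F A $$ (i, p i)))"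
    using K by (intro regular_on_sum regular_on_mult regular_on_prod reg regular_on_const)
      (auto simp: sign_def permutes_in_image)
qed (simp add: det_def'[OF F])

lemma regular_on_mat_mult:
  assumes "0 \<in> K" "i < k" "j < l"
    and "\<And>A. A \<in> S \<Longrightarrow> F A \<in> carrier_mat k m" "\<And>A. A \<in> S \<Longrightarrow> F' A \<in> carrier_mat m l"
    and "\<And>i j. i < k \<Longrightarrow> j < m \<Longrightarrow> regular_on K n S (\<lambda>A. F A $$ (i, j))"
    and "\<And>i j. i < m \<Longrightarrow> j < l \<Longrightarrow> regular_on K n S (\<lambda>A. F' A $$ (i, j))"
  shows "regular_on K n S (\<lambda>A. (F A * F' A) $$ (i, j))"
proof (rule regular_on_cong)
  show "regular_on K n S (\<lambda>A. \<Sum>q = 0..<m. F A $$ (i, q) * F' A $$ (q, j))"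
    using assms by (intro regular_on_sum regular_on_mult) auto
  show "(\<Sum>q = 0..<m. F A $$ (i, q) * F' A $$ (q, j)) = (F A * F' A) $$ (i, j)" if "A \<in> S" for A
    using assms(4,5)[OF that] assms(2,3) by (auto simp: scalar_prod_def)
qed

lemma regular_on_inv_GL:
  assumes K: "0 \<in> K" "1 \<in> K" "-1 \<in> K" and S: "S \<subseteq> carrier (GL n)" and ij: "i < n" "j < n"
  shows "regular_on K n S (\<lambda>A. (inv\<^bsub>GL n\<^esub> A) $$ (i, j))"
proof (rule regular_on_cong)
  have c: "(-1) ^ (j + i) \<in> K" using K by (cases "even (j + i)") auto
  have S': "A \<in> carrier_mat n n" if "A \<in> S" for A using that S by (auto simp: carrier_GL)
  have "regular_on K n S (\<lambda>A. det (mat_delete A j i))"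
  proof (rule regular_on_det[OF K])
    show "mat_delete A j i \<in> carrier_mat (n - 1) (n - 1)" if "A \<in> S" for A
      using S'[OF that] by (rule mat_delete_carrier)
    fix a b assume ab: "a < n - 1" "b < n - 1"
    show "regular_on K n S (\<lambda>A. mat_delete A j i $$ (a, b))"
    proof (rule regular_on_cong)
      show "regular_on K n S
          (\<lambda>A. A $$ (if a < j then a else Suc a, if b < i then b else Suc b))"
        using ab by (intro regular_on_entry) auto
      show "A $$ (if a < j then a else Suc a, if b < i then b else Suc b) = mat_delete A j i $$ (a, b)"
        if "A \<in> S" for A
        using S'[OF that] ab by (simp add: mat_delete_def)
    qed
  qed
  then show "regular_on K n S (\<lambda>A. inverse (det A) * ((-1) ^ (j + i) * det (mat_delete A j i)))"
    by (intro regular_on_mult regular_on_inverse_det regular_on_const c)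
  show "inverse (det A) * ((-1) ^ (j + i) * det (mat_delete A j i)) = (inv\<^bsub>GL n\<^esub> A) $$ (i, j)"
    if "A \<in> S" for A
    using inv_GL_index[of A n i j] that S ij by (auto simp: cofactor_def)
qed

text \<open>Substituting \<open>F\<close> into the generators of the coordinate ring yields entries
  of \<open>F A\<close>, constants, and the term \<open>inverse (det (F A))\<close>, which entrywise
  regularity does not control; hence the separate hypothesis \<open>det\<close>.\<close>

lemma regular_on_comp_aux:
  assumes F: "F ` S \<subseteq> T"
    and reg: "\<And>i j. i < m \<Longrightarrow> j < m \<Longrightarrow> regular_on K n S (\<lambda>A. F A $$ (i, j))"
    and det: "regular_on K n S (\<lambda>A. inverse (det (F A)))"
    and f: "regular_on K m T f"
  shows "regular_on K n S (\<lambda>A. f (F A))"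
proof -
  obtain p where p: "p \<in> coord_ring K m" "\<And>A. A \<in> T \<Longrightarrow> f A = p A"
    using f unfolding regular_on_def by blast
  from p(1) have "regular_on K n S (\<lambda>A. p (F A))"
    by induction (auto intro: regular_on_const reg det regular_on_add regular_on_mult)
  then show ?thesis
    by (rule regular_on_cong) (use p(2) F in auto)
qed

lemma subgroup_GL_hom_inv:
  assumes S: "subgroup S (GL n)" and F: "F \<in> hom (GL n\<lparr>carrier := S\<rparr>) (GL m)" and A: "A \<in> S"
  shows "F (inv\<^bsub>GL n\<^esub> A) = inv\<^bsub>GL m\<^esub> (F A)" "inv\<^bsub>GL n\<^esub> A \<in> S"
proof -
  interpret group_hom "GL n\<lparr>carrier := S\<rparr>" "GL m" F
    using F group_GL subgroup.subgroup_is_group[OF S group_GL]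
    by (simp add: group_hom_def group_hom_axioms_def)
  show "F (inv\<^bsub>GL n\<^esub> A) = inv\<^bsub>GL m\<^esub> (F A)"
    using hom_inv[of A] A group.m_inv_consistent[OF group_GL S A] by simp
  show "inv\<^bsub>GL n\<^esub> A \<in> S" using S A by (rule subgroup.m_inv_closed)
qed

text \<open>The pullback of \<open>1 / det\<close> along a homomorphism \<open>F\<close> is \<open>det (F (A\<^sup>-\<^sup>1))\<close>, so it is regular.\<close>

lemma regular_on_comp:
  assumes K: "0 \<in> K" "1 \<in> K" "-1 \<in> K"
    and S: "subgroup S (GL n)" and F: "F \<in> hom (GL n\<lparr>carrier := S\<rparr>) (GL m)" and FT: "F ` S \<subseteq> T"
    and reg: "\<And>i j. i < m \<Longrightarrow> j < m \<Longrightarrow> regular_on K n S (\<lambda>A. F A $$ (i, j))"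
    and f: "regular_on K m T f"
  shows "regular_on K n S (\<lambda>A. f (F A))"
proof -
  have SG: "S \<subseteq> carrier (GL n)" using S by (rule subgroup.subset)
  have FG: "F A \<in> carrier (GL m)" if "A \<in> S" for A using F that by (auto simp: hom_def)
  have "regular_on K n S (\<lambda>A. F (inv\<^bsub>GL n\<^esub> A) $$ (i, j))" if "i < m" "j < m" for i j
  proof (rule regular_on_comp_aux[where T = S and m = n and F = "m_inv (GL n)" and f = "\<lambda>A. F A $$ (i, j)"])
    show "m_inv (GL n) ` S \<subseteq> S" using subgroup_GL_hom_inv(2)[OF S F] by blast
    show "regular_on K n S (\<lambda>A. inverse (det (inv\<^bsub>GL n\<^esub> A)))"
    proof (rule regular_on_cong)
      show "regular_on K n S det"
        using regular_on_det[OF K, of S "\<lambda>A. A" n n] SG by (auto intro: regular_on_entry simp: carrier_GL)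
    qed (use det_inv_GL SG in auto)
  qed (fact regular_on_inv_GL[OF K SG], fact reg[OF that])
  then have "regular_on K n S (\<lambda>A. det (F (inv\<^bsub>GL n\<^esub> A)))"
    using FG subgroup_GL_hom_inv(2)[OF S F] by (intro regular_on_det[OF K]) (auto simp: carrier_GL)
  then have "regular_on K n S (\<lambda>A. inverse (det (F A)))"
    by (rule regular_on_cong) (use FG subgroup_GL_hom_inv[OF S F] det_inv_GL in auto)
  from regular_on_comp_aux[OF FT reg this f] show ?thesis .
qed

section \<open>Zariski closed sets and their preimages\<close>

lemma zariski_closed_subset: "zariski_closed K n V \<Longrightarrow> V \<subseteq> carrier (GL n)"
  unfolding zariski_closed_def by auto

lemma zariski_closed_separate:
  assumes "zariski_closed K n V" "A \<in> carrier (GL n)" "A \<notin> V"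
  obtains p where "p \<in> coord_ring K n" "p A \<noteq> 0" "\<And>B. B \<in> V \<Longrightarrow> p B = 0"
  using assms unfolding zariski_closed_def by auto

lemma zariski_closedI:
  assumes V: "V \<subseteq> carrier (GL n)"
    and sep: "\<And>A. A \<in> carrier (GL n) \<Longrightarrow> A \<notin> V \<Longrightarrow> \<exists>p\<in>coord_ring K n. p A \<noteq> 0 \<and> (\<forall>B\<in>V. p B = 0)"
  shows "zariski_closed K n V"
  unfolding zariski_closed_def
proof (intro exI conjI)
  let ?P = "{p \<in> coord_ring K n. \<forall>B\<in>V. p B = 0}"
  show "?P \<subseteq> coord_ring K n" by auto
  show "V = {A \<in> carrier (GL n). \<forall>p\<in>?P. p A = 0}"
  proof
    show "{A \<in> carrier (GL n). \<forall>p\<in>?P. p A = 0} \<subseteq> V"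
    proof
      fix A assume A: "A \<in> {A \<in> carrier (GL n). \<forall>p\<in>?P. p A = 0}"
      show "A \<in> V"
      proof (rule ccontr)
        assume "A \<notin> V"
        then obtain p where "p \<in> coord_ring K n" "p A \<noteq> 0" "\<forall>B\<in>V. p B = 0"
          using A sep by blast
        then show False using A by simp
      qed
    qed
  qed (use V in auto)
qed

text \<open>The functions in \<open>F\<close> are represented by coordinate functions only on
  \<open>V\<close>. A point outside \<open>V\<close> is therefore separated by an equation of
  \<open>V\<close>, and a point of \<open>V\<close> by a representative of some
  \<open>f\<close>.\<close>

lemma zariski_closed_regular_zeros:
  assumes V: "zariski_closed K n V" and reg: "\<And>f. f \<in> F \<Longrightarrow> regular_on K n V f"
  shows "zariski_closed K n {A \<in> V. \<forall>f\<in>F. f A = 0}"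
proof (rule zariski_closedI)
  show "{A \<in> V. \<forall>f\<in>F. f A = 0} \<subseteq> carrier (GL n)" using zariski_closed_subset[OF V] by auto
  fix A assume A: "A \<in> carrier (GL n)" "A \<notin> {A \<in> V. \<forall>f\<in>F. f A = 0}"
  show "\<exists>p\<in>coord_ring K n. p A \<noteq> 0 \<and> (\<forall>B\<in>{A \<in> V. \<forall>f\<in>F. f A = 0}. p B = 0)"
  proof (cases "A \<in> V")
    case True
    then obtain f where f: "f \<in> F" "f A \<noteq> 0" using A by auto
    obtain p where "p \<in> coord_ring K n" "\<forall>B\<in>V. f B = p B"
      using reg[OF f(1)] unfolding regular_on_def by blast
    then show ?thesis using f True by (intro bexI[of _ p]) auto
  next
    case False
    obtain p where "p \<in> coord_ring K n" "p A \<noteq> 0" "\<And>B. B \<in> V \<Longrightarrow> p B = 0"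
      using zariski_closed_separate[OF V A(1) False] by blast
    then show ?thesis by (intro bexI[of _ p]) auto
  qed
qed

text \<open>\<open>F\<close> is taken to be a homomorphism on a subgroup so that
  \<open>regular_on_comp\<close> can pull back 1 / det as well.\<close>

lemma zariski_closed_preimage:
  assumes K: "0 \<in> K" "1 \<in> K" "-1 \<in> K"
    and S: "subgroup S (GL n)" "zariski_closed K n S" and F: "F \<in> hom (GL n\<lparr>carrier := S\<rparr>) (GL m)"
    and reg: "\<And>i j. i < m \<Longrightarrow> j < m \<Longrightarrow> regular_on K n S (\<lambda>A. F A $$ (i, j))"
    and V: "zariski_closed K m V"
  shows "zariski_closed K n {A \<in> S. F A \<in> V}"
proof -
  obtain P where P: "P \<subseteq> coord_ring K m" "V = {A \<in> carrier (GL m). \<forall>p\<in>P. p A = 0}"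
    using V unfolding zariski_closed_def by blast
  have FG: "F A \<in> carrier (GL m)" if "A \<in> S" for A using F that by (auto simp: hom_def)
  have "zariski_closed K n {A \<in> S. \<forall>f\<in>(\<lambda>p A. p (F A)) ` P. f A = 0}"
  proof (rule zariski_closed_regular_zeros[OF S(2)])
    fix f assume "f \<in> (\<lambda>p A. p (F A)) ` P"
    then obtain p where p: "p \<in> coord_ring K m" "f = (\<lambda>A. p (F A))" using P(1) by auto
    show "regular_on K n S f"
      unfolding p(2) using regular_on_comp[OF K S(1) F subset_UNIV reg regular_on_coord_ring[OF p(1)]] .
  qed
  also have "{A \<in> S. \<forall>f\<in>(\<lambda>p A. p (F A)) ` P. f A = 0} = {A \<in> S. F A \<in> V}"
    using P(2) FG by auto
  finally show ?thesis .
qed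

section \<open>Real structures\<close>

lemma coord_ring_mono: "p \<in> coord_ring K n \<Longrightarrow> K \<subseteq> L \<Longrightarrow> p \<in> coord_ring L n"
  by (induction rule: coord_ring.induct) (auto intro: coord_ring.intros)

lemma zariski_closed_mono:
  assumes V: "zariski_closed K n V" and L: "K \<subseteq> L"
  shows "zariski_closed L n V"
proof -
  have "coord_ring K n \<subseteq> coord_ring L n" using coord_ring_mono L by blast
  then show ?thesis using V unfolding zariski_closed_def by (elim exE conjE) (rule exI, rule conjI, erule (1) subset_trans)
qed

text \<open>The splitting concerns coefficients, not values: \<open>q\<close> and \<open>r\<close>
  still take complex values. It expresses that the complex coordinate ring is the real one plus i
  times the real one.\<close>

lemma coord_ring_Re_Im:
  assumes "p \<in> coord_ring UNIV n"
  obtains q r where "q \<in> coord_ring \<real> n" "r \<in> coord_ring \<real> n" "\<And>A. p A = q A + \<i> * r A"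
proof -
  have z: "(\<lambda>_. 0) \<in> coord_ring \<real> n" by (rule coord_ring.const) simp
  from assms have "\<exists>q\<in>coord_ring \<real> n. \<exists>r\<in>coord_ring \<real> n. \<forall>A. p A = q A + \<i> * r A"
  proof induction
    case (const c)
    show ?case
      by (rule bexI[of _ "\<lambda>_. of_real (Re c)"], rule bexI[of _ "\<lambda>_. of_real (Im c)"])
        (auto intro: coord_ring.const simp: complex_eq[symmetric] mult.commute)
  next
    case (entry i j)
    show ?case using coord_ring.entry[OF entry] z by (metis add.right_neutral mult_zero_right)
  next
    case inv_det
    show ?case using coord_ring.inv_det z by (metis (no_types, lifting) add.right_neutral mult_zero_right)
  next
    case (add p q)
    then obtain a b c d where "a \<in> coord_ring \<real> n" "b \<in> coord_ring \<real> n" "c \<in> coord_ring \<real> n"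
      "d \<in> coord_ring \<real> n" and e: "\<forall>A. p A = a A + \<i> * b A" "\<forall>A. q A = c A + \<i> * d A" by blast
    then have "(\<lambda>A. a A + c A) \<in> coord_ring \<real> n" "(\<lambda>A. b A + d A) \<in> coord_ring \<real> n"
      by (auto intro: coord_ring.add)
    then show ?case using e
      by (intro bexI[of _ "\<lambda>A. a A + c A"] bexI[of _ "\<lambda>A. b A + d A"]) (auto simp: algebra_simps)
  next
    case (mult p q)
    then obtain a b c d where abcd: "a \<in> coord_ring \<real> n" "b \<in> coord_ring \<real> n" "c \<in> coord_ring \<real> n"
      "d \<in> coord_ring \<real> n" and e: "\<forall>A. p A = a A + \<i> * b A" "\<forall>A. q A = c A + \<i> * d A" by blast
    have "(\<lambda>A. a A * c A + (-1) * (b A * d A)) \<in> coord_ring \<real> n"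
      "(\<lambda>A. a A * d A + b A * c A) \<in> coord_ring \<real> n"
      using abcd by (intro coord_ring.add coord_ring.mult coord_ring.const, simp_all)+
    then show ?case using e
      by (intro bexI[of _ "\<lambda>A. a A * c A + (-1) * (b A * d A)"] bexI[of _ "\<lambda>A. a A * d A + b A * c A"])
        (auto simp: algebra_simps)
  qed
  then show ?thesis using that by blast
qed

lemma cnj_comm_ring_hom: "comm_ring_hom cnj"
  by unfold_locales auto

lemma det_map_mat_cnj: "det (map_mat cnj A) = cnj (det A)"
  by (rule comm_ring_hom.hom_det[OF cnj_comm_ring_hom])

lemma map_mat_cnj_mult:
  "A \<in> carrier_mat k m \<Longrightarrow> B \<in> carrier_mat m l \<Longrightarrow> map_mat cnj (A * B) = map_mat cnj A * map_mat cnj B"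
  by (intro eq_matI) (auto simp: scalar_prod_def)

lemma map_mat_cnj_cnj [simp]: "map_mat cnj (map_mat cnj A) = A"
  by (intro eq_matI) auto

lemma map_mat_cnj_GL: "A \<in> carrier (GL n) \<Longrightarrow> map_mat cnj A \<in> carrier (GL n)"
  by (auto simp: carrier_GL det_map_mat_cnj)

lemma coord_ring_real_cnj:
  "q \<in> coord_ring \<real> n \<Longrightarrow> A \<in> carrier_mat n n \<Longrightarrow> q (map_mat cnj A) = cnj (q A)"
  by (induction rule: coord_ring.induct) (auto simp: det_map_mat_cnj Reals_cnj_iff)

lemma zariski_closed_real_cnj:
  assumes "zariski_closed \<real> n V" "A \<in> V"
  shows "map_mat cnj A \<in> V"
proof -
  obtain P where P: "P \<subseteq> coord_ring \<real> n" "V = {A \<in> carrier (GL n). \<forall>p\<in>P. p A = 0}"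
    using assms(1) unfolding zariski_closed_def by blast
  have "p (map_mat cnj A) = 0" if "p \<in> P" for p
    using that P assms(2) coord_ring_real_cnj[of p n A] by (auto simp: carrier_GL_D)
  then show ?thesis using P(2) assms(2) by (simp add: map_mat_cnj_GL)
qed

lemma complex_lin_cnj_eq_0:
  assumes "q + \<i> * r = 0" "cnj q + \<i> * cnj r = 0"
  shows "q = 0 \<and> r = 0"
proof -
  have "q - \<i> * r = 0" using arg_cong[OF assms(2), of cnj] by simp
  moreover have "2 * q = (q + \<i> * r) + (q - \<i> * r)" by simp
  ultimately have "q = 0" using assms(1) by simp
  then show ?thesis using assms(1) by simp
qed

text \<open>Write a separating function as q + i r with real coefficients. Evaluating it at B and at
  the conjugate of B, both in \<open>V\<close>, shows that q and r vanish on \<open>V\<close>; at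
  the point to be separated one of them is nonzero.\<close>

lemma zariski_closed_real_of_cnj:
  assumes V: "zariski_closed UNIV n V" and cnj: "\<And>A. A \<in> V \<Longrightarrow> map_mat cnj A \<in> V"
  shows "zariski_closed \<real> n V"
proof (rule zariski_closedI)
  show VG: "V \<subseteq> carrier (GL n)" using V by (rule zariski_closed_subset)
  fix A assume A: "A \<in> carrier (GL n)" "A \<notin> V"
  obtain p where p: "p \<in> coord_ring UNIV n" "p A \<noteq> 0" "\<And>B. B \<in> V \<Longrightarrow> p B = 0"
    using zariski_closed_separate[OF V A] by blast
  obtain q r where qr: "q \<in> coord_ring \<real> n" "r \<in> coord_ring \<real> n" "\<And>A. p A = q A + \<i> * r A"
    using coord_ring_Re_Im[OF p(1)] by blast
  have z: "q B = 0 \<and> r B = 0" if "B \<in> V" for B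
  proof (rule complex_lin_cnj_eq_0)
    show "q B + \<i> * r B = 0" using p(3)[OF that] qr(3) by simp
    have Bn: "B \<in> carrier_mat n n" using that VG carrier_GL_D by blast
    show "cnj (q B) + \<i> * cnj (r B) = 0"
      using p(3)[OF cnj[OF that]] qr(3) coord_ring_real_cnj[OF qr(1) Bn] coord_ring_real_cnj[OF qr(2) Bn]
      by simp
  qed
  have "q A \<noteq> 0 \<or> r A \<noteq> 0" using p(2) qr(3) by auto
  then show "\<exists>p\<in>coord_ring \<real> n. p A \<noteq> 0 \<and> (\<forall>B\<in>V. p B = 0)"
    using qr(1,2) z by (elim disjE) (rule bexI[of _ q], simp_all, rule bexI[of _ r], simp_all)
qed

text \<open>With f = q + i r as before, comparing f at the conjugate of A with the conjugate of f at
  A forces r = 0 on \<open>S\<close>, so the real part q represents f.\<close>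

lemma regular_on_real_of_cnj:
  assumes f: "regular_on UNIV n S f" and S: "S \<subseteq> carrier_mat n n"
    and cnj: "\<And>A. A \<in> S \<Longrightarrow> map_mat cnj A \<in> S" "\<And>A. A \<in> S \<Longrightarrow> f (map_mat cnj A) = cnj (f A)"
  shows "regular_on \<real> n S f"
proof -
  obtain p where p: "p \<in> coord_ring UNIV n" "\<And>A. A \<in> S \<Longrightarrow> f A = p A"
    using f unfolding regular_on_def by blast
  obtain q r where qr: "q \<in> coord_ring \<real> n" "r \<in> coord_ring \<real> n" "\<And>A. p A = q A + \<i> * r A"
    using coord_ring_Re_Im[OF p(1)] by blast
  have "f A = q A" if A: "A \<in> S" for A
  proof -
    have An: "A \<in> carrier_mat n n" using A S by auto
    have "cnj (q A) + \<i> * cnj (r A) = cnj (q A + \<i> * r A)"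
      using cnj[OF A] p(2)[OF A] p(2)[OF cnj(1)[OF A]] qr(3)
        coord_ring_real_cnj[OF qr(1) An] coord_ring_real_cnj[OF qr(2) An] by simp
    then have "r A = 0" by simp
    then show ?thesis using p(2)[OF A] qr(3) by simp
  qed
  then show ?thesis unfolding regular_on_def using qr(1) by blast
qed

section \<open>Algebraic isomorphisms\<close>

lemma pts_simps [simp]:
  "carrier (pts H) = snd H" "x \<otimes>\<^bsub>pts H\<^esub> y = x * y" "\<one>\<^bsub>pts H\<^esub> = 1\<^sub>m (fst H)"
  by (simp_all add: pts_def)

lemma real_alg_group_subgroup: "real_alg_group H \<Longrightarrow> subgroup (snd H) (GL (fst H))"
  by (simp add: real_alg_group_def)

lemma group_pts: "real_alg_group H \<Longrightarrow> group (pts H)"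
  unfolding pts_def by (rule subgroup.subgroup_is_group[OF real_alg_group_subgroup group_GL])

lemma inv_pts:
  "real_alg_group H \<Longrightarrow> x \<in> snd H \<Longrightarrow> inv\<^bsub>pts H\<^esub> x = inv\<^bsub>GL (fst H)\<^esub> x"
  unfolding pts_def by (rule group.m_inv_consistent[OF group_GL real_alg_group_subgroup])

lemma real_alg_group_GL: "real_alg_group H \<Longrightarrow> x \<in> snd H \<Longrightarrow> x \<in> carrier (GL (fst H))"
  using real_alg_group_subgroup subgroup.subset by blast

lemma real_alg_group_carrier_mat:
  "real_alg_group H \<Longrightarrow> x \<in> snd H \<Longrightarrow> x \<in> carrier_mat (fst H) (fst H)"
  using real_alg_group_GL carrier_GL_D by blast

lemma real_alg_group_cnj: "real_alg_group H \<Longrightarrow> x \<in> snd H \<Longrightarrow> map_mat cnj x \<in> snd H"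
  unfolding real_alg_group_def using zariski_closed_real_cnj by blast

lemma cnj_hom_pts:
  assumes "real_alg_group H"
  shows "map_mat cnj \<in> hom (pts H) (pts H)"
  using real_alg_group_cnj[OF assms]
    map_mat_cnj_mult[OF real_alg_group_carrier_mat[OF assms] real_alg_group_carrier_mat[OF assms]]
  by (auto simp: hom_def)

lemma connected_reductive_real_alg_group: "connected_reductive H \<Longrightarrow> real_alg_group H"
  by (simp add: connected_reductive_def)

locale real_group =
  fixes G :: lin_group
  assumes real_alg: "real_alg_group G"
begin

abbreviation mult_G (infixl "\<cdot>" 70) where "x \<cdot> y \<equiv> x \<otimes>\<^bsub>pts G\<^esub> y"
abbreviation inv_G ("inv\<^sub>G _" [81] 80) where "inv\<^sub>G x \<equiv> inv\<^bsub>pts G\<^esub> x"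
abbreviation Ad where "Ad g x \<equiv> g \<cdot> x \<cdot> inv\<^sub>G g"

sublocale G: group "pts G" by (rule group_pts[OF real_alg])

sublocale cnj: group_hom "pts G" "pts G" "map_mat cnj"
  by unfold_locales (rule cnj_hom_pts[OF real_alg])

end

section \<open>Regular maps and isomorphisms of matrix groups\<close>

lemma regular_map_iff:
  "regular_map K H H' f \<longleftrightarrow> f \<in> snd H \<rightarrow> snd H' \<and>
     (\<forall>i<fst H'. \<forall>j<fst H'. regular_on K (fst H) (snd H) (\<lambda>A. f A $$ (i, j)))"
  by (simp add: regular_map_def regular_on_def)

lemma hom_pts_GL:
  assumes "real_alg_group H'" "f \<in> hom (pts H) (pts H')"
  shows "f \<in> hom (GL (fst H)\<lparr>carrier := snd H\<rparr>) (GL (fst H'))"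
  using assms(2) real_alg_group_GL[OF assms(1)] by (auto simp: hom_def Pi_iff)

lemma regular_map_comp:
  assumes K: "0 \<in> K" "1 \<in> K" "-1 \<in> K"
    and H: "real_alg_group H" "real_alg_group H'"
    and f: "f \<in> hom (pts H) (pts H')" "regular_map K H H' f" and g: "regular_map K H' H'' g"
  shows "regular_map K H H'' (\<lambda>A. g (f A))"
  unfolding regular_map_iff
proof (intro conjI allI impI)
  show "(\<lambda>A. g (f A)) \<in> snd H \<rightarrow> snd H''"
    using f(2) g by (auto simp: regular_map_iff)
  fix i j assume ij: "i < fst H''" "j < fst H''"
  show "regular_on K (fst H) (snd H) (\<lambda>A. g (f A) $$ (i, j))"
  proof (rule regular_on_comp[OF K real_alg_group_subgroup[OF H(1)] hom_pts_GL[OF H(2) f(1)]])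
    show "f ` snd H \<subseteq> snd H'" using f(2) by (auto simp: regular_map_iff)
    show "regular_on K (fst H) (snd H) (\<lambda>A. f A $$ (i, j))" if "i < fst H'" "j < fst H'" for i j
      using f(2) that by (simp add: regular_map_iff)
    show "regular_on K (fst H') (snd H') (\<lambda>A. g A $$ (i, j))"
      using g ij by (simp add: regular_map_iff)
  qed
qed

lemma regular_map_cong:
  assumes f: "regular_map K H H' f" and eq: "\<And>x. x \<in> snd H \<Longrightarrow> f x = g x"
  shows "regular_map K H H' g"
  unfolding regular_map_iff
proof (intro conjI allI impI)
  show "g \<in> snd H \<rightarrow> snd H'" using f eq by (auto simp: regular_map_iff Pi_iff)
  fix i j assume "i < fst H'" "j < fst H'"
  then have "regular_on K (fst H) (snd H) (\<lambda>A. f A $$ (i, j))" using f by (simp add: regular_map_iff)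
  then show "regular_on K (fst H) (snd H) (\<lambda>A. g A $$ (i, j))"
    by (rule regular_on_cong) (simp add: eq)
qed

lemma alg_isoI:
  assumes f: "f \<in> extensional (snd H)" "f \<in> hom (pts H) (pts H')" "regular_map K H H' f"
    and g: "regular_map K H' H g" "\<And>x. x \<in> snd H \<Longrightarrow> g (f x) = x" "\<And>y. y \<in> snd H' \<Longrightarrow> f (g y) = y"
  shows "alg_iso K H H' f"
proof -
  have bij: "bij_betw f (snd H) (snd H')"
    using f(3) g by (intro bij_betw_byWitness[of _ g]) (auto simp: regular_map_iff)
  then have "inv_into (snd H) f y = g y" if "y \<in> snd H'" for y
    using that g by (intro inv_into_f_eq) (auto simp: bij_betw_def regular_map_iff)
  then have "regular_map K H' H (inv_into (snd H) f)"
    by (intro regular_map_cong[OF g(1)]) auto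
  then show ?thesis using f bij by (simp add: alg_iso_def iso_def)
qed

lemma alg_isoD:
  assumes "alg_iso K H H' f"
  shows "f \<in> hom (pts H) (pts H')" "regular_map K H H' f" "regular_map K H' H (inv_into (snd H) f)"
    "f \<in> extensional (snd H)"
    "bij_betw f (snd H) (snd H')" "\<And>x. x \<in> snd H \<Longrightarrow> f x \<in> snd H'"
    "\<And>y. y \<in> snd H' \<Longrightarrow> inv_into (snd H) f y \<in> snd H"
    "\<And>x. x \<in> snd H \<Longrightarrow> inv_into (snd H) f (f x) = x"
    "\<And>y. y \<in> snd H' \<Longrightarrow> f (inv_into (snd H) f y) = y"
proof -
  show "f \<in> hom (pts H) (pts H')" "regular_map K H H' f" "regular_map K H' H (inv_into (snd H) f)"
    "f \<in> extensional (snd H)"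
    and b: "bij_betw f (snd H) (snd H')" using assms by (auto simp: alg_iso_def iso_def)
  show "f x \<in> snd H'" if "x \<in> snd H" for x using b that by (auto simp: bij_betw_def)
  show "inv_into (snd H) f y \<in> snd H" if "y \<in> snd H'" for y
    using b that by (auto simp: bij_betw_def inv_into_into)
  show "inv_into (snd H) f (f x) = x" if "x \<in> snd H" for x
    using b that by (auto simp: bij_betw_def)
  show "f (inv_into (snd H) f y) = y" if "y \<in> snd H'" for y
    using b that by (auto simp: bij_betw_def f_inv_into_f)
qed

lemma alg_iso_comp:
  assumes K: "0 \<in> K" "1 \<in> K" "-1 \<in> K"
    and H: "real_alg_group H" "real_alg_group H'" "real_alg_group H''"
    and f: "alg_iso K H H' f" and g: "alg_iso K H' H'' g"
  shows "alg_iso K H H'' (compose (snd H) g f)"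
proof (rule alg_isoI)
  note f' = alg_isoD[OF f] and g' = alg_isoD[OF g]
  show "compose (snd H) g f \<in> hom (pts H) (pts H'')"
    using f'(1) g'(1) group.is_monoid[OF group_pts[OF H(1)]]
    by (auto simp: hom_def compose_def Pi_iff monoid.m_closed)
      (metis group.is_monoid[OF group_pts[OF H(1)]] monoid.m_closed pts_simps(1,2))
  show "regular_map K H H'' (compose (snd H) g f)"
    using regular_map_comp[OF K H(1,2) f'(1,2) g'(2)]
    by (rule regular_map_cong) (simp add: compose_def)
  have "inv_into (snd H') g \<in> hom (pts H'') (pts H')"
    using group.iso_set_sym[OF group_pts[OF H(2)], of g "pts H''"] g
    by (simp add: alg_iso_def iso_def)
  then show "regular_map K H'' H (\<lambda>y. inv_into (snd H) f (inv_into (snd H') g y))"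
    by (rule regular_map_comp[OF K H(3,2) _ g'(3) f'(3)])
  show "inv_into (snd H) f (inv_into (snd H') g (compose (snd H) g f x)) = x" if "x \<in> snd H" for x
    using that f' g' by (simp add: compose_def)
  show "compose (snd H) g f (inv_into (snd H) f (inv_into (snd H') g y)) = y" if "y \<in> snd H''" for y
    using that f' g' by (simp add: compose_def)
qed (simp add: compose_def)

lemma alg_iso_inv:
  assumes H: "real_alg_group H" and f: "alg_iso K H H' f"
  shows "alg_iso K H' H (\<lambda>y\<in>snd H'. inv_into (snd H) f y)"
proof (rule alg_isoI)
  note f' = alg_isoD[OF f]
  have i: "inv_into (snd H) f \<in> hom (pts H') (pts H)"
    using group.iso_set_sym[OF group_pts[OF H], of f "pts H'"] f
    by (simp add: alg_iso_def iso_def)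
  have c: "x * y \<in> snd H'" if "x \<in> snd H'" "y \<in> snd H'" for x y
  proof -
    have "inv_into (snd H) f x * inv_into (snd H) f y \<in> snd H"
      using group.is_monoid[OF group_pts[OF H]] monoid.m_closed f'(7) that
      by (metis pts_simps(1,2))
    then have "f (inv_into (snd H) f x * inv_into (snd H) f y) \<in> snd H'" by (rule f'(6))
    then show ?thesis
      using hom_mult[OF f'(1), of "inv_into (snd H) f x" "inv_into (snd H) f y"] f'(7,9) that by simp
  qed
  show "(\<lambda>y\<in>snd H'. inv_into (snd H) f y) \<in> hom (pts H') (pts H)"
    using i c by (auto simp: hom_def Pi_iff)
  show "regular_map K H' H (\<lambda>y\<in>snd H'. inv_into (snd H) f y)"
    using f'(3) by (rule regular_map_cong) simp
  show "regular_map K H H' f" by (rule f'(2))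
qed (use alg_isoD[OF f] in simp_all)

lemma (in real_group) regular_map_Ad:
  assumes g: "g \<in> snd G"
  shows "regular_map UNIV G G (\<lambda>x. g * x * inv\<^sub>G g)"
  unfolding regular_map_iff
proof (intro conjI allI impI)
  have ig: "inv\<^sub>G g \<in> snd G" using G.inv_closed[of g] g by simp
  have mc: "x * y \<in> snd G" if "x \<in> snd G" "y \<in> snd G" for x y using G.m_closed[of x y] that by simp
  show "(\<lambda>x. g * x * inv\<^sub>G g) \<in> snd G \<rightarrow> snd G"
    using ig g mc by simp
  fix i j assume ij: "i < fst G" "j < fst G"
  have cm: "x \<in> carrier_mat (fst G) (fst G)" if "x \<in> snd G" for x
    by (rule real_alg_group_carrier_mat[OF real_alg that])
  show "regular_on UNIV (fst G) (snd G) (\<lambda>x. (g * x * inv\<^sub>G g) $$ (i, j))"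
    using cm[OF g] cm[OF ig] cm ij
    by (intro regular_on_mat_mult[where k = "fst G" and l = "fst G" and m = "fst G"]
        regular_on_const regular_on_entry) auto
qed

lemma (in real_group) alg_iso_Ad:
  assumes g: "g \<in> snd G"
  shows "alg_iso UNIV G G (\<lambda>x\<in>snd G. Ad g x)"
proof (rule alg_isoI)
  have g: "g \<in> carrier (pts G)" using g by simp
  have e: "Ad g (x \<cdot> y) =
     (Ad g x) \<cdot> (Ad g y)"
    if "x \<in> carrier (pts G)" "y \<in> carrier (pts G)" for x y
    using g that by (simp add: G.m_assoc G.inv_solve_left' del: pts_simps)
      (metis G.inv_closed G.l_inv G.l_one G.m_assoc G.m_closed)
  show "(\<lambda>x\<in>snd G. Ad g x) \<in> hom (pts G) (pts G)"
    unfolding hom_def pts_simps(1)[of G, symmetric]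
    using g e by (auto simp del: pts_simps)
  show "regular_map UNIV G G (\<lambda>x\<in>snd G. Ad g x)"
    using regular_map_Ad[of g] g by (auto intro: regular_map_cong)
  have ig: "inv\<^sub>G g \<in> snd G" using g by (metis G.inv_closed pts_simps(1))
  show "regular_map UNIV G G (\<lambda>x. inv\<^sub>G g \<cdot> x \<cdot> g)"
    using regular_map_Ad[OF ig] G.inv_inv[OF g] by simp
  have cl: "Ad g x \<in> snd G" "inv\<^sub>G g \<cdot> x \<cdot> g \<in> snd G"
    if "x \<in> snd G" for x
    using that g G.inv_closed[OF g] G.m_closed pts_simps(1) by metis+
  have c: "inv\<^sub>G g \<cdot> (Ad g x) \<cdot> g = x"
    "Ad g (inv\<^sub>G g \<cdot> x \<cdot> g) = x"
    if "x \<in> carrier (pts G)" for x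
    using that g by (simp_all add: G.m_assoc del: pts_simps)
      (metis G.inv_closed G.l_inv G.l_one G.m_assoc G.m_closed G.r_inv G.r_one)+
  show "inv\<^sub>G g \<cdot> (\<lambda>x\<in>snd G. Ad g x) x \<cdot> g = x" if "x \<in> snd G" for x
    using c(1)[of x] that by simp
  show "(\<lambda>x\<in>snd G. Ad g x) (inv\<^sub>G g \<cdot> x \<cdot> g) = x" if "x \<in> snd G" for x
    using c(2)[of x] cl(2)[of x] that by simp
qed simp

lemma regular_map_real_of_cnj:
  assumes H: "real_alg_group H" "real_alg_group H'" and f: "regular_map UNIV H H' f"
    and cnj: "\<And>x. x \<in> snd H \<Longrightarrow> f (map_mat cnj x) = map_mat cnj (f x)"
  shows "regular_map \<real> H H' f"
  unfolding regular_map_iff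
proof (intro conjI allI impI)
  show P: "f \<in> snd H \<rightarrow> snd H'" using f by (simp add: regular_map_iff)
  fix i j assume ij: "i < fst H'" "j < fst H'"
  show "regular_on \<real> (fst H) (snd H) (\<lambda>A. f A $$ (i, j))"
  proof (rule regular_on_real_of_cnj)
    show "regular_on UNIV (fst H) (snd H) (\<lambda>A. f A $$ (i, j))"
      using f ij by (simp add: regular_map_iff)
    fix A assume A: "A \<in> snd H"
    have "f A \<in> carrier_mat (fst H') (fst H')"
      using P A real_alg_group_carrier_mat[OF H(2)] by blast
    then show "f (map_mat cnj A) $$ (i, j) = cnj (f A $$ (i, j))"
      using cnj[OF A] ij by simp
  qed (use real_alg_group_carrier_mat[OF H(1)] real_alg_group_cnj[OF H(1)] in auto)
qed

text \<open>Equivariance passes to the inverse map, so descent of regular functions applies in both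
  directions.\<close>

lemma alg_iso_real_of_cnj:
  assumes H: "real_alg_group H" "real_alg_group H'" and f: "alg_iso UNIV H H' f"
    and cnj: "\<And>x. x \<in> snd H \<Longrightarrow> f (map_mat cnj x) = map_mat cnj (f x)"
  shows "alg_iso \<real> H H' f"
proof -
  note f' = alg_isoD[OF f]
  have "inv_into (snd H) f (map_mat cnj y) = map_mat cnj (inv_into (snd H) f y)" if y: "y \<in> snd H'" for y
    using cnj[OF f'(7)[OF y]] f'(9)[OF y] f'(8)[OF real_alg_group_cnj[OF H(1) f'(7)[OF y]]] by simp
  then have "regular_map \<real> H' H (inv_into (snd H) f)"
    by (rule regular_map_real_of_cnj[OF H(2,1) f'(3)])
  then show ?thesis
    using f regular_map_real_of_cnj[OF H f'(2) cnj] by (simp add: alg_iso_def)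
qed

section \<open>Twisted forms\<close>

text \<open>
  \<open>real_block y b\<close> is the matrix of \<open>y \<oplus> b\<close> in a basis adapted to the real structure
  \<open>(v, w) \<mapsto> (cnj w, cnj v)\<close>, so that complex conjugation of matrices corresponds to exchanging
  and conjugating \<open>y\<close> and \<open>b\<close>.
\<close>

definition real_block :: "complex mat \<Rightarrow> complex mat \<Rightarrow> complex mat" where
  "real_block y b = four_block_mat
     ((1/2) \<cdot>\<^sub>m (y + b)) ((\<i>/2) \<cdot>\<^sub>m (y - b)) ((-\<i>/2) \<cdot>\<^sub>m (y - b)) ((1/2) \<cdot>\<^sub>m (y + b))"

text \<open>A linear retraction of \<open>real_block\<close>: (y + b)/2 - i (i/2)(y - b) = y. Being
  linear in the entries, it serves as the regular inverse of the embedding below.\<close>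

definition block_fst :: "nat \<Rightarrow> complex mat \<Rightarrow> complex mat" where
  "block_fst n M = mat n n (\<lambda>(i, j). M $$ (i, j) - \<i> * M $$ (i, j + n))"

text \<open>Complex conjugation exchanges the two block columns of this matrix. Its inverse sends a
  real vector (a, c) to (a + i c, a - i c), the general fixed point of (v, w) -> (cnj w, cnj
  v).\<close>

definition adapted_base :: "nat \<Rightarrow> complex mat" where
  "adapted_base n = four_block_mat ((1/2) \<cdot>\<^sub>m 1\<^sub>m n) ((1/2) \<cdot>\<^sub>m 1\<^sub>m n) ((-\<i>/2) \<cdot>\<^sub>m 1\<^sub>m n) ((\<i>/2) \<cdot>\<^sub>m 1\<^sub>m n)"

definition adapted_base_inv :: "nat \<Rightarrow> complex mat" where
  "adapted_base_inv n = four_block_mat (1\<^sub>m n) (\<i> \<cdot>\<^sub>m 1\<^sub>m n) (1\<^sub>m n) ((-\<i>) \<cdot>\<^sub>m 1\<^sub>m n)"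

lemma adapted_base_carrier [simp]:
  "adapted_base n \<in> carrier_mat (n + n) (n + n)" "adapted_base_inv n \<in> carrier_mat (n + n) (n + n)"
  by (simp_all add: adapted_base_def adapted_base_inv_def)

lemma adapted_base_inverse:
  "adapted_base n * adapted_base_inv n = 1\<^sub>m (n + n)" "adapted_base_inv n * adapted_base n = 1\<^sub>m (n + n)"
proof -
  note m = mult_four_block_mat[where ?nr1.0 = n and ?nr2.0 = n and ?n1.0 = n and ?n2.0 = n and ?nc1.0 = n and ?nc2.0 = n]
  show "adapted_base n * adapted_base_inv n = 1\<^sub>m (n + n)"
    unfolding adapted_base_def adapted_base_inv_def
    by (subst m, simp_all add: four_block_one_mat[symmetric] del: four_block_one_mat)
      (intro cong_four_block_mat eq_matI; simp)
  show "adapted_base_inv n * adapted_base n = 1\<^sub>m (n + n)"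
    unfolding adapted_base_def adapted_base_inv_def
    by (subst m, simp_all add: four_block_one_mat[symmetric] del: four_block_one_mat)
      (intro cong_four_block_mat eq_matI; simp)
qed

lemma real_block_carrier [simp]:
  "y \<in> carrier_mat n n \<Longrightarrow> b \<in> carrier_mat n n \<Longrightarrow> real_block y b \<in> carrier_mat (n + n) (n + n)"
  by (simp add: real_block_def)

text \<open>Products, determinants and powers can now be computed on a block diagonal
  matrix.\<close>

lemma real_block_conv:
  assumes [simp]: "y \<in> carrier_mat n n" "b \<in> carrier_mat n n"
  shows "real_block y b =
     adapted_base n * four_block_mat y (0\<^sub>m n n) (0\<^sub>m n n) b * adapted_base_inv n"
proof -
  have [simp]: "dim_row y = n" "dim_col y = n" "dim_row b = n" "dim_col b = n"
    using carrier_matD[OF assms(1)] carrier_matD[OF assms(2)] by blast+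
  note m = mult_four_block_mat[where ?nr1.0 = n and ?nr2.0 = n and ?n1.0 = n and ?n2.0 = n and ?nc1.0 = n and ?nc2.0 = n]
  have "adapted_base n * four_block_mat y (0\<^sub>m n n) (0\<^sub>m n n) b =
     four_block_mat ((1/2) \<cdot>\<^sub>m y) ((1/2) \<cdot>\<^sub>m b) ((-\<i>/2) \<cdot>\<^sub>m y) ((\<i>/2) \<cdot>\<^sub>m b)"
    unfolding adapted_base_def
    by (subst m) (simp_all add: mult_smult_assoc_mat[of _ n n _ n] left_mult_one_mat[of _ n n]
        left_add_zero_mat[of _ n n] right_add_zero_mat[of _ n n])
  also have "\<dots> * adapted_base_inv n = real_block y b"
    unfolding adapted_base_inv_def real_block_def
    by (subst m) (simp_all add: mult_smult_distrib[of _ n n _ n] right_mult_one_mat[of _ n n],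
        intro cong_four_block_mat eq_matI, auto simp: algebra_simps)
  finally show ?thesis by simp
qed

lemma real_block_mult:
  assumes [simp]: "y \<in> carrier_mat n n" "b \<in> carrier_mat n n" "y' \<in> carrier_mat n n" "b' \<in> carrier_mat n n"
  shows "real_block (y * y') (b * b') = real_block y b * real_block y' b'"
proof -
  let ?P = "adapted_base n" and ?Q = "adapted_base_inv n"
  let ?D = "four_block_mat y (0\<^sub>m n n) (0\<^sub>m n n) b" and ?D' = "four_block_mat y' (0\<^sub>m n n) (0\<^sub>m n n) b'"
  have [simp]: "?D \<in> carrier_mat (n + n) (n + n)" "?D' \<in> carrier_mat (n + n) (n + n)" by simp_all
  have D: "four_block_mat (y * y') (0\<^sub>m n n) (0\<^sub>m n n) (b * b') = ?D * ?D'"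
    by (subst mult_four_block_mat[where ?nr1.0 = n and ?nr2.0 = n and ?n1.0 = n and ?n2.0 = n and ?nc1.0 = n and ?nc2.0 = n])
      (simp_all add: left_mult_zero_mat[of _ n n] right_mult_zero_mat[of _ n n]
        left_add_zero_mat[of _ n n] right_add_zero_mat[of _ n n] mult_carrier_mat[of _ n n _ n])
  note a = assoc_mult_mat[where ?n\<^sub>1 = "n + n" and ?n\<^sub>2 = "n + n" and ?n\<^sub>3 = "n + n" and ?n\<^sub>4 = "n + n"]
  have "real_block y b * real_block y' b' = (?P * ?D * ?Q) * (?P * ?D' * ?Q)"
    by (simp add: real_block_conv[of _ n])
  also have "\<dots> = ?P * ?D * (?Q * ?P) * ?D' * ?Q"
    by (simp add: a mult_carrier_mat[where n = "n + n"])
  also have "\<dots> = ?P * (?D * ?D') * ?Q"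
    by (simp add: a adapted_base_inverse mult_carrier_mat[where n = "n + n"]
        left_mult_one_mat[of _ "n + n" "n + n"])
  finally show ?thesis by (simp add: real_block_conv[of _ n] D mult_carrier_mat[of _ n n _ n])
qed

lemma real_block_one: "real_block (1\<^sub>m n) (1\<^sub>m n) = 1\<^sub>m (n + n)"
  by (simp add: real_block_conv[of _ n] adapted_base_inverse right_mult_one_mat[of _ "n + n" "n + n"])

text \<open>After the similarity the k-th power is taken block by block, and the first block of the
  result is the power of \<open>y - 1\<close>. This is the input on unipotent elements for
  \<open>connected_reductive_transport\<close>.\<close>

lemma real_block_unipotent:
  assumes [simp]: "y \<in> carrier_mat n n" "b \<in> carrier_mat n n"
    and k: "(real_block y b - 1\<^sub>m (n + n)) ^\<^sub>m k = 0\<^sub>m (n + n) (n + n)"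
  shows "(y - 1\<^sub>m n) ^\<^sub>m k = 0\<^sub>m n n"
proof -
  let ?P = "adapted_base n" and ?Q = "adapted_base_inv n"
  let ?D = "four_block_mat (y - 1\<^sub>m n) (0\<^sub>m n n) (0\<^sub>m n n) (b - 1\<^sub>m n)"
  have D: "?D \<in> carrier_mat (n + n) (n + n)"
    by (intro four_block_carrier_mat minus_carrier_mat) simp_all
  have "real_block y b - 1\<^sub>m (n + n) = real_block (y - 1\<^sub>m n) (b - 1\<^sub>m n)"
  proof (rule eq_matI)
    have d: "dim_row y = n" "dim_col y = n" "dim_row b = n" "dim_col b = n"
      using carrier_matD[OF assms(1)] carrier_matD[OF assms(2)] by blast+
    show "(real_block y b - 1\<^sub>m (n + n)) $$ (i, j) = real_block (y - 1\<^sub>m n) (b - 1\<^sub>m n) $$ (i, j)"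
      if "i < dim_row (real_block (y - 1\<^sub>m n) (b - 1\<^sub>m n))" "j < dim_col (real_block (y - 1\<^sub>m n) (b - 1\<^sub>m n))" for i j
      using that d by (cases "i < n"; cases "j < n") (auto simp: real_block_def diff_divide_distrib)
  qed (auto simp: real_block_def carrier_matD)
  also have "\<dots> = ?P * ?D * ?Q" by (rule real_block_conv) (simp_all add: minus_carrier_mat)
  finally have "similar_mat_wit (real_block y b - 1\<^sub>m (n + n)) ?D ?P ?Q"
    using D adapted_base_inverse
    by (intro similar_mat_witI[of _ _ "n + n"]) (simp_all add: mult_carrier_mat[where n = "n + n"])
  from similar_mat_wit_pow[OF this, of k] have "similar_mat_wit (0\<^sub>m (n + n) (n + n)) (?D ^\<^sub>m k) ?P ?Q"
    unfolding k .
  from similar_mat_witD(3)[OF refl similar_mat_wit_sym[OF this]] have "?D ^\<^sub>m k = 0\<^sub>m (n + n) (n + n)"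
    using D adapted_base_inverse pow_carrier_mat[OF D, of k]
    by (simp add: left_mult_zero_mat[of _ "n + n" "n + n"] right_mult_zero_mat[of _ "n + n" "n + n"])
  also have "?D ^\<^sub>m k = four_block_mat ((y - 1\<^sub>m n) ^\<^sub>m k) (0\<^sub>m n n) (0\<^sub>m n n) ((b - 1\<^sub>m n) ^\<^sub>m k)"
    by (rule pow_four_block_mat) (simp_all add: minus_carrier_mat)
  finally have e: "four_block_mat ((y - 1\<^sub>m n) ^\<^sub>m k) (0\<^sub>m n n) (0\<^sub>m n n) ((b - 1\<^sub>m n) ^\<^sub>m k) = 0\<^sub>m (n + n) (n + n)" .
  have Y: "(y - 1\<^sub>m n) ^\<^sub>m k \<in> carrier_mat n n" by (rule pow_carrier_mat) (simp add: minus_carrier_mat)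
  show ?thesis
  proof (rule eq_matI)
    fix i j assume "i < dim_row (0\<^sub>m n n :: complex mat)" "j < dim_col (0\<^sub>m n n :: complex mat)"
    then show "((y - 1\<^sub>m n) ^\<^sub>m k) $$ (i, j) = 0\<^sub>m n n $$ (i, j)"
      using arg_cong[OF e, of "\<lambda>M. M $$ (i, j)"] Y
      by (simp add: carrier_matD[OF Y] del: pow_mat_dim)
  qed (use Y in auto)
qed

lemma block_fst_real_block:
  assumes "y \<in> carrier_mat n n" "b \<in> carrier_mat n n"
  shows "block_fst n (real_block y b) = y"
  using assms by (intro eq_matI) (auto simp: block_fst_def real_block_def field_simps)

lemma map_mat_cnj_real_block:
  assumes "y \<in> carrier_mat n n" "b \<in> carrier_mat n n"
  shows "map_mat cnj (real_block y b) = real_block (map_mat cnj b) (map_mat cnj y)"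
  using assms by (intro eq_matI) (auto simp: real_block_def field_simps)

lemma block_fst_carrier [simp]: "block_fst n M \<in> carrier_mat n n"
  by (simp add: block_fst_def)

lemma regular_on_block_fst:
  "i < n \<Longrightarrow> j < n \<Longrightarrow> regular_on UNIV (n + n) S (\<lambda>M. block_fst n M $$ (i, j))"
  by (simp add: block_fst_def)
    (intro regular_on_diff regular_on_mult regular_on_const regular_on_entry; simp)

lemma regular_on_real_block:
  assumes ij: "i < n + n" "j < n + n"
    and c: "\<And>A. A \<in> S \<Longrightarrow> F A \<in> carrier_mat n n" "\<And>A. A \<in> S \<Longrightarrow> F' A \<in> carrier_mat n n"
    and F: "\<And>i j. i < n \<Longrightarrow> j < n \<Longrightarrow> regular_on UNIV m S (\<lambda>A. F A $$ (i, j))"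
    and F': "\<And>i j. i < n \<Longrightarrow> j < n \<Longrightarrow> regular_on UNIV m S (\<lambda>A. F' A $$ (i, j))"
  shows "regular_on UNIV m S (\<lambda>A. real_block (F A) (F' A) $$ (i, j))"
proof (rule regular_on_cong)
  let ?i = "if i < n then i else i - n" and ?j = "if j < n then j else j - n"
  define s t where "s = (if i < n \<longleftrightarrow> j < n then 1/2 else if i < n then \<i>/2 else -\<i>/2)"
    and "t = (if i < n \<longleftrightarrow> j < n then 1/2 else if i < n then -\<i>/2 else \<i>/2)"
  show "regular_on UNIV m S (\<lambda>A. s * F A $$ (?i, ?j) + t * F' A $$ (?i, ?j))"
    using ij by (intro regular_on_add regular_on_mult regular_on_const F F') auto
  show "s * F A $$ (?i, ?j) + t * F' A $$ (?i, ?j) = real_block (F A) (F' A) $$ (i, j)" if "A \<in> S" for A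
    using c[OF that] ij by (auto simp: real_block_def s_def t_def field_simps)
qed

section \<open>Transport of reductivity along an isomorphism\<close>

lemma alg_iso_preimage_closed:
  assumes H: "real_alg_group H" "real_alg_group H'" and f: "alg_iso UNIV H H' f"
    and V: "zariski_closed UNIV (fst H') V"
  shows "zariski_closed UNIV (fst H) {A \<in> snd H. f A \<in> V}"
proof (rule zariski_closed_preimage[where m = "fst H'"])
  show "subgroup (snd H) (GL (fst H))" by (rule real_alg_group_subgroup[OF H(1)])
  show "zariski_closed UNIV (fst H) (snd H)"
    using H(1) zariski_closed_mono unfolding real_alg_group_def by blast
  show "f \<in> hom (GL (fst H)\<lparr>carrier := snd H\<rparr>) (GL (fst H'))"
    by (rule hom_pts_GL[OF H(2) alg_isoD(1)[OF f]])
  show "regular_on UNIV (fst H) (snd H) (\<lambda>A. f A $$ (i, j))" if "i < fst H'" "j < fst H'" for i j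
    using alg_isoD(2)[OF f] that by (simp add: regular_map_iff)
qed (use V in simp_all)

lemma image_Collect_mem_eq: "X \<subseteq> f ` S \<Longrightarrow> f ` {A \<in> S. f A \<in> X} = X"
  by auto

lemma alg_iso_image_connected:
  assumes H: "real_alg_group H" "real_alg_group H'" and f: "alg_iso UNIV H H' f"
    and V: "V \<subseteq> snd H" "zariski_connected (fst H) V"
  shows "zariski_connected (fst H') (f ` V)"
  unfolding zariski_connected_def
proof (intro allI impI, elim conjE)
  fix V1 V2 assume cl: "zariski_closed UNIV (fst H') V1" "zariski_closed UNIV (fst H') V2"
    and un: "V1 \<union> V2 = f ` V" and dis: "V1 \<inter> V2 = {}"
  let ?W = "\<lambda>V. {A \<in> snd H. f A \<in> V}"
  have inj: "inj_on f (snd H)" using alg_isoD(5)[OF f] by (auto simp: bij_betw_def)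
  have sub: "A \<in> V" if "A \<in> snd H" "f A \<in> f ` V" for A
    using that V(1) inj_onD[OF inj] by blast
  have "?W V1 \<union> ?W V2 = V"
  proof
    show "?W V1 \<union> ?W V2 \<subseteq> V" using sub un by blast
    show "V \<subseteq> ?W V1 \<union> ?W V2" using un V(1) by blast
  qed
  moreover have "?W V1 \<inter> ?W V2 = {}" using dis by blast
  moreover note alg_iso_preimage_closed[OF H f cl(1)] alg_iso_preimage_closed[OF H f cl(2)]
  ultimately have "?W V1 = {} \<or> ?W V2 = {}"
    using V(2) unfolding zariski_connected_def by blast
  moreover have "V1 \<subseteq> f ` snd H" "V2 \<subseteq> f ` snd H"
    using un image_mono[OF V(1), of f] by (metis Un_upper1 subset_trans, metis Un_upper2 subset_trans)
  ultimately show "V1 = {} \<or> V2 = {}"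
    using image_Collect_mem_eq[of V1 f "snd H"] image_Collect_mem_eq[of V2 f "snd H"] by auto
qed

text \<open>A normal closed connected unipotent subgroup of \<open>G'\<close> is pulled back along
  \<open>f\<close>. That an isomorphism of algebraic groups respects unipotency belongs to the
  Jordan decomposition; \<open>unip\<close> asks for the single direction used, which for the
  explicit embedding is a matrix computation.\<close>

lemma connected_reductive_transport:
  assumes G: "connected_reductive G" and G': "real_alg_group G'" and f: "alg_iso UNIV G G' f"
    and unip: "\<And>x k. x \<in> snd G \<Longrightarrow> (f x - 1\<^sub>m (fst G')) ^\<^sub>m k = 0\<^sub>m (fst G') (fst G') \<Longrightarrow>
       (x - 1\<^sub>m (fst G)) ^\<^sub>m k = 0\<^sub>m (fst G) (fst G)"
  shows "connected_reductive G'"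
proof -
  have H: "real_alg_group G" using G by (rule connected_reductive_real_alg_group)
  note f' = alg_isoD[OF f]
  interpret G: group "pts G" by (rule group_pts[OF H])
  interpret G': group "pts G'" by (rule group_pts[OF G'])
  interpret f: group_hom "pts G" "pts G'" f by unfold_locales (rule f'(1))
  have im: "f ` snd G = snd G'" using f'(5) by (simp add: bij_betw_def)
  have "zariski_connected (fst G') (f ` snd G)"
    using alg_iso_image_connected[OF H G' f order_refl] G by (simp add: connected_reductive_def)
  then have conn: "zariski_connected (fst G') (snd G')" by (simp add: im)
  have "trivial_unipotent_radical G'"
    unfolding trivial_unipotent_radical_def
  proof (intro allI impI, elim conjE)
    fix U assume U: "U \<lhd> pts G'" "zariski_closed UNIV (fst G') U" "zariski_connected (fst G') U"
      "unipotent_set (fst G') U"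
    have sU: "subgroup U (pts G')" using U(1) by (rule normal_imp_subgroup)
    have Us: "U \<subseteq> snd G'" using subgroup.subset[OF sU] by simp
    let ?U = "{A \<in> snd G. f A \<in> U}"
    have "?U \<lhd> pts G"
      unfolding G.normal_inv_iff
    proof (intro conjI ballI)
      show "subgroup ?U (pts G)"
      proof (rule G.subgroupI)
        show "?U \<noteq> {}" using f.hom_one subgroup.one_closed[OF sU] G.one_closed by force
        show "inv\<^bsub>pts G\<^esub> a \<in> ?U" if "a \<in> ?U" for a
          using that f.hom_inv[of a] subgroup.m_inv_closed[OF sU, of "f a"] G.inv_closed[of a] by simp
        show "a \<otimes>\<^bsub>pts G\<^esub> b \<in> ?U" if "a \<in> ?U" "b \<in> ?U" for a b
          using that f.hom_mult[of a b] subgroup.m_closed[OF sU, of "f a" "f b"] G.m_closed[of a b] by simp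
      qed simp
      fix x a assume xa: "x \<in> carrier (pts G)" "a \<in> ?U"
      have "f (x \<otimes>\<^bsub>pts G\<^esub> a \<otimes>\<^bsub>pts G\<^esub> inv\<^bsub>pts G\<^esub> x) = f x \<otimes>\<^bsub>pts G'\<^esub> f a \<otimes>\<^bsub>pts G'\<^esub> inv\<^bsub>pts G'\<^esub> (f x)"
        using xa f.hom_mult f.hom_inv G.m_closed G.inv_closed by (simp del: pts_simps(2))
      moreover have "\<dots> \<in> U"
        using U(1) xa f'(6) unfolding G'.normal_inv_iff by simp
      moreover have "x \<otimes>\<^bsub>pts G\<^esub> a \<otimes>\<^bsub>pts G\<^esub> inv\<^bsub>pts G\<^esub> x \<in> carrier (pts G)"
        using xa by (intro G.m_closed G.inv_closed) auto
      ultimately show "x \<otimes>\<^bsub>pts G\<^esub> a \<otimes>\<^bsub>pts G\<^esub> inv\<^bsub>pts G\<^esub> x \<in> ?U" by simp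
    qed
    moreover have "zariski_closed UNIV (fst G) ?U" by (rule alg_iso_preimage_closed[OF H G' f U(2)])
    moreover have "zariski_connected (fst G) ?U"
    proof -
      have "(\<lambda>y\<in>snd G'. inv_into (snd G) f y) ` U = ?U"
      proof
        show "(\<lambda>y\<in>snd G'. inv_into (snd G) f y) ` U \<subseteq> ?U" using Us f'(7,9) by auto
        show "?U \<subseteq> (\<lambda>y\<in>snd G'. inv_into (snd G) f y) ` U"
        proof
          fix x assume "x \<in> ?U"
          then show "x \<in> (\<lambda>y\<in>snd G'. inv_into (snd G) f y) ` U"
            using Us f'(8)[of x] by (intro image_eqI[of _ _ "f x"]) auto
        qed
      qed
      then show ?thesis
        using alg_iso_image_connected[OF G' H alg_iso_inv[OF H f] Us U(3)] by simp
    qed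
    moreover have "unipotent_set (fst G) ?U"
      using U(4) unip unfolding unipotent_set_def by blast
    ultimately have 1: "?U = {\<one>\<^bsub>pts G\<^esub>}"
      using G unfolding connected_reductive_def trivial_unipotent_radical_def by blast
    have "U = f ` ?U" using image_Collect_mem_eq[of U f "snd G"] Us im by simp
    also have "\<dots> = {\<one>\<^bsub>pts G'\<^esub>}" unfolding 1 using f.hom_one by simp
    finally show "U = {\<one>\<^bsub>pts G'\<^esub>}" .
  qed
  then show ?thesis using G' conn by (simp add: connected_reductive_def)
qed

text \<open>Meant for \<open>k = map_mat cnj h\<close>: the second argument of
  \<open>real_block\<close> is then the complex conjugate of h \<sigma>(y) h^-1, so the image is the
  graph of twisted conjugation inside the Weil restriction of GL(n).\<close>

definition twist_embed :: "complex mat \<Rightarrow> complex mat \<Rightarrow> complex mat" where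
  "twist_embed k y = real_block y (k * y * inv\<^bsub>GL (dim_row k)\<^esub> k)"

section \<open>The embedding attached to an invertible matrix k\<close>

context
  fixes n :: nat and k :: "complex mat"
  assumes k: "k \<in> carrier (GL n)"
begin

lemma dim_row_k: "dim_row k = n"
  using k by (auto simp: carrier_GL)

lemma conj_carrier_mat: "y \<in> carrier_mat n n \<Longrightarrow> k * y * inv\<^bsub>GL n\<^esub> k \<in> carrier_mat n n"
  using carrier_GL_D[OF k] carrier_GL_D[OF inv_GL(1)[OF k]] by (auto intro!: mult_carrier_mat)

lemma conj_mult:
  assumes "y \<in> carrier_mat n n" "y' \<in> carrier_mat n n"
  shows "k * (y * y') * inv\<^bsub>GL n\<^esub> k = (k * y * inv\<^bsub>GL n\<^esub> k) * (k * y' * inv\<^bsub>GL n\<^esub> k)"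
proof -
  note kc = carrier_GL_D[OF k] and ic = carrier_GL_D[OF inv_GL(1)[OF k]]
  note a = assoc_mult_mat[where ?n\<^sub>1 = n and ?n\<^sub>2 = n and ?n\<^sub>3 = n and ?n\<^sub>4 = n]
  have "(k * y * inv\<^bsub>GL n\<^esub> k) * (k * y' * inv\<^bsub>GL n\<^esub> k) = k * y * ((inv\<^bsub>GL n\<^esub> k * k) * (y' * inv\<^bsub>GL n\<^esub> k))"
    using kc ic assms by (simp add: a mult_carrier_mat[where n = n])
  also have "\<dots> = k * (y * y') * inv\<^bsub>GL n\<^esub> k"
    using kc ic assms by (simp add: a inv_GL(2)[OF k] mult_carrier_mat[where n = n] left_mult_one_mat[of _ n n])
  finally show ?thesis by simp
qed

lemma twist_embed_carrier_mat: "y \<in> carrier_mat n n \<Longrightarrow> twist_embed k y \<in> carrier_mat (n + n) (n + n)"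
  unfolding twist_embed_def dim_row_k by (intro real_block_carrier conj_carrier_mat)

lemma twist_embed_mult:
  assumes "y \<in> carrier_mat n n" "y' \<in> carrier_mat n n"
  shows "twist_embed k (y * y') = twist_embed k y * twist_embed k y'"
  unfolding twist_embed_def dim_row_k conj_mult[OF assms]
  by (rule real_block_mult[OF assms(1) conj_carrier_mat[OF assms(1)] assms(2) conj_carrier_mat[OF assms(2)]])

lemma twist_embed_one: "twist_embed k (1\<^sub>m n) = 1\<^sub>m (n + n)"
  unfolding twist_embed_def dim_row_k
  using carrier_GL_D[OF k] inv_GL(3)[OF k] by (simp add: real_block_one right_mult_one_mat[of _ n n])

lemma block_fst_twist_embed: "y \<in> carrier_mat n n \<Longrightarrow> block_fst n (twist_embed k y) = y"
  unfolding twist_embed_def dim_row_k by (intro block_fst_real_block conj_carrier_mat)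

text \<open>Guarantees that \<open>block_fst\<close> of an invertible matrix of the form
  \<open>twist_embed k y\<close> is again invertible, which the closedness of the image depends
  on.\<close>

lemma det_twist_embed_eq_0:
  assumes y: "y \<in> carrier_mat n n" and "det y = 0"
  shows "det (twist_embed k y) = 0"
proof -
  let ?b = "k * y * inv\<^bsub>GL n\<^esub> k" and ?P = "adapted_base n" and ?Q = "adapted_base_inv n"
  let ?D = "four_block_mat y (0\<^sub>m n n) (0\<^sub>m n n) ?b"
  have b: "?b \<in> carrier_mat n n" by (rule conj_carrier_mat[OF y])
  have D: "?D \<in> carrier_mat (n + n) (n + n)" using y b by simp
  have "det ?D = 0"
    using det_four_block_mat_lower_left_zero[OF y _ refl b, of "0\<^sub>m n n"] assms by simp
  then have "det (?P * ?D * ?Q) = 0"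
    using det_mult[of "?P * ?D" "n + n" ?Q] det_mult[of ?P "n + n" ?D] D
    by (simp add: mult_carrier_mat[where n = "n + n"])
  then show ?thesis by (simp add: twist_embed_def dim_row_k real_block_conv[OF y b])
qed

lemma twist_embed_hom: "twist_embed k \<in> hom (GL n) (GL (n + n))"
proof -
  have "det (twist_embed k y) \<noteq> 0" if y: "y \<in> carrier (GL n)" for y
  proof -
    have "twist_embed k y * twist_embed k (inv\<^bsub>GL n\<^esub> y) = 1\<^sub>m (n + n)"
      using twist_embed_mult[of y "inv\<^bsub>GL n\<^esub> y"] inv_GL[OF y] y by (simp add: carrier_GL_D twist_embed_one)
    then have "det (twist_embed k y) * det (twist_embed k (inv\<^bsub>GL n\<^esub> y)) = 1"
      using det_mult[of "twist_embed k y" "n + n"] twist_embed_carrier_mat carrier_GL_D[OF y]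
        carrier_GL_D[OF inv_GL(1)[OF y]] by (metis det_one)
    then show ?thesis by auto
  qed
  then show ?thesis
    by (auto simp: hom_def twist_embed_mult carrier_GL_D) (auto simp: carrier_GL twist_embed_carrier_mat)
qed

lemma regular_on_twist_embed:
  assumes ij: "i < n + n" "j < n + n" and c: "\<And>A. A \<in> S \<Longrightarrow> F A \<in> carrier_mat n n"
    and F: "\<And>i j. i < n \<Longrightarrow> j < n \<Longrightarrow> regular_on UNIV m S (\<lambda>A. F A $$ (i, j))"
  shows "regular_on UNIV m S (\<lambda>A. twist_embed k (F A) $$ (i, j))"
  unfolding twist_embed_def dim_row_k
proof (rule regular_on_real_block[OF ij c _ F])
  note kc = carrier_GL_D[OF k] and ic = carrier_GL_D[OF inv_GL(1)[OF k]]
  show "k * F A * inv\<^bsub>GL n\<^esub> k \<in> carrier_mat n n" if "A \<in> S" for A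
    by (rule conj_carrier_mat[OF c[OF that]])
  show "regular_on UNIV m S (\<lambda>A. (k * F A * inv\<^bsub>GL n\<^esub> k) $$ (i, j))" if "i < n" "j < n" for i j
    using that kc ic c
    by (intro regular_on_mat_mult[where k = n and l = n and m = n] regular_on_const F)
      (auto intro: mult_carrier_mat)
qed

text \<open>The image is the fixed locus of the retraction M ->
  \<open>twist_embed k (block_fst n M)\<close>, hence cut out by equations linear in the entries of
  M.\<close>

lemma twist_embed_image_closed: "zariski_closed UNIV (n + n) (twist_embed k ` carrier (GL n))"
proof -
  define F where "F = (\<lambda>(i, j) M. M $$ (i, j) - twist_embed k (block_fst n M) $$ (i, j)) `
    ({..<n + n} \<times> {..<n + n})"
  have "zariski_closed UNIV (n + n) (carrier (GL (n + n)))"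
    unfolding zariski_closed_def by (rule exI[of _ "{}"]) simp
  then have "zariski_closed UNIV (n + n) {M \<in> carrier (GL (n + n)). \<forall>f\<in>F. f M = 0}"
  proof (rule zariski_closed_regular_zeros)
    fix f assume "f \<in> F"
    then obtain i j where ij: "i < n + n" "j < n + n"
      and f: "f = (\<lambda>M. M $$ (i, j) - twist_embed k (block_fst n M) $$ (i, j))"
      unfolding F_def by auto
    show "regular_on UNIV (n + n) (carrier (GL (n + n))) f"
      unfolding f using ij
      by (intro regular_on_diff regular_on_entry regular_on_twist_embed regular_on_block_fst) auto
  qed
  also have "{M \<in> carrier (GL (n + n)). \<forall>f\<in>F. f M = 0} = twist_embed k ` carrier (GL n)"
  proof (intro equalityI subsetI)
    fix M assume M: "M \<in> {M \<in> carrier (GL (n + n)). \<forall>f\<in>F. f M = 0}"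
    have Mc: "M \<in> carrier_mat (n + n) (n + n)" using M carrier_GL_D by blast
    have eq: "M = twist_embed k (block_fst n M)"
    proof (rule eq_matI)
      fix i j assume "i < dim_row (twist_embed k (block_fst n M))" "j < dim_col (twist_embed k (block_fst n M))"
      then have ij: "i < n + n" "j < n + n" using twist_embed_carrier_mat[of "block_fst n M"] by auto
      have "(\<lambda>M. M $$ (i, j) - twist_embed k (block_fst n M) $$ (i, j)) \<in> F"
        unfolding F_def using ij by (intro image_eqI[of _ _ "(i, j)"]) auto
      then show "M $$ (i, j) = twist_embed k (block_fst n M) $$ (i, j)" using M by fastforce
    qed (use Mc twist_embed_carrier_mat[of "block_fst n M"] in auto)
    have "det (block_fst n M) \<noteq> 0"
      using det_twist_embed_eq_0[of "block_fst n M"] eq M by (auto simp: carrier_GL)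
    then have "block_fst n M \<in> carrier (GL n)" by (simp add: carrier_GL)
    then show "M \<in> twist_embed k ` carrier (GL n)" using eq by blast
  next
    fix M assume "M \<in> twist_embed k ` carrier (GL n)"
    then obtain y where y: "y \<in> carrier (GL n)" "M = twist_embed k y" by blast
    then have "M \<in> carrier (GL (n + n))" using twist_embed_hom by (auto simp: hom_def)
    moreover have "twist_embed k (block_fst n M) = M"
      using y by (simp add: block_fst_twist_embed carrier_GL_D)
    ultimately show "M \<in> {M \<in> carrier (GL (n + n)). \<forall>f\<in>F. f M = 0}" by (auto simp: F_def)
  qed
  finally show ?thesis .
qed

text \<open>The image of all of \<open>GL n\<close> is closed, and inside it the image of
  \<open>S\<close> is the preimage of \<open>S\<close> under \<open>block_fst\<close>. The detour
  through the full image is made because \<open>block_fst\<close> is multiplicative there, but not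
  on all of \<open>GL (n + n)\<close>.\<close>

lemma twist_embed_subgroup_closed:
  assumes S: "subgroup S (GL n)" "zariski_closed UNIV n S"
  shows "subgroup (twist_embed k ` S) (GL (n + n))" "zariski_closed UNIV (n + n) (twist_embed k ` S)"
proof -
  interpret group_hom "GL n" "GL (n + n)" "twist_embed k"
    using twist_embed_hom group_GL by (simp add: group_hom_def group_hom_axioms_def)
  show "subgroup (twist_embed k ` S) (GL (n + n))" using S(1) by (rule subgroup_img_is_subgroup)
  let ?H = "twist_embed k ` carrier (GL n)"
  have H: "subgroup ?H (GL (n + n))"
    using subgroup_img_is_subgroup[OF group.subgroup_self[OF group_GL]] .
  have SG: "S \<subseteq> carrier (GL n)" using S(1) by (rule subgroup.subset)
  have "zariski_closed UNIV (n + n) {M \<in> ?H. block_fst n M \<in> S}"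
  proof (rule zariski_closed_preimage[OF _ _ _ H twist_embed_image_closed])
    show "block_fst n \<in> hom (GL (n + n)\<lparr>carrier := ?H\<rparr>) (GL n)"
    proof -
      have "block_fst n (twist_embed k y * twist_embed k y') = y * y'"
        if "y \<in> carrier (GL n)" "y' \<in> carrier (GL n)" for y y'
        using that carrier_GL_D block_fst_twist_embed[of "y * y'"] mult_carrier_mat[of y n n y' n]
        by (simp add: twist_embed_mult)
      then show ?thesis by (auto simp: hom_def block_fst_twist_embed carrier_GL_D)
    qed
    show "regular_on UNIV (n + n) ?H (\<lambda>A. block_fst n A $$ (i, j))" if "i < n" "j < n" for i j
      using that by (rule regular_on_block_fst)
  qed (use S in simp_all)
  also have "{M \<in> ?H. block_fst n M \<in> S} = twist_embed k ` S"
    using SG by (auto simp: block_fst_twist_embed carrier_GL_D image_iff)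
  finally show "zariski_closed UNIV (n + n) (twist_embed k ` S)" .
qed

lemma map_mat_cnj_twist_embed:
  assumes "y \<in> carrier_mat n n"
  shows "map_mat cnj (twist_embed k y) =
    real_block (map_mat cnj (k * y * inv\<^bsub>GL n\<^esub> k)) (map_mat cnj y)"
  unfolding twist_embed_def dim_row_k
  by (rule map_mat_cnj_real_block[OF assms conj_carrier_mat[OF assms]])

lemma twist_embed_unipotent:
  assumes "y \<in> carrier_mat n n" "(twist_embed k y - 1\<^sub>m (n + n)) ^\<^sub>m m = 0\<^sub>m (n + n) (n + n)"
  shows "(y - 1\<^sub>m n) ^\<^sub>m m = 0\<^sub>m n n"
  using assms real_block_unipotent[OF _ conj_carrier_mat] unfolding twist_embed_def dim_row_k by blast

end

text \<open>The embedding turns the twisted conjugation \<open>\<theta>\<close> into the standard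
  conjugation of matrices. Hence the image is stable under conjugation, and descent makes it a real
  group.\<close>

lemma (in real_group) exists_twisted_form:
  assumes G: "connected_reductive G" and h: "h \<in> snd G"
    and c: "h \<cdot> map_mat cnj h \<in> center_of (pts G)"
  obtains G' \<psi> where "connected_reductive G'" "alg_iso UNIV G G' \<psi>"
    "\<And>x. x \<in> snd G \<Longrightarrow> map_mat cnj (\<psi> x) = \<psi> (Ad h (map_mat cnj x))"
proof -
  define n where "n = fst G"
  define k where "k = map_mat cnj h"
  have kG: "k \<in> snd G" unfolding k_def by (rule real_alg_group_cnj[OF real_alg h])
  have k: "k \<in> carrier (GL n)" unfolding n_def by (rule real_alg_group_GL[OF real_alg kG])
  have cm: "x \<in> carrier_mat n n" if "x \<in> snd G" for x
    unfolding n_def by (rule real_alg_group_carrier_mat[OF real_alg that])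
  have ik: "inv\<^bsub>GL n\<^esub> k = inv\<^sub>G k" using inv_pts[OF real_alg kG] by (simp add: n_def)
  let ?E = "twist_embed k"
  define \<theta> where "\<theta> x = Ad h (map_mat cnj x)" for x
  have \<theta>: "\<theta> x \<in> snd G" if "x \<in> snd G" for x
    using G.m_closed[OF G.m_closed[of h "map_mat cnj x"] G.inv_closed[of h]] that h real_alg_group_cnj[OF real_alg that]
    unfolding \<theta>_def by simp
  \<comment> \<open>The central element \<open>h \<cdot> k\<close> commutes with \<open>h\<close>,
    and cancelling \<open>h\<close> on the left shows that \<open>k \<cdot> h\<close> is the same
    element.\<close>
  have kh: "k \<cdot> h \<in> center_of (pts G)"
  proof -
    have "h \<cdot> (k \<cdot> h) = (h \<cdot> k) \<cdot> h"
      using h kG by (simp add: G.m_assoc del: pts_simps(2))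
    also have "\<dots> = h \<cdot> (h \<cdot> k)" using c h by (simp add: center_of_def k_def)
    finally have "k \<cdot> h = h \<cdot> k"
      using h kG G.Units_l_cancel[of h "k \<cdot> h" "h \<cdot> k"] G.m_closed by (simp del: pts_simps(2))
    then show ?thesis using c by (simp add: k_def)
  qed
  \<comment> \<open>This is the involutivity of \<open>\<theta>\<close> in disguise: conjugation by
    \<open>k\<close> and then by \<open>h\<close> are absorbed into the central element
    \<open>k \<cdot> h\<close>.\<close>
  have conj\<theta>: "Ad k (\<theta> x) = map_mat cnj x" if x: "x \<in> snd G" for x
  proof -
    let ?x = "map_mat cnj x"
    have x': "?x \<in> carrier (pts G)" using real_alg_group_cnj[OF real_alg x] by simp
    have hk: "h \<in> carrier (pts G)" "k \<in> carrier (pts G)" using h kG by simp_all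
    have "Ad k (\<theta> x) = Ad (k \<cdot> h) ?x"
      unfolding \<theta>_def using x' hk by (simp add: G.m_assoc G.inv_mult_group del: pts_simps)
    also have "\<dots> = ?x \<cdot> (k \<cdot> h) \<cdot> inv\<^sub>G (k \<cdot> h)"
      using kh x' unfolding center_of_def by simp
    also have "\<dots> = ?x" using x' hk by (simp add: G.m_assoc del: pts_simps)
    finally show ?thesis .
  qed
  \<comment> \<open>Conjugation exchanges the blocks. The new first block is
    \<open>\<theta> x\<close>, and by \<open>conj\<theta>\<close> the new second block is its
    conjugate by \<open>k\<close>, so the result is again an embedded matrix.\<close>
  have cnjE: "map_mat cnj (?E x) = ?E (\<theta> x)" if x: "x \<in> snd G" for x
  proof -
    have "map_mat cnj (k * x * inv\<^bsub>GL n\<^esub> k) = \<theta> x"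
    proof -
      have xk: "x \<in> carrier (pts G)" "k \<in> carrier (pts G)" using x kG by simp_all
      have "map_mat cnj (Ad k x) =
        map_mat cnj k \<cdot> map_mat cnj x \<cdot> inv\<^sub>G (map_mat cnj k)"
        using xk by (simp add: cnj.hom_mult cnj.hom_inv del: pts_simps)
      then show ?thesis by (simp add: \<theta>_def ik[unfolded k_def] k_def)
    qed
    then have "map_mat cnj (?E x) = real_block (\<theta> x) (map_mat cnj x)"
      using map_mat_cnj_twist_embed[OF k cm[OF x]] by simp
    also have "map_mat cnj x = k * \<theta> x * inv\<^bsub>GL n\<^esub> k" using conj\<theta>[OF x] by (simp add: ik)
    also have "real_block (\<theta> x) (k * \<theta> x * inv\<^bsub>GL n\<^esub> k) = ?E (\<theta> x)"
      by (simp add: twist_embed_def dim_row_k[OF k])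
    finally show ?thesis .
  qed
  define G' where "G' = (n + n, ?E ` snd G)"
  have S: "subgroup (snd G) (GL n)" "zariski_closed UNIV n (snd G)"
    using real_alg zariski_closed_mono unfolding real_alg_group_def n_def by blast+
  note sc = twist_embed_subgroup_closed[OF k S]
  have "zariski_closed \<real> (n + n) (?E ` snd G)"
    by (rule zariski_closed_real_of_cnj[OF sc(2)]) (use cnjE \<theta> in auto)
  then have G': "real_alg_group G'" using sc(1) by (simp add: real_alg_group_def G'_def)
  let ?\<psi> = "restrict ?E (snd G)"
  have iso: "alg_iso UNIV G G' ?\<psi>"
  proof (rule alg_isoI)
    have "x * y \<in> snd G" if "x \<in> snd G" "y \<in> snd G" for x y using G.m_closed[of x y] that by simp
    then show "?\<psi> \<in> hom (pts G) (pts G')"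
      by (auto simp: hom_def G'_def twist_embed_mult[OF k cm cm])
    show "regular_map UNIV G G' ?\<psi>"
    proof (rule regular_map_cong)
      show "regular_map UNIV G G' ?E"
        unfolding regular_map_iff G'_def fst_conv snd_conv n_def[symmetric]
        using cm by (intro conjI allI impI regular_on_twist_embed[OF k] regular_on_entry) auto
    qed simp
    show "regular_map UNIV G' G (block_fst n)"
      unfolding regular_map_iff G'_def fst_conv snd_conv n_def[symmetric]
      using block_fst_twist_embed[OF k cm] by (intro conjI allI impI regular_on_block_fst) auto
  qed (use block_fst_twist_embed[OF k cm] in \<open>auto simp: G'_def\<close>)
  have "connected_reductive G'"
  proof (rule connected_reductive_transport[OF G G' iso])
    fix x m assume "x \<in> snd G" "(?\<psi> x - 1\<^sub>m (fst G')) ^\<^sub>m m = 0\<^sub>m (fst G') (fst G')"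
    then show "(x - 1\<^sub>m (fst G)) ^\<^sub>m m = 0\<^sub>m (fst G) (fst G)"
      using twist_embed_unipotent[OF k cm, of x m] by (simp add: G'_def n_def)
  qed
  moreover have "map_mat cnj (?\<psi> x) = ?\<psi> (Ad h (map_mat cnj x))"
    if "x \<in> snd G" for x
    using cnjE[OF that] \<theta>[OF that] that unfolding \<theta>_def by (simp del: pts_simps)
  ultimately show ?thesis using that iso by blast
qed

text \<open>The only candidate for the group isomorphism in a morphism with given \<open>g\<close>:
  the relation f o \<psi>1 = \<psi>2 o Ad g determines f on the image of \<psi>1, that is,
  everywhere.\<close>

definition twist_map ::
    "lin_group \<Rightarrow> 'w twist \<Rightarrow> 'w twist \<Rightarrow> complex mat \<Rightarrow> complex mat \<Rightarrow> complex mat" where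
  "twist_map G X Y g = (\<lambda>y\<in>snd (fst X). fst (snd Y)
     (g \<otimes>\<^bsub>pts G\<^esub> inv_into (snd G) (fst (snd X)) y \<otimes>\<^bsub>pts G\<^esub> inv\<^bsub>pts G\<^esub> g))"

lemma twist_map_eqI:
  assumes \<psi>: "alg_iso K G G1 \<psi>1" and f: "f \<in> extensional (snd G1)"
    and eq: "\<And>x. x \<in> snd G \<Longrightarrow> f (\<psi>1 x) = \<psi>2 (g \<otimes>\<^bsub>pts G\<^esub> x \<otimes>\<^bsub>pts G\<^esub> inv\<^bsub>pts G\<^esub> g)"
  shows "f = twist_map G (G1, \<psi>1, z1) (G2, \<psi>2, z2) g"
proof (rule extensionalityI[OF f])
  fix y assume y: "y \<in> snd G1"
  show "f y = twist_map G (G1, \<psi>1, z1) (G2, \<psi>2, z2) g y"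
    using eq[OF alg_isoD(7)[OF \<psi> y]] alg_isoD(9)[OF \<psi> y] y by (simp add: twist_map_def)
qed (simp add: twist_map_def)

text \<open>Over the complex numbers the map is a composite of isomorphisms. The relation
  \<open>g(2)\<close> says that Ad g intertwines the twisted conjugations of \<open>h1\<close> and
  \<open>h2\<close>, so the map commutes with conjugation and descends to the reals.\<close>

lemma (in real_group) twist_map_alg_iso:
  assumes G: "real_alg_group G1" "real_alg_group G2"
    and \<psi>: "alg_iso UNIV G G1 \<psi>1" "alg_iso UNIV G G2 \<psi>2"
    and h: "h1 \<in> snd G" "h2 \<in> snd G"
    and \<psi>1: "\<And>x. x \<in> snd G \<Longrightarrow> map_mat cnj (\<psi>1 x) = \<psi>1 (Ad h1 (map_mat cnj x))"
    and \<psi>2: "\<And>x. x \<in> snd G \<Longrightarrow> map_mat cnj (\<psi>2 x) = \<psi>2 (Ad h2 (map_mat cnj x))"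
    and g: "g \<in> snd G" "h2 = g \<cdot> h1 \<cdot> map_mat cnj (inv\<^sub>G g)"
  shows "alg_iso \<real> G1 G2 (twist_map G (G1, \<psi>1, z1) (G2, \<psi>2, z2) g)"
    "x \<in> snd G \<Longrightarrow> twist_map G (G1, \<psi>1, z1) (G2, \<psi>2, z2) g (\<psi>1 x) =
       \<psi>2 (Ad g x)"
proof -
  let ?f = "twist_map G (G1, \<psi>1, z1) (G2, \<psi>2, z2) g"
  let ?Ad = "\<lambda>x\<in>snd G. Ad g x"
  let ?i = "\<lambda>y\<in>snd G1. inv_into (snd G) \<psi>1 y"
  note f1 = alg_isoD[OF \<psi>(1)] and f2 = alg_isoD[OF \<psi>(2)]
  have eq: "?f (\<psi>1 x) = \<psi>2 (Ad g x)" if "x \<in> snd G" for x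
    using that f1(6,8) by (simp add: twist_map_def)
  then show "?f (\<psi>1 x) = \<psi>2 (Ad g x)" if "x \<in> snd G"
    using that .
  have "alg_iso UNIV G1 G2 (compose (snd G1) \<psi>2 (compose (snd G1) ?Ad ?i))"
    using alg_iso_comp[OF _ _ _ G(1) real_alg G(2) alg_iso_comp[OF _ _ _ G(1) real_alg real_alg
      alg_iso_inv[OF real_alg \<psi>(1)] alg_iso_Ad[OF g(1)]] \<psi>(2)] by simp
  also have "compose (snd G1) \<psi>2 (compose (snd G1) ?Ad ?i) = ?f"
    using f1(7) by (intro extensionalityI[of _ "snd G1"]) (auto simp: compose_def twist_map_def)
  finally have iso: "alg_iso UNIV G1 G2 ?f" .
  show "alg_iso \<real> G1 G2 ?f"
  proof (rule alg_iso_real_of_cnj[OF G iso])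
    fix y assume y: "y \<in> snd G1"
    define x where "x = inv_into (snd G) \<psi>1 y"
    have x: "x \<in> carrier (pts G)" "y = \<psi>1 x" using f1(7,9) y by (simp_all add: x_def)
    let ?x = "map_mat cnj x"
    have c: "?x \<in> carrier (pts G)" "g \<in> carrier (pts G)" "h1 \<in> carrier (pts G)"
        "map_mat cnj g \<in> carrier (pts G)"
      using cnj.hom_closed[OF x(1)] g(1) h(1) cnj.hom_closed[of g] by simp_all
    have "h2 \<cdot> map_mat cnj (Ad g x) \<cdot> inv\<^sub>G h2 =
       g \<cdot> (Ad h1 ?x) \<cdot> inv\<^sub>G g"
    proof -
      have cancel: "inv\<^sub>G a \<cdot> (a \<cdot> b) = b"
        if "a \<in> carrier (pts G)" "b \<in> carrier (pts G)" for a b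
        using that by (simp add: G.m_assoc[symmetric] del: pts_simps)
      show ?thesis
        unfolding g(2) using x(1) c
        by (simp add: G.m_assoc G.inv_mult_group cnj.hom_mult cnj.hom_inv cancel del: pts_simps)
    qed
    moreover have "Ad g x \<in> carrier (pts G)"
      "Ad h1 ?x \<in> carrier (pts G)"
      using x(1) c by (simp_all del: pts_simps)
    ultimately show "?f (map_mat cnj y) = map_mat cnj (?f y)"
      using eq \<psi>1[of x] \<psi>2[of "Ad g x"] x by (simp del: pts_simps(2,3))
  qed
qed

section \<open>Functoriality of the isomorphisms between twists\<close>

lemma (in real_group) twist_map_one:
  assumes \<psi>: "alg_iso UNIV G G1 \<psi>"
  shows "twist_map G (G1, \<psi>, z) (G1, \<psi>, z) \<one>\<^bsub>pts G\<^esub> = (\<lambda>x\<in>snd G1. x)"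
proof -
  have "\<one>\<^bsub>pts G\<^esub> \<cdot> x \<cdot> inv\<^sub>G \<one>\<^bsub>pts G\<^esub> = x" if "x \<in> snd G" for x
    using that by (simp del: pts_simps(2,3))
  then show ?thesis
    using alg_isoD(6)[OF \<psi>] by (intro twist_map_eqI[OF \<psi>, symmetric]) (simp_all del: pts_simps)
qed

lemma (in real_group) twist_map_mult:
  assumes \<psi>: "alg_iso UNIV G G1 \<psi>1" "alg_iso UNIV G G2 \<psi>2"
    and g: "g \<in> snd G" "g' \<in> snd G"
  shows "twist_map G (G1, \<psi>1, z1) (G3, \<psi>3, z3) (g' \<cdot> g) =
    compose (snd G1) (twist_map G (G2, \<psi>2, z2) (G3, \<psi>3, z3) g') (twist_map G (G1, \<psi>1, z1) (G2, \<psi>2, z2) g)"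
proof (rule twist_map_eqI[OF \<psi>(1), symmetric])
  fix x assume x: "x \<in> snd G"
  have c: "x \<in> carrier (pts G)" "g \<in> carrier (pts G)" "g' \<in> carrier (pts G)" using x g by simp_all
  have "Ad (g' \<cdot> g) x =
     g' \<cdot> (Ad g x) \<cdot> inv\<^sub>G g'"
    using c by (simp add: G.m_assoc G.inv_mult_group del: pts_simps)
  moreover have "Ad g x \<in> snd G"
    using c G.m_closed G.inv_closed pts_simps(1) by metis
  ultimately show "compose (snd G1) (twist_map G (G2, \<psi>2, z2) (G3, \<psi>3, z3) g')
      (twist_map G (G1, \<psi>1, z1) (G2, \<psi>2, z2) g) (\<psi>1 x) =
      \<psi>3 (Ad (g' \<cdot> g) x)"
    using x alg_isoD(6,8)[OF \<psi>(1)] alg_isoD(6,8)[OF \<psi>(2)]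
    by (simp add: twist_map_def compose_def del: pts_simps)
qed simp

section \<open>The group u as a limit of groups of roots of unity\<close>

lemma galois_simps [simp]:
  "s \<otimes>\<^bsub>galois E\<^esub> t = compose E s t" "\<one>\<^bsub>galois E\<^esub> = (\<lambda>x\<in>E. x)"
  by (simp_all add: galois_def)

lemma carrier_galois_UNIV: "carrier \<Gamma> = {\<lambda>x. x, cnj}"
proof
  show "carrier \<Gamma> \<subseteq> {\<lambda>x. x, cnj}"
  proof
    fix s assume "s \<in> carrier \<Gamma>"
    then have add: "s (x + y) = s x + s y" and mult: "s (x * y) = s x * s y"
      and r: "s (complex_of_real a) = complex_of_real a" for x y a
      by (auto simp: galois_def)
    have "s \<i> * s \<i> = -1" using mult[of \<i> \<i>] r[of "-1"] by simp
    then have "(s \<i> - \<i>) * (s \<i> + \<i>) = 0" by (simp add: algebra_simps)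
    then have i: "s \<i> = \<i> \<or> s \<i> = -\<i>" by (simp add: eq_neg_iff_add_eq_0)
    have z: "s z = complex_of_real (Re z) + s \<i> * complex_of_real (Im z)" for z
    proof -
      have "s z = s (complex_of_real (Re z) + \<i> * complex_of_real (Im z))" by (simp add: complex_eq[symmetric])
      then show ?thesis by (simp add: add mult r)
    qed
    have "s = (\<lambda>x. x)" if "s \<i> = \<i>"
      by (rule ext, subst z) (simp add: that complex_eq[symmetric])
    moreover have "s = cnj" if "s \<i> = -\<i>"
      by (rule ext, subst z) (simp add: that complex_eq_iff)
    ultimately have "s = (\<lambda>x. x) \<or> s = cnj" using i by blast
    then show "s \<in> {\<lambda>x. x, cnj}" by simp
  qed
  have "bij cnj" by (intro involuntory_imp_bij) simp
  then show "{\<lambda>x. x, cnj} \<subseteq> carrier \<Gamma>"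
    by (auto simp: galois_def bij_betw_def)
qed

lemma carrier_galois_Reals: "carrier (galois \<real>) = {\<lambda>x\<in>\<real>. x}"
proof
  show "carrier (galois \<real>) \<subseteq> {\<lambda>x\<in>\<real>. x}"
  proof
    fix s assume s: "s \<in> carrier (galois \<real>)"
    have "s x = x" if "x \<in> \<real>" for x using that s by (auto simp: galois_def elim!: Reals_cases)
    moreover have "s \<in> extensional \<real>" using s by (simp add: galois_def)
    ultimately have "s = (\<lambda>x\<in>\<real>. x)" by (intro extensionalityI[of _ \<real>]) auto
    then show "s \<in> {\<lambda>x\<in>\<real>. x}" by simp
  qed
  show "{\<lambda>x\<in>\<real>. x} \<subseteq> carrier (galois \<real>)"
    by (auto simp: galois_def bij_betw_def inj_on_def)
qed

lemma restrict_UNIV: "restrict f UNIV = f"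
  by (simp add: restrict_def)

lemma id_neq_cnj [simp]: "(\<lambda>x. x) \<noteq> cnj" "cnj \<noteq> (\<lambda>x. x)"
  by (auto dest!: fun_cong[of _ _ \<i>])

lemma Reals_neq_UNIV [simp]: "(\<real> :: complex set) \<noteq> UNIV" "(UNIV :: complex set) \<noteq> \<real>"
proof -
  have "\<i> \<notin> \<real>" by (auto simp: complex_is_Real_iff)
  then show "(\<real> :: complex set) \<noteq> UNIV" "(UNIV :: complex set) \<noteq> \<real>"
    using UNIV_I[of \<i>] by metis+
qed

section \<open>Coordinates on the finite levels of u\<close>

lemma root_of_unity_nonzero: "z ^ n = 1 \<Longrightarrow> n \<ge> 1 \<Longrightarrow> z \<noteq> (0 :: complex)"
  by (auto simp: power_0_left)

lemma res_mu_simps: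
  "carrier (res_mu i) = (\<Pi>\<^sub>E \<tau>\<in>carrier (galois (fst i)). {z. z ^ snd i = 1})"
  "f \<otimes>\<^bsub>res_mu i\<^esub> g = (\<lambda>\<tau>\<in>carrier (galois (fst i)). f \<tau> * g \<tau>)"
  by (simp_all add: res_mu_def product_group_def mu_def)

lemma diag_mu_eq:
  "diag_mu i = (\<lambda>z. \<lambda>\<tau>\<in>carrier (galois (fst i)). z) ` {z. z ^ snd i = 1}"
  by (simp add: diag_mu_def mu_def)

definition gal_pair :: "complex \<Rightarrow> complex \<Rightarrow> (complex \<Rightarrow> complex) \<Rightarrow> complex" where
  "gal_pair x y = (\<lambda>\<tau>\<in>{\<lambda>x. x, cnj}. if \<tau> = cnj then y else x)"

definition gal_single :: "complex \<Rightarrow> (complex \<Rightarrow> complex) \<Rightarrow> complex" where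
  "gal_single x = (\<lambda>\<tau>\<in>{\<lambda>x\<in>\<real>. x}. x)"

lemma gal_pair_simps [simp]: "gal_pair x y (\<lambda>x. x) = x" "gal_pair x y cnj = y"
  by (simp_all add: gal_pair_def)

lemma gal_single_simp [simp]: "gal_single x (\<lambda>x\<in>\<real>. x) = x"
  by (simp add: gal_single_def)

lemma gal_pair_undefined: "\<tau> \<notin> {\<lambda>x. x, cnj} \<Longrightarrow> gal_pair x y \<tau> = undefined"
  unfolding gal_pair_def by (simp only: restrict_def if_False)

lemma gal_single_undefined: "\<tau> \<notin> {\<lambda>x\<in>\<real>. x} \<Longrightarrow> gal_single x \<tau> = undefined"
  unfolding gal_single_def by (simp only: restrict_def if_False)

lemma gal_pair_inject [simp]: "gal_pair x y = gal_pair x' y' \<longleftrightarrow> x = x' \<and> y = y'"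
  by (metis gal_pair_simps)

lemma restrict_gal_pair: "(\<lambda>\<tau>\<in>{\<lambda>x. x, cnj}. f \<tau>) = gal_pair (f (\<lambda>x. x)) (f cnj)"
proof (rule ext)
  fix \<tau> show "(\<lambda>\<tau>\<in>{\<lambda>x. x, cnj}. f \<tau>) \<tau> = gal_pair (f (\<lambda>x. x)) (f cnj) \<tau>"
    by (cases "\<tau> = cnj"; cases "\<tau> = (\<lambda>x. x)") (simp_all add: gal_pair_def)
qed

lemma restrict_gal_single: "(\<lambda>\<tau>\<in>{\<lambda>x\<in>\<real>. x}. f \<tau>) = gal_single (f (\<lambda>x\<in>\<real>. x))"
proof (rule ext)
  fix \<tau> show "(\<lambda>\<tau>\<in>{\<lambda>x\<in>\<real>. x}. f \<tau>) \<tau> = gal_single (f (\<lambda>x\<in>\<real>. x)) \<tau>"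
    by (cases "\<tau> = (\<lambda>x\<in>\<real>. x)") (simp_all add: gal_single_def)
qed

lemma res_mu_UNIV: "carrier (res_mu (UNIV, n)) = {gal_pair x y | x y. x ^ n = 1 \<and> y ^ n = 1}"
proof (intro equalityI subsetI)
  fix f assume f: "f \<in> carrier (res_mu (UNIV, n))"
  then have "f = restrict f {\<lambda>x. x, cnj}"
    by (simp add: res_mu_simps carrier_galois_UNIV PiE_restrict)
  also have "\<dots> = gal_pair (f (\<lambda>x. x)) (f cnj)" by (rule restrict_gal_pair)
  finally show "f \<in> {gal_pair x y | x y. x ^ n = 1 \<and> y ^ n = 1}"
    using f by (auto simp: res_mu_simps carrier_galois_UNIV PiE_iff)
next
  fix f assume "f \<in> {gal_pair x y | x y. x ^ n = 1 \<and> y ^ n = 1}"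
  then obtain x y where xy: "x ^ n = 1" "y ^ n = 1" and f: "f = gal_pair x y" by blast
  show "f \<in> carrier (res_mu (UNIV, n))"
    unfolding res_mu_simps(1) fst_conv snd_conv carrier_galois_UNIV f
  proof (rule PiE_I)
    fix \<tau> assume "\<tau> \<in> {\<lambda>x. x, cnj}"
    then consider "\<tau> = (\<lambda>x. x)" | "\<tau> = cnj" by blast
    then show "gal_pair x y \<tau> \<in> {z. z ^ n = 1}" using xy by cases simp_all
  qed (rule gal_pair_undefined)
qed

lemma res_mu_Reals: "carrier (res_mu (\<real>, n)) = gal_single ` {z. z ^ n = 1}"
proof (intro equalityI subsetI)
  fix f assume f: "f \<in> carrier (res_mu (\<real>, n))"
  then have "f = restrict f {\<lambda>x\<in>\<real>. x}"
    by (simp add: res_mu_simps carrier_galois_Reals PiE_restrict)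
  also have "\<dots> = gal_single (f (\<lambda>x\<in>\<real>. x))" by (rule restrict_gal_single)
  finally show "f \<in> gal_single ` {z. z ^ n = 1}"
    using f by (auto simp: res_mu_simps carrier_galois_Reals PiE_iff)
next
  fix f assume "f \<in> gal_single ` {z. z ^ n = 1}"
  then obtain x where x: "x ^ n = 1" and f: "f = gal_single x" by blast
  show "f \<in> carrier (res_mu (\<real>, n))"
    unfolding res_mu_simps(1) fst_conv snd_conv carrier_galois_Reals f
    by (rule PiE_I) (use x gal_single_undefined in simp_all)
qed

lemma gal_pair_mult: "gal_pair x y \<otimes>\<^bsub>res_mu (UNIV, n)\<^esub> gal_pair x' y' = gal_pair (x * x') (y * y')"
  by (simp add: res_mu_simps carrier_galois_UNIV restrict_gal_pair)

lemma gal_single_mult: "gal_single x \<otimes>\<^bsub>res_mu (\<real>, n)\<^esub> gal_single x' = gal_single (x * x')"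
  by (simp add: res_mu_simps carrier_galois_Reals restrict_gal_single)

lemma diag_mu_UNIV: "diag_mu (UNIV, n) = (\<lambda>z. gal_pair z z) ` {z. z ^ n = 1}"
  by (simp add: diag_mu_eq carrier_galois_UNIV restrict_gal_pair)

lemma diag_mu_Reals: "diag_mu (\<real>, n) = gal_single ` {z. z ^ n = 1}"
  by (simp add: diag_mu_eq carrier_galois_Reals restrict_gal_single)

text \<open>
  The quotient \<open>f(1) / f(\<sigma>)\<close> identifies the group at level \<open>(\<complex>, n)\<close> with \<open>\<mu>\<^sub>n\<close>; \<open>u_coset (UNIV, n) a\<close> is
  the coset with quotient \<open>a\<close>. At level \<open>(\<real>, n)\<close> there is only one coset and \<open>a\<close> is ignored.
\<close>

definition u_coset :: "complex set \<times> nat \<Rightarrow> complex \<Rightarrow> ((complex \<Rightarrow> complex) \<Rightarrow> complex) set" where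
  "u_coset i a = {f \<in> carrier (res_mu i). fst i = UNIV \<longrightarrow> f (\<lambda>x. x) = a * f cnj}"

lemma u_index_cases:
  assumes "i \<in> u_index"
  obtains n where "n \<ge> 1" "i = (UNIV, n)" | n where "n \<ge> 1" "i = (\<real>, n)"
  using assms by (auto simp: u_index_def)

lemma u_coset_UNIV:
  "a ^ n = 1 \<Longrightarrow> u_coset (UNIV, n) a = (\<lambda>y. gal_pair (a * y) y) ` {y. y ^ n = 1}"
  by (auto simp: u_coset_def res_mu_UNIV power_mult_distrib)

lemma u_coset_Reals: "u_coset (\<real>, n) a = gal_single ` {z. z ^ n = 1}"
  by (simp add: u_coset_def res_mu_Reals)

lemma u_coset_inject:
  assumes a: "a ^ n = 1" and b: "b ^ n = 1" and eq: "u_coset (UNIV, n) a = u_coset (UNIV, n) b"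
  shows "a = b"
proof -
  have "gal_pair (a * 1) 1 \<in> u_coset (UNIV, n) a" using a by (auto simp: u_coset_UNIV)
  then show ?thesis using b unfolding eq by (auto simp: u_coset_UNIV)
qed

lemma set_multI: "f = a \<otimes>\<^bsub>G\<^esub> b \<Longrightarrow> a \<in> A \<Longrightarrow> b \<in> B \<Longrightarrow> f \<in> A <#>\<^bsub>G\<^esub> B"
  by (auto simp: set_mult_def)

lemma set_multE:
  assumes "f \<in> A <#>\<^bsub>G\<^esub> B"
  obtains a b where "f = a \<otimes>\<^bsub>G\<^esub> b" "a \<in> A" "b \<in> B"
  using assms by (auto simp: set_mult_def)

lemma u_coset_mult:
  assumes i: "i \<in> u_index" and a: "a ^ snd i = 1" "b ^ snd i = 1"
  shows "u_coset i a <#>\<^bsub>res_mu i\<^esub> u_coset i b = u_coset i (a * b)"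
  using i
proof (cases rule: u_index_cases)
  case (1 n)
  have ab: "a ^ n = 1" "b ^ n = 1" "(a * b) ^ n = 1" using a 1 by (auto simp: power_mult_distrib)
  show ?thesis
  proof (intro equalityI subsetI)
    fix f assume "f \<in> u_coset i (a * b)"
    then obtain y where y: "y ^ n = 1" "f = gal_pair (a * b * y) y" using ab by (auto simp: 1 u_coset_UNIV)
    show "f \<in> u_coset i a <#>\<^bsub>res_mu i\<^esub> u_coset i b"
    proof (rule set_multI)
      show "f = gal_pair (a * 1) 1 \<otimes>\<^bsub>res_mu i\<^esub> gal_pair (b * y) y" by (simp add: 1 gal_pair_mult y mult.assoc)
      show "gal_pair (a * 1) 1 \<in> u_coset i a" "gal_pair (b * y) y \<in> u_coset i b"
        using ab y unfolding 1 by (auto simp: u_coset_UNIV)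
    qed
  next
    fix f assume "f \<in> u_coset i a <#>\<^bsub>res_mu i\<^esub> u_coset i b"
    then obtain y y' where "y ^ n = 1" "y' ^ n = 1" "f = gal_pair (a * y) y \<otimes>\<^bsub>res_mu i\<^esub> gal_pair (b * y') y'"
      using ab by (auto simp: 1 u_coset_UNIV elim!: set_multE)
    then show "f \<in> u_coset i (a * b)"
      unfolding 1 gal_pair_mult u_coset_UNIV[OF ab(3)]
      by (intro image_eqI[of _ _ "y * y'"]) (auto simp: power_mult_distrib)
  qed
next
  case (2 n)
  show ?thesis
  proof (intro equalityI subsetI)
    fix f assume "f \<in> u_coset i (a * b)"
    then obtain z where z: "z ^ n = 1" "f = gal_single z" by (auto simp: 2 u_coset_Reals)
    show "f \<in> u_coset i a <#>\<^bsub>res_mu i\<^esub> u_coset i b"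
    proof (rule set_multI)
      show "f = gal_single 1 \<otimes>\<^bsub>res_mu i\<^esub> gal_single z" by (simp add: 2 gal_single_mult z)
    qed (use z in \<open>auto simp: 2 u_coset_Reals\<close>)
  qed (auto simp: 2 u_coset_Reals gal_single_mult power_mult_distrib elim!: set_multE)
qed

lemma diag_mu_eq_u_coset: "i \<in> u_index \<Longrightarrow> diag_mu i = u_coset i 1"
  by (elim u_index_cases) (simp_all add: diag_mu_UNIV diag_mu_Reals u_coset_UNIV u_coset_Reals)

lemma rcoset_diag_mu_UNIV:
  assumes n: "n \<ge> 1" and xy: "x ^ n = 1" "y ^ n = 1"
  shows "diag_mu (UNIV, n) #>\<^bsub>res_mu (UNIV, n)\<^esub> gal_pair x y = u_coset (UNIV, n) (x / y)"
proof -
  have nz: "y \<noteq> 0" using root_of_unity_nonzero[OF xy(2) n] .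
  have c: "(x / y) ^ n = 1" using xy by (simp add: power_divide)
  have "diag_mu (UNIV, n) #>\<^bsub>res_mu (UNIV, n)\<^esub> gal_pair x y = (\<lambda>z. gal_pair (z * x) (z * y)) ` {z. z ^ n = 1}"
    by (auto simp: r_coset_def diag_mu_UNIV gal_pair_mult)
  also have "\<dots> = u_coset (UNIV, n) (x / y)"
    unfolding u_coset_UNIV[OF c]
  proof (intro equalityI subsetI)
    fix f assume "f \<in> (\<lambda>y'. gal_pair (x / y * y') y') ` {y. y ^ n = 1}"
    then obtain w where w: "w ^ n = 1" "f = gal_pair (x / y * w) w" by auto
    then show "f \<in> (\<lambda>z. gal_pair (z * x) (z * y)) ` {z. z ^ n = 1}"
      using nz xy by (intro image_eqI[of _ _ "w / y"]) (auto simp: power_divide)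
  next
    fix f assume "f \<in> (\<lambda>z. gal_pair (z * x) (z * y)) ` {z. z ^ n = 1}"
    then obtain z where z: "z ^ n = 1" "f = gal_pair (z * x) (z * y)" by auto
    then show "f \<in> (\<lambda>y'. gal_pair (x / y * y') y') ` {y. y ^ n = 1}"
      using nz xy by (intro image_eqI[of _ _ "z * y"]) (auto simp: power_mult_distrib)
  qed
  finally show ?thesis .
qed

lemma rcoset_diag_mu_Reals:
  assumes n: "n \<ge> 1" and x: "x ^ n = 1"
  shows "diag_mu (\<real>, n) #>\<^bsub>res_mu (\<real>, n)\<^esub> gal_single x = u_coset (\<real>, n) 1"
proof -
  have nz: "x \<noteq> 0" using root_of_unity_nonzero[OF x n] .
  have "diag_mu (\<real>, n) #>\<^bsub>res_mu (\<real>, n)\<^esub> gal_single x = (\<lambda>z. gal_single (z * x)) ` {z. z ^ n = 1}"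
    by (auto simp: r_coset_def diag_mu_Reals gal_single_mult)
  also have "\<dots> = u_coset (\<real>, n) 1"
    unfolding u_coset_Reals
  proof (intro equalityI subsetI)
    fix f assume "f \<in> gal_single ` {z. z ^ n = 1}"
    then obtain w where "w ^ n = 1" "f = gal_single w" by auto
    then show "f \<in> (\<lambda>z. gal_single (z * x)) ` {z. z ^ n = 1}"
      using nz x by (intro image_eqI[of _ _ "w / x"]) (auto simp: power_divide)
  qed (use x in \<open>auto simp: power_mult_distrib\<close>)
  finally show ?thesis .
qed

lemma carrier_u_level:
  assumes i: "i \<in> u_index"
  shows "carrier (u_level i) = u_coset i ` {a. a ^ snd i = 1}"
proof -
  have R: "carrier (u_level i) = (\<lambda>f. diag_mu i #>\<^bsub>res_mu i\<^esub> f) ` carrier (res_mu i)"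
    by (auto simp: u_level_def FactGroup_def RCOSETS_def)
  from i show ?thesis
  proof (cases rule: u_index_cases)
    case (1 n)
    show ?thesis
    proof (intro equalityI subsetI)
      fix c assume "c \<in> carrier (u_level i)"
      then obtain x y where "x ^ n = 1" "y ^ n = 1" "c = diag_mu i #>\<^bsub>res_mu i\<^esub> gal_pair x y"
        unfolding R by (auto simp: 1 res_mu_UNIV)
      then show "c \<in> u_coset i ` {a. a ^ snd i = 1}"
        using 1 rcoset_diag_mu_UNIV[of n x y] by (auto simp: power_divide)
    next
      fix c assume "c \<in> u_coset i ` {a. a ^ snd i = 1}"
      then obtain a where "a ^ n = 1" "c = u_coset i a" using 1 by auto
      then show "c \<in> carrier (u_level i)"
        unfolding R using 1 rcoset_diag_mu_UNIV[of n a 1]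
        by (intro image_eqI[of _ _ "gal_pair a 1"]) (auto simp: res_mu_UNIV)
    qed
  next
    case (2 n)
    have e: "u_coset i a = u_coset i 1" for a by (simp add: 2 u_coset_Reals)
    have "carrier (u_level i) = {u_coset i 1}"
    proof -
      have "diag_mu i #>\<^bsub>res_mu i\<^esub> f = u_coset i 1" if "f \<in> carrier (res_mu i)" for f
        using that rcoset_diag_mu_Reals[OF 2(1)] by (auto simp: 2 res_mu_Reals)
      moreover have "gal_single 1 \<in> carrier (res_mu i)" by (simp add: 2 res_mu_Reals)
      ultimately show ?thesis unfolding R by blast
    qed
    moreover have "u_coset i ` {a. a ^ snd i = 1} = {u_coset i 1}"
    proof -
      have "1 \<in> {a :: complex. a ^ snd i = 1}" by simp
      then show ?thesis using e by blast
    qed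
    ultimately show ?thesis by simp
  qed
qed

lemma res_trans_UNIV:
  "res_trans (UNIV, m) (UNIV, n) (gal_pair x y) = gal_pair (x ^ (m div n)) (y ^ (m div n))"
proof -
  have "{b \<in> {\<lambda>x. x, cnj}. restrict b UNIV = \<tau>} = {\<tau>}" if "\<tau> \<in> {\<lambda>x. x, cnj}" for \<tau> :: "complex \<Rightarrow> complex"
    using that by (auto simp: restrict_UNIV)
  then show ?thesis
    by (simp add: res_trans_def carrier_galois_UNIV restrict_gal_pair)
qed

lemma res_trans_Reals:
  assumes j: "j \<in> u_index" and nm: "n dvd snd j" and f: "f \<in> carrier (res_mu j)"
  shows "res_trans j (\<real>, n) f \<in> gal_single ` {z. z ^ n = 1}"
proof -
  let ?B = "{b \<in> carrier (galois (fst j)). restrict b \<real> = (\<lambda>x\<in>\<real>. x)}"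
  have "(f b ^ (snd j div n)) ^ n = 1" if "b \<in> ?B" for b
  proof -
    have "(f b ^ (snd j div n)) ^ n = f b ^ (snd j div n * n)" by (rule power_mult[symmetric])
    also have "\<dots> = f b ^ snd j" using nm by simp
    also have "\<dots> = 1"
      using PiE_mem[OF f[unfolded res_mu_simps(1)], of b] that by simp
    finally show ?thesis .
  qed
  then have "(\<Prod>b\<in>?B. f b ^ (snd j div n)) ^ n = 1"
    unfolding prod_power_distrib by (rule prod.neutral[rule_format])
  then show ?thesis
    by (simp add: res_trans_def carrier_galois_Reals restrict_gal_single)
qed

lemma u_coset_nonempty: "j \<in> u_index \<Longrightarrow> a ^ snd j = 1 \<Longrightarrow> u_coset j a \<noteq> {}"
  using power_one by (elim u_index_cases) (auto simp: u_coset_UNIV u_coset_Reals)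

text \<open>Between two complex levels each automorphism has exactly one extension, so the
  transition map raises both coordinates, and hence their ratio, to the power m / n. At a real level
  there is a single coset, and one point of the image multiplied by the diagonal already fills
  it.\<close>

lemma u_trans_u_coset:
  assumes ij: "i \<in> u_index" "j \<in> u_index" "u_le i j" and a: "a ^ snd j = 1"
  shows "u_trans j i (u_coset j a) = u_coset i (a ^ (snd j div snd i))"
proof -
  obtain d where d: "snd j = snd i * d" using ij(3) by (auto simp: u_le_def)
  have pos: "snd i \<ge> 1" "snd j \<ge> 1" using ij by (auto simp: u_index_def)
  have dd: "snd j div snd i = d" using d pos by simp
  from ij(1) show ?thesis
  proof (cases rule: u_index_cases)
    case (1 n)
    then have j: "j = (UNIV, n * d)" using ij d by (cases j) (auto simp: u_le_def)
    have a': "(a ^ d) ^ n = 1" "a ^ (n * d) = 1"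
      using a power_mult[of a d n] by (simp_all add: j mult.commute)
    have n: "n * d div n = d" using 1 by simp
    have "res_trans j i ` u_coset j a = (\<lambda>y. gal_pair ((a * y) ^ d) (y ^ d)) ` {y. y ^ (n * d) = 1}"
      unfolding j 1 u_coset_UNIV[OF a'(2)] image_image res_trans_UNIV n ..
    moreover have "diag_mu i <#>\<^bsub>res_mu i\<^esub> \<dots> = u_coset i (a ^ d)"
      unfolding 1 diag_mu_UNIV u_coset_UNIV[OF a'(1)]
    proof (intro equalityI subsetI)
      fix g assume "g \<in> (\<lambda>y. gal_pair (a ^ d * y) y) ` {y. y ^ n = 1}"
      then obtain y where y: "y ^ n = 1" "g = gal_pair (a ^ d * y) y" by auto
      show "g \<in> (\<lambda>z. gal_pair z z) ` {z. z ^ n = 1} <#>\<^bsub>res_mu (UNIV, n)\<^esub>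
          (\<lambda>y. gal_pair ((a * y) ^ d) (y ^ d)) ` {y. y ^ (n * d) = 1}"
      proof (rule set_multI)
        show "g = gal_pair y y \<otimes>\<^bsub>res_mu (UNIV, n)\<^esub> gal_pair ((a * 1) ^ d) (1 ^ d)"
          by (simp add: gal_pair_mult y mult.commute)
        show "gal_pair ((a * 1) ^ d) (1 ^ d) \<in> (\<lambda>y. gal_pair ((a * y) ^ d) (y ^ d)) ` {y. y ^ (n * d) = 1}"
          by (rule image_eqI[of _ _ 1]) simp_all
      qed (use y in auto)
    next
      fix g assume "g \<in> (\<lambda>z. gal_pair z z) ` {z. z ^ n = 1} <#>\<^bsub>res_mu (UNIV, n)\<^esub>
          (\<lambda>y. gal_pair ((a * y) ^ d) (y ^ d)) ` {y. y ^ (n * d) = 1}"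
      then obtain z y where zy: "z ^ n = 1" "y ^ (n * d) = 1"
          "g = gal_pair z z \<otimes>\<^bsub>res_mu (UNIV, n)\<^esub> gal_pair ((a * y) ^ d) (y ^ d)"
        by (auto elim!: set_multE)
      show "g \<in> (\<lambda>y. gal_pair (a ^ d * y) y) ` {y. y ^ n = 1}"
        unfolding zy(3) gal_pair_mult using zy(1,2)
        by (intro image_eqI[of _ _ "z * y ^ d"])
          (auto simp: power_mult_distrib power_mult[of y d n, symmetric] mult.commute[of d])
    qed
    ultimately show ?thesis by (simp add: u_trans_def dd)
  next
    case (2 n)
    have c: "u_coset i b = gal_single ` {z. z ^ n = 1}" "diag_mu i = gal_single ` {z. z ^ n = 1}" for b
      by (simp_all add: 2 u_coset_Reals diag_mu_Reals)
    have m: "gal_single v \<otimes>\<^bsub>res_mu i\<^esub> gal_single w = gal_single (v * w)" for v w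
      by (simp add: 2 gal_single_mult)
    have sub: "res_trans j i ` u_coset j a \<subseteq> gal_single ` {z. z ^ n = 1}"
      using res_trans_Reals[OF ij(2), of n] d by (auto simp: 2 u_coset_def)
    obtain f where f: "f \<in> u_coset j a" using u_coset_nonempty[OF ij(2) a] by auto
    have "res_trans j i f \<in> gal_single ` {z. z ^ n = 1}" by (rule subsetD[OF sub imageI[OF f]])
    then obtain z where z: "z ^ n = 1" and fz: "res_trans j i f = gal_single z" by blast
    have zj: "gal_single z \<in> res_trans j i ` u_coset j a" unfolding fz[symmetric] by (rule imageI[OF f])
    have nz: "z \<noteq> 0" using root_of_unity_nonzero[OF z 2(1)] .
    have "diag_mu i <#>\<^bsub>res_mu i\<^esub> res_trans j i ` u_coset j a = u_coset i (a ^ (snd j div snd i))"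
    proof (intro equalityI subsetI)
      fix g assume "g \<in> u_coset i (a ^ (snd j div snd i))"
      then obtain w where w: "w ^ n = 1" "g = gal_single w" unfolding c by blast
      show "g \<in> diag_mu i <#>\<^bsub>res_mu i\<^esub> res_trans j i ` u_coset j a"
      proof (rule set_multI)
        show "g = gal_single (w / z) \<otimes>\<^bsub>res_mu i\<^esub> gal_single z" using nz by (simp add: m w)
        show "gal_single (w / z) \<in> diag_mu i" using z w by (simp add: c power_divide)
      qed (rule zj)
    next
      fix g assume "g \<in> diag_mu i <#>\<^bsub>res_mu i\<^esub> res_trans j i ` u_coset j a"
      then obtain x y where xy: "g = x \<otimes>\<^bsub>res_mu i\<^esub> y" "x \<in> diag_mu i" "y \<in> res_trans j i ` u_coset j a"
        by (rule set_multE)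
      obtain v where v: "v ^ n = 1" "x = gal_single v" using xy(2) unfolding c by blast
      obtain w where w: "w ^ n = 1" "y = gal_single w" using subsetD[OF sub xy(3)] by blast
      show "g \<in> u_coset i (a ^ (snd j div snd i))"
        unfolding c xy(1) v(2) w(2) m using v(1) w(1) by (intro imageI) (simp add: power_mult_distrib)
    qed
    then show ?thesis unfolding u_trans_def .
  qed
qed

section \<open>The Galois action on the levels of u\<close>

lemma cnj_root_of_unity: "a ^ n = 1 \<Longrightarrow> n \<ge> 1 \<Longrightarrow> a * cnj a = 1"
proof -
  assume a: "a ^ n = 1" "n \<ge> 1"
  then have "norm a = 1" using power_eq_1_iff[OF a(1)] by auto
  then show "a * cnj a = 1" by (simp add: complex_norm_square[symmetric])
qed

lemma group_galois_UNIV: "group \<Gamma>"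
  by (rule groupI) (auto simp: carrier_galois_UNIV compose_def)

lemma compose_id_Reals: "compose \<real> (\<lambda>x\<in>\<real>. x) (\<lambda>x\<in>\<real>. x) = (\<lambda>x\<in>\<real>. x :: complex)"
  by (rule ext) (simp add: compose_def)

lemma group_galois_Reals: "group (galois \<real>)"
  by (rule groupI) (simp_all add: carrier_galois_Reals compose_id_Reals)

lemma inv_galois_cnj: "inv\<^bsub>\<Gamma>\<^esub> cnj = cnj"
  by (rule group.inv_equality[OF group_galois_UNIV]) (auto simp: carrier_galois_UNIV compose_def)

lemma inv_galois_id: "inv\<^bsub>\<Gamma>\<^esub> (\<lambda>x. x) = (\<lambda>x. x)"
  by (rule group.inv_equality[OF group_galois_UNIV]) (auto simp: carrier_galois_UNIV compose_def)

lemma inv_galois_Reals: "inv\<^bsub>galois \<real>\<^esub> (\<lambda>x\<in>\<real>. x) = (\<lambda>x\<in>\<real>. x)"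
  by (rule group.inv_equality[OF group_galois_Reals]) (simp_all add: carrier_galois_Reals compose_id_Reals)

lemma res_act_UNIV:
  "res_act (UNIV, n) (\<lambda>x. x) (gal_pair x y) = gal_pair x y"
  "res_act (UNIV, n) cnj (gal_pair x y) = gal_pair (cnj y) (cnj x)"
  unfolding res_act_def fst_conv carrier_galois_UNIV restrict_gal_pair restrict_UNIV
  by (simp_all add: inv_galois_cnj inv_galois_id compose_def restrict_UNIV)

lemma res_act_Reals:
  assumes "s \<in> carrier \<Gamma>"
  shows "res_act (\<real>, n) s (gal_single x) = gal_single (s x)"
proof -
  have "restrict s \<real> = (\<lambda>x\<in>\<real>. x)"
    using assms by (auto simp: carrier_galois_UNIV fun_eq_iff Reals_cnj_iff)
  then show ?thesis
    unfolding res_act_def fst_conv carrier_galois_Reals restrict_gal_single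
    by (simp add: inv_galois_Reals compose_id_Reals)
qed

text \<open>Conjugation sends the pair (x, y) to (cnj y, cnj x). Since \<open>cnj\<close> inverts
  roots of unity, the ratio cnj y / cnj x equals x / y, so every coset is preserved as a set
  although its elements move.\<close>

lemma res_act_u_coset:
  assumes i: "i \<in> u_index" and s: "s \<in> carrier \<Gamma>" and a: "a ^ snd i = 1"
  shows "res_act i s ` u_coset i a = u_coset i a"
proof (cases "s = cnj")
  case False
  then have s: "s = (\<lambda>x. x)" using s by (simp add: carrier_galois_UNIV)
  have "s \<in> carrier \<Gamma>" unfolding s by (simp add: carrier_galois_UNIV)
  then have "res_act i s f = f" if "f \<in> u_coset i a" for f
    using that i a by (auto simp: s u_coset_UNIV u_coset_Reals res_act_UNIV res_act_Reals elim!: u_index_cases)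
  then show ?thesis by simp
next
  case True
  from i show ?thesis
  proof (cases rule: u_index_cases)
    case (1 n)
    have a': "a ^ n = 1" "a * cnj a = 1" using a 1 cnj_root_of_unity by auto
    show ?thesis
      unfolding True 1 u_coset_UNIV[OF a'(1)] image_image res_act_UNIV
    proof (intro equalityI subsetI)
      fix g assume "g \<in> (\<lambda>x. gal_pair (cnj x) (cnj (a * x))) ` {y. y ^ n = 1}"
      then obtain x where x: "x ^ n = 1" "g = gal_pair (cnj x) (cnj (a * x))" by auto
      have "a * cnj (a * x) = cnj x" using a'(2) by (simp add: mult.assoc[symmetric])
      moreover have "cnj (a * x) ^ n = 1"
        unfolding complex_cnj_power[symmetric] using x(1) a'(1) by (simp add: power_mult_distrib)
      ultimately show "g \<in> (\<lambda>y. gal_pair (a * y) y) ` {y. y ^ n = 1}"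
        unfolding x(2) by (intro image_eqI[of _ _ "cnj (a * x)"]) auto
    next
      fix g assume "g \<in> (\<lambda>y. gal_pair (a * y) y) ` {y. y ^ n = 1}"
      then obtain y where y: "y ^ n = 1" "g = gal_pair (a * y) y" by auto
      have "cnj a * a = 1" using a'(2) by (simp add: mult.commute)
      then have "cnj (a * (cnj a * cnj y)) = y" using a'(2) by (simp add: mult.assoc[symmetric])
      moreover have "(cnj a * cnj y) ^ n = 1"
        unfolding complex_cnj_mult[symmetric] complex_cnj_power[symmetric] using y(1) a'(1)
        by (simp add: power_mult_distrib)
      ultimately show "g \<in> (\<lambda>x. gal_pair (cnj x) (cnj (a * x))) ` {y. y ^ n = 1}"
        unfolding y(2) by (intro image_eqI[of _ _ "cnj a * cnj y"]) auto
    qed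
  next
    case (2 n)
    show ?thesis
      unfolding True 2 u_coset_Reals image_image res_act_Reals[OF s[unfolded True]]
    proof (intro equalityI subsetI)
      fix g assume "g \<in> gal_single ` {z. z ^ n = 1}"
      then obtain z where "z ^ n = 1" "g = gal_single z" by auto
      then show "g \<in> (\<lambda>x. gal_single (cnj x)) ` {z. z ^ n = 1}"
        by (intro image_eqI[of _ _ "cnj z"]) (auto simp: complex_cnj_power[symmetric] simp del: complex_cnj_power)
    qed (auto simp: complex_cnj_power[symmetric] simp del: complex_cnj_power)
  qed
qed

text \<open>The inverse limit of the groups of roots of unity under power maps. The value at index 0
  is left free; \<open>u_of\<close> reads only positive indices.\<close>

definition mu_system :: "(nat \<Rightarrow> complex) \<Rightarrow> bool" where
  "mu_system a \<longleftrightarrow> (\<forall>n\<ge>1. a n ^ n = 1) \<and> (\<forall>n\<ge>1. \<forall>m\<ge>1. n dvd m \<longrightarrow> a m ^ (m div n) = a n)"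

definition u_of :: "(nat \<Rightarrow> complex) \<Rightarrow> u_elem" where
  "u_of a = (\<lambda>i\<in>u_index. u_coset i (a (snd i)))"

lemma mu_systemD:
  assumes "mu_system a"
  shows "n \<ge> 1 \<Longrightarrow> a n ^ n = 1" "n \<ge> 1 \<Longrightarrow> m \<ge> 1 \<Longrightarrow> n dvd m \<Longrightarrow> a m ^ (m div n) = a n"
    "i \<in> u_index \<Longrightarrow> a (snd i) ^ snd i = 1"
  using assms by (auto simp: mu_system_def u_index_def)

lemma mu_system_one: "mu_system (\<lambda>_. 1)"
  by (simp add: mu_system_def)

lemma mu_system_mult: "mu_system a \<Longrightarrow> mu_system b \<Longrightarrow> mu_system (\<lambda>n. a n * b n)"
  by (simp add: mu_system_def power_mult_distrib)

lemma mu_system_inverse: "mu_system a \<Longrightarrow> mu_system (\<lambda>n. inverse (a n))"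
  by (simp add: mu_system_def power_inverse)

text \<open>The root is the shifted system n -> a (2 n). By compatibility its n-th power is
  \<open>a 2\<close>, so the hypothesis at level 2 is what makes it consist of n-th roots of unity.
  Thus level 2 detects squares in u.\<close>

lemma mu_system_sqrt:
  assumes a: "mu_system a" and a2: "a 2 = 1"
  obtains b where "mu_system b" "\<And>n. n \<ge> 1 \<Longrightarrow> b n * b n = a n"
proof -
  have r: "a (2 * m) ^ (m div n) = a (2 * n)" if "n \<ge> 1" "m \<ge> 1" "n dvd m" for n m
    using mu_systemD(2)[OF a, of "2 * n" "2 * m"] that by simp
  have "a (2 * n) ^ n = 1" if "n \<ge> 1" for n
    using mu_systemD(2)[OF a, of 2 "2 * n"] that a2 by simp
  then have "mu_system (\<lambda>n. a (2 * n))" using r by (simp add: mu_system_def)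
  moreover have "a (2 * n) * a (2 * n) = a n" if "n \<ge> 1" for n
    using mu_systemD(2)[OF a, of n "2 * n"] that by (simp add: power2_eq_square)
  ultimately show ?thesis using that by blast
qed

abbreviation u_mult (infixl "*\<^sub>u" 70) where "x *\<^sub>u y \<equiv> x \<otimes>\<^bsub>u_grp\<^esub> y"

section \<open>Identification of u with the compatible systems of roots of unity\<close>

lemma u_grp_simps:
  "x *\<^sub>u y = (\<lambda>i\<in>u_index. x i <#>\<^bsub>res_mu i\<^esub> y i)"
  "\<one>\<^bsub>u_grp\<^esub> = (\<lambda>i\<in>u_index. diag_mu i)"
  by (simp_all add: u_grp_def product_group_def u_level_def FactGroup_def)

lemma u_of_apply: "i \<in> u_index \<Longrightarrow> u_of a i = u_coset i (a (snd i))"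
  by (simp add: u_of_def)

lemma u_of_cong: "(\<And>n. n \<ge> 1 \<Longrightarrow> a n = b n) \<Longrightarrow> u_of a = u_of b"
  unfolding u_of_def by (rule restrict_ext) (auto simp: u_index_def)

lemma u_of_mult:
  assumes "mu_system a" "mu_system b"
  shows "u_of a *\<^sub>u u_of b = u_of (\<lambda>n. a n * b n)"
  unfolding u_grp_simps u_of_def
  by (rule restrict_ext) (simp add: u_coset_mult mu_systemD(3)[OF assms(1)] mu_systemD(3)[OF assms(2)])

lemma u_of_one: "\<one>\<^bsub>u_grp\<^esub> = u_of (\<lambda>_. 1)"
  unfolding u_grp_simps u_of_def by (rule restrict_ext) (simp add: diag_mu_eq_u_coset)

lemma u_of_carrier:
  assumes a: "mu_system a"
  shows "u_of a \<in> carrier u_grp"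
proof -
  have "u_of a i \<in> carrier (u_level i)" if "i \<in> u_index" for i
    using mu_systemD(3)[OF a that] that by (simp add: u_of_apply carrier_u_level)
  moreover have "u_trans j i (u_of a j) = u_of a i" if ij: "i \<in> u_index" "j \<in> u_index" "u_le i j" for i j
  proof -
    have "snd i \<ge> 1" "snd j \<ge> 1" "snd i dvd snd j" using ij by (auto simp: u_index_def u_le_def)
    then show ?thesis
      using u_trans_u_coset[OF ij mu_systemD(3)[OF a ij(2)]] ij mu_systemD(2)[OF a] by (simp add: u_of_apply)
  qed
  ultimately show ?thesis
    unfolding u_grp_def by (auto simp: u_of_def)
qed

text \<open>The components at the complex levels yield the system, and \<open>u_coset_inject\<close>
  turns compatibility of cosets into compatibility of numbers. At the real levels there is only one
  coset to match.\<close>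

lemma carrier_u_grpE:
  assumes x: "x \<in> carrier u_grp"
  obtains a where "mu_system a" "x = u_of a"
proof -
  have x1: "x i \<in> carrier (u_level i)" if "i \<in> u_index" for i
    using x that by (auto simp: u_grp_def)
  have x2: "u_trans j i (x j) = x i" if "i \<in> u_index" "j \<in> u_index" "u_le i j" for i j
    using x that by (auto simp: u_grp_def)
  have "\<exists>a. a ^ n = 1 \<and> x (UNIV, n) = u_coset (UNIV, n) a" if "n \<ge> 1" for n
  proof -
    have "(UNIV, n) \<in> u_index" using that by (simp add: u_index_def)
    then show ?thesis using x1[of "(UNIV, n)"] carrier_u_level[of "(UNIV, n)"] by auto
  qed
  then obtain a where a: "\<And>n. n \<ge> 1 \<Longrightarrow> a n ^ n = 1" "\<And>n. n \<ge> 1 \<Longrightarrow> x (UNIV, n) = u_coset (UNIV, n) (a n)"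
    by metis
  have "a m ^ (m div n) = a n" if nm: "n \<ge> 1" "m \<ge> 1" "n dvd m" for n m
  proof (rule u_coset_inject)
    show "(a m ^ (m div n)) ^ n = 1" using a(1)[OF nm(2)] nm(3) by (simp add: power_mult[symmetric])
    show "a n ^ n = 1" by (rule a(1)[OF nm(1)])
    have ij: "(UNIV, n) \<in> u_index" "(UNIV, m) \<in> u_index" "u_le (UNIV, n) (UNIV, m)"
      using nm by (simp_all add: u_index_def u_le_def)
    show "u_coset (UNIV, n) (a m ^ (m div n)) = u_coset (UNIV, n) (a n)"
      using u_trans_u_coset[OF ij, of "a m"] x2[OF ij] a nm by simp
  qed
  then have sys: "mu_system a" using a(1) by (simp add: mu_system_def)
  have "x = u_of a"
  proof (rule extensionalityI[of _ u_index])
    show "x \<in> extensional u_index" using x by (auto simp: u_grp_def PiE_def)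
    fix i assume i: "i \<in> u_index"
    then show "x i = u_of a i"
    proof (cases rule: u_index_cases)
      case (2 n)
      then show ?thesis using x1[OF i] carrier_u_level[OF i] i by (auto simp: u_of_apply u_coset_Reals)
    qed (use a i in \<open>simp add: u_of_apply\<close>)
  qed (simp add: u_of_def)
  then show ?thesis using that sys by blast
qed

lemma comm_group_u_grp: "comm_group u_grp"
proof (rule comm_groupI)
  show "\<exists>y\<in>carrier u_grp. y *\<^sub>u x = \<one>\<^bsub>u_grp\<^esub>" if x: "x \<in> carrier u_grp" for x
  proof -
    obtain a where a: "mu_system a" "x = u_of a" using x by (rule carrier_u_grpE)
    have "inverse (a n) * a n = 1" if "n \<ge> 1" for n
      using root_of_unity_nonzero[OF mu_systemD(1)[OF a(1) that] that] by simp
    then have "u_of (\<lambda>n. inverse (a n)) *\<^sub>u x = \<one>\<^bsub>u_grp\<^esub>"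
      unfolding a(2) u_of_mult[OF mu_system_inverse[OF a(1)] a(1)] u_of_one by (rule u_of_cong)
    then show ?thesis using u_of_carrier[OF mu_system_inverse[OF a(1)]] by blast
  qed
next
  fix x y assume "x \<in> carrier u_grp" "y \<in> carrier u_grp"
  then obtain a b where ab: "mu_system a" "x = u_of a" "mu_system b" "y = u_of b" by (elim carrier_u_grpE)
  show "x *\<^sub>u y \<in> carrier u_grp"
    unfolding ab(2,4) u_of_mult[OF ab(1,3)] by (rule u_of_carrier[OF mu_system_mult[OF ab(1,3)]])
  show "x *\<^sub>u y = y *\<^sub>u x"
    unfolding ab(2,4) u_of_mult[OF ab(1,3)] u_of_mult[OF ab(3,1)] by (simp add: mult.commute)
  fix z assume "z \<in> carrier u_grp"
  then obtain c where c: "mu_system c" "z = u_of c" by (elim carrier_u_grpE)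
  show "x *\<^sub>u y *\<^sub>u z = x *\<^sub>u (y *\<^sub>u z)"
    unfolding ab(2,4) c(2) u_of_mult[OF ab(1,3)] u_of_mult[OF ab(3) c(1)]
      u_of_mult[OF mu_system_mult[OF ab(1,3)] c(1)] u_of_mult[OF ab(1) mu_system_mult[OF ab(3) c(1)]]
    by (simp add: mult.assoc)
next
  show "\<one>\<^bsub>u_grp\<^esub> \<in> carrier u_grp" unfolding u_of_one by (rule u_of_carrier[OF mu_system_one])
  fix x assume "x \<in> carrier u_grp"
  then obtain a where a: "mu_system a" "x = u_of a" by (elim carrier_u_grpE)
  show "\<one>\<^bsub>u_grp\<^esub> *\<^sub>u x = x"
    unfolding a(2) u_of_one u_of_mult[OF mu_system_one a(1)] by simp
qed

lemma u_act_trivial: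
  assumes s: "s \<in> carrier \<Gamma>" and x: "x \<in> carrier u_grp"
  shows "u_act s x = x"
proof -
  obtain a where a: "mu_system a" "x = u_of a" using x by (rule carrier_u_grpE)
  show ?thesis
    unfolding a(2) u_act_def
    by (rule extensionalityI[of _ u_index])
      (simp_all add: u_of_apply res_act_u_coset[OF _ s] mu_systemD(3)[OF a(1)], simp add: u_of_def)
qed

section \<open>The topological generator of u\<close>

definition zeta :: "nat \<Rightarrow> complex" where
  "zeta n = cis (2 * pi / n)"

lemma zeta_power: "zeta n ^ k = cis (2 * pi * k / n)"
  by (simp add: zeta_def DeMoivre mult_ac)

lemma mu_system_zeta: "mu_system zeta"
  unfolding mu_system_def
proof (intro conjI allI impI)
  show "zeta n ^ n = 1" if "n \<ge> 1" for n
    using that by (simp add: zeta_power)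
  show "zeta m ^ (m div n) = zeta n" if nm: "n \<ge> 1" "m \<ge> 1" "n dvd m" for n m
  proof -
    obtain d where d: "m = n * d" using nm(3) by (rule dvdE)
    then show ?thesis using nm by (simp add: zeta_power) (simp add: zeta_def)
  qed
qed

lemma zeta_generates:
  assumes "z ^ n = 1" "n \<ge> 1"
  obtains k where "k < n" "z = zeta n ^ k"
proof -
  have "z \<in> (\<lambda>k. cis (2 * pi * real k / real n)) ` {..<n}"
    using bij_betw_roots_unity[of n] assms by (auto simp: bij_betw_def)
  then show ?thesis using that by (auto simp: zeta_power)
qed

lemma zeta_2: "zeta 2 = -1"
  by (simp add: zeta_def complex_eq_iff)

section \<open>A distinguished lift of complex conjugation\<close>

lemma id_in_galois [simp]: "(\<lambda>x. x) \<in> carrier \<Gamma>" and cnj_in_galois [simp]: "cnj \<in> carrier \<Gamma>"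
  by (simp_all add: carrier_galois_UNIV)

lemma compose_galois [simp]:
  "compose UNIV (\<lambda>x. x) s = s" "compose UNIV s (\<lambda>x. x) = s" "compose UNIV cnj cnj = (\<lambda>x. x)"
  by (simp_all add: compose_def restrict_UNIV)

section \<open>Two-cochains and coboundaries\<close>

lemma group_cochains2: "group cochains2"
  unfolding cochains2_def by (intro product_group comm_group.axioms(2)[OF comm_group_u_grp])

lemma cochains2_mult:
  "b \<otimes>\<^bsub>cochains2\<^esub> d = (\<lambda>p\<in>carrier \<Gamma> \<times> carrier \<Gamma>. b p *\<^sub>u d p)"
  by (simp add: cochains2_def product_group_def)

lemma carrier_cochains2: "carrier cochains2 = (carrier \<Gamma> \<times> carrier \<Gamma> \<rightarrow>\<^sub>E carrier u_grp)"
  by (simp add: cochains2_def product_group_def)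

text \<open>Because \<Gamma> acts trivially and u is commutative, the coboundary map
  \<open>D\<close> is a homomorphism on 1-cochains, and its image is a subgroup.\<close>

lemma subgroup_coboundaries2: "subgroup coboundaries2 cochains2"
proof -
  interpret u: comm_group u_grp by (rule comm_group_u_grp)
  let ?C = "product_group (carrier \<Gamma>) (\<lambda>_. u_grp)"
  define D where "D f = (\<lambda>(s, t)\<in>carrier \<Gamma> \<times> carrier \<Gamma>.
        u_act s (f t) *\<^sub>u inv\<^bsub>u_grp\<^esub> (f (s \<otimes>\<^bsub>\<Gamma>\<^esub> t)) *\<^sub>u f s)" for f :: "(complex \<Rightarrow> complex) \<Rightarrow> u_elem"
  have m: "s \<otimes>\<^bsub>\<Gamma>\<^esub> t \<in> carrier \<Gamma>" if "s \<in> carrier \<Gamma>" "t \<in> carrier \<Gamma>" for s t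
    by (rule monoid.m_closed[OF group.is_monoid[OF group_galois_UNIV] that])
  have D: "D f (s, t) = f t *\<^sub>u inv\<^bsub>u_grp\<^esub> (f (s \<otimes>\<^bsub>\<Gamma>\<^esub> t)) *\<^sub>u f s"
    if "f \<in> carrier ?C" "s \<in> carrier \<Gamma>" "t \<in> carrier \<Gamma>" for f s t
  proof -
    have "f t \<in> carrier u_grp" using PiE_mem[of f "carrier \<Gamma>" "\<lambda>_. carrier u_grp" t] that by simp
    then show ?thesis using that(2,3) u_act_trivial[OF that(2)] by (simp add: D_def)
  qed
  have fc: "f s \<in> carrier u_grp" if "f \<in> carrier ?C" "s \<in> carrier \<Gamma>" for f s
    using that by auto
  have c: "D f \<in> carrier cochains2" if f: "f \<in> carrier ?C" for f
    unfolding carrier_cochains2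
  proof (rule PiE_I)
    fix p assume "p \<in> carrier \<Gamma> \<times> carrier \<Gamma>"
    then obtain s t where p: "p = (s, t)" "s \<in> carrier \<Gamma>" "t \<in> carrier \<Gamma>" by auto
    show "D f p \<in> carrier u_grp"
      unfolding p(1) D[OF f p(2,3)] using fc[OF f] p m by (intro u.m_closed u.inv_closed) auto
  qed (simp add: D_def)
  have "D \<in> hom ?C cochains2"
  proof (rule homI)
    fix f g assume f: "f \<in> carrier ?C" and g: "g \<in> carrier ?C"
    have fg: "f \<otimes>\<^bsub>?C\<^esub> g \<in> carrier ?C"
      using f g by (intro monoid.m_closed group.is_monoid product_group u.is_group) auto
    show "D (f \<otimes>\<^bsub>?C\<^esub> g) = D f \<otimes>\<^bsub>cochains2\<^esub> D g"
    proof (rule extensionalityI[of _ "carrier \<Gamma> \<times> carrier \<Gamma>"])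
      fix p assume "p \<in> carrier \<Gamma> \<times> carrier \<Gamma>"
      then obtain s t where p: "p = (s, t)" "s \<in> carrier \<Gamma>" "t \<in> carrier \<Gamma>" by auto
      have e: "(f \<otimes>\<^bsub>?C\<^esub> g) s = f s *\<^sub>u g s" if "s \<in> carrier \<Gamma>" for s using that by simp
      show "D (f \<otimes>\<^bsub>?C\<^esub> g) p = (D f \<otimes>\<^bsub>cochains2\<^esub> D g) p"
        unfolding p(1) D[OF fg p(2,3)] cochains2_mult
        using p(2,3) fc[OF f] fc[OF g] m[OF p(2,3)]
        by (simp add: D[OF f] D[OF g] e u.inv_mult u.m_ac del: galois_simps mult_product_group)
    qed (auto simp: D_def cochains2_mult)
  qed (rule c)
  then interpret group_hom ?C cochains2 D
    using group_cochains2 product_group[of "carrier \<Gamma>" "\<lambda>_. u_grp"] u.is_group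
    by (simp add: group_hom_def group_hom_axioms_def)
  have "coboundaries2 = D ` carrier ?C"
    unfolding coboundaries2_def D_def by simp
  then show ?thesis using img_is_subgroup by simp
qed

lemma coboundary_imp_trivial_class:
  assumes \<xi>: "\<xi> \<in> carrier H2_u" and c: "c \<in> \<xi>" "c \<in> coboundaries2"
  shows "\<xi> = \<one>\<^bsub>H2_u\<^esub>"
proof -
  interpret group cochains2 by (rule group_cochains2)
  obtain d where d: "d \<in> carrier cocycles2" and e: "\<xi> = coboundaries2 #>\<^bsub>cocycles2\<^esub> d"
    using \<xi> by (auto simp: H2_u_def FactGroup_def RCOSETS_def)
  have dc: "d \<in> carrier cochains2" using d by (simp add: cocycles2_def)
  \<comment> \<open>Cocycles and cochains share their multiplication, so the coset may be formed
    among all cochains, where the group laws are at hand.\<close>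
  have e': "\<xi> = coboundaries2 #>\<^bsub>cochains2\<^esub> d" using e by (simp add: r_coset_def cocycles2_def)
  have "\<xi> = coboundaries2 #>\<^bsub>cochains2\<^esub> c"
    unfolding e' using c(1) subgroup_coboundaries2 dc by (intro repr_independence) (simp_all add: e')
  also have "\<dots> = coboundaries2"
    using subgroup_coboundaries2 c(2) by (intro coset_join2 subgroup.mem_carrier) auto
  finally show ?thesis by (simp add: H2_u_def FactGroup_def)
qed

text \<open>An arbitrary lift t of \<open>cnj\<close> has square \<open>inc y\<close> with y in u,
  and changing t by v in u changes y by v^2. If y were a square, the factor set would be a
  coboundary; so y has component -1 at level 2, like \<open>zeta\<close>, and the two differ by a
  square that can be absorbed into t.\<close>

lemma extension_lift_cnj:
  assumes W: "extension_of_class W \<xi>" and \<xi>: "\<xi> \<in> carrier H2_u" "\<xi> \<noteq> \<one>\<^bsub>H2_u\<^esub>"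
  obtains s where "s \<in> carrier (ext_grp W)" "ext_proj W s = cnj"
    "s \<otimes>\<^bsub>ext_grp W\<^esub> s = ext_incl W (u_of zeta)"
proof -
  let ?E = "ext_grp W" and ?i = "ext_incl W"
  have P: "profinite_extension W" using W by (simp add: extension_of_class_def)
  interpret E: group ?E
    using P by (simp add: profinite_extension_def profinite_group_def topological_group_def)
  interpret u: comm_group u_grp by (rule comm_group_u_grp)
  interpret i: group_hom u_grp ?E ?i
    using P by unfold_locales (simp add: profinite_extension_def)
  have inj: "inj_on ?i (carrier u_grp)" using P by (simp add: profinite_extension_def)
  interpret p: group_hom ?E \<Gamma> "ext_proj W"
    using P group_galois_UNIV E.is_group
    by (simp add: profinite_extension_def group_hom_def group_hom_axioms_def)
  have pi: "ext_proj W (?i x) = (\<lambda>x. x)" if "x \<in> carrier u_grp" for x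
  proof -
    have "?i x \<in> kernel ?E \<Gamma> (ext_proj W)" using P that by (auto simp: profinite_extension_def)
    then show ?thesis by (simp add: kernel_def restrict_UNIV)
  qed
  have conj: "w \<otimes>\<^bsub>?E\<^esub> ?i x = ?i x \<otimes>\<^bsub>?E\<^esub> w" if w: "w \<in> carrier ?E" and x: "x \<in> carrier u_grp" for w x
  proof -
    have "w \<otimes>\<^bsub>?E\<^esub> ?i x \<otimes>\<^bsub>?E\<^esub> inv\<^bsub>?E\<^esub> w = ?i (u_act (ext_proj W w) x)"
      using P that by (simp add: profinite_extension_def)
    also have "\<dots> = ?i x" using u_act_trivial[OF p.hom_closed[OF w] x] by simp
    finally show ?thesis using w x E.inv_solve_right'[of "?i x" "w \<otimes>\<^bsub>?E\<^esub> ?i x" w] by (simp add: E.inv_solve_right')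
  qed
  obtain \<sigma> c where \<sigma>: "\<sigma> \<in> carrier \<Gamma> \<rightarrow> carrier ?E" and c: "c \<in> \<xi>"
    and sec: "\<forall>a\<in>carrier \<Gamma>. ext_proj W (\<sigma> a) = a"
    and fs: "\<forall>a\<in>carrier \<Gamma>. \<forall>b\<in>carrier \<Gamma>. \<sigma> a \<otimes>\<^bsub>?E\<^esub> \<sigma> b = ?i (c (a, b)) \<otimes>\<^bsub>?E\<^esub> \<sigma> (a \<otimes>\<^bsub>\<Gamma>\<^esub> b)"
    using W by (auto simp: extension_of_class_def)
  have cc: "c \<in> carrier cochains2"
  proof -
    interpret C: group cochains2 by (rule group_cochains2)
    obtain d where "d \<in> carrier cocycles2" "\<xi> = coboundaries2 #>\<^bsub>cocycles2\<^esub> d"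
      using \<xi> by (auto simp: H2_u_def FactGroup_def RCOSETS_def)
    then obtain b where "b \<in> coboundaries2" "d \<in> carrier cochains2" "c = b \<otimes>\<^bsub>cochains2\<^esub> d"
      using c by (auto simp: r_coset_def cocycles2_def)
    then show ?thesis using subgroup.mem_carrier[OF subgroup_coboundaries2] by auto
  qed
  have cu: "c (a, b) \<in> carrier u_grp" if "a \<in> carrier \<Gamma>" "b \<in> carrier \<Gamma>" for a b
    using PiE_mem[OF cc[unfolded carrier_cochains2]] that by auto
  \<comment> \<open>The section need not be normalized: \<open>e\<close> is the lift of the
    identity, and the factor set forces it to be the image of \<open>c1\<close> rather than
    1.\<close>
  define e t where "e = \<sigma> (\<lambda>x. x)" and "t = \<sigma> cnj"
  have et: "e \<in> carrier ?E" "t \<in> carrier ?E" using \<sigma> unfolding e_def t_def by (auto simp: Pi_iff)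
  define c1 where "c1 = c (\<lambda>x. x, \<lambda>x. x)"
  have c1: "c1 \<in> carrier u_grp" unfolding c1_def by (rule cu) simp_all
  have F: "e \<otimes>\<^bsub>?E\<^esub> e = ?i c1 \<otimes>\<^bsub>?E\<^esub> e" "e \<otimes>\<^bsub>?E\<^esub> t = ?i (c (\<lambda>x. x, cnj)) \<otimes>\<^bsub>?E\<^esub> t"
    "t \<otimes>\<^bsub>?E\<^esub> e = ?i (c (cnj, \<lambda>x. x)) \<otimes>\<^bsub>?E\<^esub> t" "t \<otimes>\<^bsub>?E\<^esub> t = ?i (c (cnj, cnj)) \<otimes>\<^bsub>?E\<^esub> e"
    unfolding e_def t_def c1_def using fs[rule_format, of "\<lambda>x. x" "\<lambda>x. x"] fs[rule_format, of "\<lambda>x. x" cnj]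
      fs[rule_format, of cnj "\<lambda>x. x"] fs[rule_format, of cnj cnj] by simp_all
  have e: "e = ?i c1"
    using F(1) et c1 E.right_cancel by simp
  have c12: "c (\<lambda>x. x, cnj) = c1" "c (cnj, \<lambda>x. x) = c1"
  proof -
    have "?i c1 = ?i (c (\<lambda>x. x, cnj))"
      using F(2) et c1 cu[of "\<lambda>x. x" cnj] unfolding e by simp
    then show "c (\<lambda>x. x, cnj) = c1"
      using inj_onD[OF inj] c1 cu[of "\<lambda>x. x" cnj] by simp
    have "?i c1 = ?i (c (cnj, \<lambda>x. x))"
      using F(3) et c1 cu[of cnj "\<lambda>x. x"] conj[OF et(2) c1] unfolding e by simp
    then show "c (cnj, \<lambda>x. x) = c1"
      using inj_onD[OF inj] c1 cu[of cnj "\<lambda>x. x"] by simp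
  qed
  \<comment> \<open>From t * t = c (cnj, cnj) * e and e = c1, both read in W.\<close>
  define y where "y = c (cnj, cnj) *\<^sub>u c1"
  have yu: "y \<in> carrier u_grp" unfolding y_def by (intro u.m_closed cu c1) simp_all
  have tt: "t \<otimes>\<^bsub>?E\<^esub> t = ?i y" unfolding F(4) e y_def using c1 cu[of cnj cnj] by simp
  obtain a where a: "mu_system a" "y = u_of a" using yu by (rule carrier_u_grpE)
  have "a 2 \<noteq> 1"
  proof
    assume "a 2 = 1"
    with a(1) obtain b where b: "mu_system b" "\<And>n. n \<ge> 1 \<Longrightarrow> b n * b n = a n" by (rule mu_system_sqrt) blast
    define v where "v = u_of b"
    have v: "v \<in> carrier u_grp" unfolding v_def by (rule u_of_carrier[OF b(1)])
    have vv: "v *\<^sub>u v = y" unfolding v_def a(2) u_of_mult[OF b(1) b(1)] by (rule u_of_cong) (rule b(2))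
    \<comment> \<open>At (1, 1) the coboundary of \<open>f\<close> is \<open>c1\<close>, and at
      (cnj, cnj) it is v c1^-1 v. The latter equals y c1^-1 = c (cnj, cnj) because v^2 = y, so
      \<open>f\<close> trivializes the factor set.\<close>
    define f where "f = (\<lambda>s\<in>carrier \<Gamma>. if s = cnj then v else c1)"
    have f: "f \<in> carrier \<Gamma> \<rightarrow>\<^sub>E carrier u_grp" using v c1 by (auto simp: f_def)
    have f12: "f (\<lambda>x. x) = c1" "f cnj = v" by (simp_all add: f_def)
    let ?D = "\<lambda>(s, t)\<in>carrier \<Gamma> \<times> carrier \<Gamma>.
        u_act s (f t) *\<^sub>u inv\<^bsub>u_grp\<^esub> (f (s \<otimes>\<^bsub>\<Gamma>\<^esub> t)) *\<^sub>u f s"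
    have "c = ?D"
    proof (rule extensionalityI[of _ "carrier \<Gamma> \<times> carrier \<Gamma>"])
      show "c \<in> extensional (carrier \<Gamma> \<times> carrier \<Gamma>)" using cc by (simp add: carrier_cochains2 PiE_def)
      fix p assume "p \<in> carrier \<Gamma> \<times> carrier \<Gamma>"
      then obtain s t where p: "p = (s, t)" "s \<in> carrier \<Gamma>" "t \<in> carrier \<Gamma>" by auto
      have act: "u_act s x = x" if "x \<in> carrier u_grp" for x by (rule u_act_trivial[OF p(2) that])
      have ccc: "c (cnj, cnj) = v *\<^sub>u inv\<^bsub>u_grp\<^esub> c1 *\<^sub>u v"
      proof -
        have "c (cnj, cnj) = y *\<^sub>u inv\<^bsub>u_grp\<^esub> c1"
          unfolding y_def using c1 cu[of cnj cnj] by (simp add: u.m_assoc)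
        then show ?thesis unfolding vv[symmetric] using v c1 by (simp add: u.m_ac)
      qed
      consider "s = (\<lambda>x. x)" "t = (\<lambda>x. x)" | "s = (\<lambda>x. x)" "t = cnj" | "s = cnj" "t = (\<lambda>x. x)" | "s = cnj" "t = cnj"
        using p(2,3) by (auto simp: carrier_galois_UNIV)
      then show "c p = ?D p"
      proof cases
        case 1
        then show ?thesis using c1 act by (simp add: p(1) f12 c1_def[symmetric] u.m_assoc)
      next
        case 2
        then show ?thesis using c1 v act by (simp add: p(1) f12 c12 u.m_assoc)
      next
        case 3
        then show ?thesis using c1 v act by (simp add: p(1) f12 c12 u.m_assoc)
      next
        case 4
        then show ?thesis using c1 v act ccc by (simp add: p(1) f12)
      qed
    qed simp
    then have "c \<in> coboundaries2" unfolding coboundaries2_def using f by blast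
    then show False using coboundary_imp_trivial_class[OF \<xi>(1) c] \<xi>(2) by simp
  qed
  then have a2: "a 2 = -1"
    using mu_systemD(1)[OF a(1), of 2] by (simp add: power2_eq_1_iff)
  \<comment> \<open>The correction from y to \<open>zeta\<close>. At level 2 both components are -1,
    so their quotient is 1 there and therefore a square.\<close>
  let ?r = "\<lambda>n. zeta n * inverse (a n)"
  have "mu_system ?r" by (rule mu_system_mult[OF mu_system_zeta mu_system_inverse[OF a(1)]])
  moreover have "?r 2 = 1" by (simp add: a2 zeta_2)
  ultimately obtain b where b: "mu_system b" "\<And>n. n \<ge> 1 \<Longrightarrow> b n * b n = ?r n" by (rule mu_system_sqrt) blast
  define v where "v = u_of b"
  have v: "v \<in> carrier u_grp" unfolding v_def by (rule u_of_carrier[OF b(1)])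
  have vvy: "v *\<^sub>u v *\<^sub>u y = u_of zeta"
    unfolding v_def a(2) u_of_mult[OF b(1) b(1)] u_of_mult[OF mu_system_mult[OF b(1) b(1)] a(1)]
  proof (rule u_of_cong)
    fix n :: nat assume n: "n \<ge> 1"
    have "a n \<noteq> 0" using root_of_unity_nonzero[OF mu_systemD(1)[OF a(1) n] n] .
    then show "b n * b n * a n = zeta n" using b(2)[OF n] by simp
  qed
  let ?s = "?i v \<otimes>\<^bsub>?E\<^esub> t"
  have iv: "?i v \<in> carrier ?E" using v by simp
  have "?s \<otimes>\<^bsub>?E\<^esub> ?s = ?i v \<otimes>\<^bsub>?E\<^esub> (t \<otimes>\<^bsub>?E\<^esub> ?i v) \<otimes>\<^bsub>?E\<^esub> t" using iv et by (simp add: E.m_assoc)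
  also have "\<dots> = ?i v \<otimes>\<^bsub>?E\<^esub> ?i v \<otimes>\<^bsub>?E\<^esub> (t \<otimes>\<^bsub>?E\<^esub> t)" unfolding conj[OF et(2) v] using iv et by (simp add: E.m_assoc)
  also have "\<dots> = ?i (u_of zeta)" unfolding tt vvy[symmetric] using v yu by simp
  finally have "?s \<otimes>\<^bsub>?E\<^esub> ?s = ?i (u_of zeta)" .
  moreover have "ext_proj W t = cnj" using sec by (simp add: t_def)
  then have "ext_proj W ?s = cnj" using iv et pi[OF v] by simp
  ultimately show ?thesis using that iv et by blast
qed

section \<open>Rigid cocycles\<close>

text \<open>Retains from the cohomology class of the extension just a lift of conjugation with
  prescribed square; together with the centrality of u this fixes the group law of W.\<close>

locale cnj_lift =
  fixes W :: "'w extension" and s :: 'w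
  assumes profinite: "profinite_extension W"
    and s: "s \<in> carrier (ext_grp W)"
    and proj_s: "ext_proj W s = cnj"
    and s_square: "s \<otimes>\<^bsub>ext_grp W\<^esub> s = ext_incl W (u_of zeta)"
begin

abbreviation E where "E \<equiv> ext_grp W"
abbreviation inc where "inc \<equiv> ext_incl W"
abbreviation mult_E (infixl "\<star>" 70) where "x \<star> y \<equiv> x \<otimes>\<^bsub>E\<^esub> y"

sublocale E: group E
  using profinite by (simp add: profinite_extension_def profinite_group_def topological_group_def)

sublocale u: comm_group u_grp by (rule comm_group_u_grp)

sublocale inc: group_hom u_grp E inc
  using profinite by unfold_locales (simp add: profinite_extension_def)

sublocale proj: group_hom E \<Gamma> "ext_proj W"
  using profinite group_galois_UNIV E.is_group
  by (simp add: profinite_extension_def group_hom_def group_hom_axioms_def)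

lemma inc_inj: "inj_on inc (carrier u_grp)"
  using profinite by (simp add: profinite_extension_def)

lemma kernel_proj: "inc ` carrier u_grp = kernel E \<Gamma> (ext_proj W)"
  using profinite by (simp add: profinite_extension_def)

lemma proj_inc: "x \<in> carrier u_grp \<Longrightarrow> ext_proj W (inc x) = (\<lambda>x. x)"
  using kernel_proj by (auto simp: kernel_def restrict_UNIV)

lemma proj_inc_s: "x \<in> carrier u_grp \<Longrightarrow> ext_proj W (inc x \<star> s) = cnj"
  using s by (simp add: proj_inc proj_s)

lemma inc_commutes:
  assumes w: "w \<in> carrier E" and x: "x \<in> carrier u_grp"
  shows "w \<star> inc x = inc x \<star> w"
proof -
  have "w \<star> inc x \<star> inv\<^bsub>E\<^esub> w = inc (u_act (ext_proj W w) x)"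
    using profinite assms by (simp add: profinite_extension_def)
  also have "\<dots> = inc x" using u_act_trivial[OF proj.hom_closed[OF w] x] by simp
  finally show ?thesis using w x by (simp add: E.inv_solve_right')
qed

lemma E_cases:
  assumes w: "w \<in> carrier E"
  obtains x where "x \<in> carrier u_grp" "w = inc x" "ext_proj W w = (\<lambda>x. x)"
  | x where "x \<in> carrier u_grp" "w = inc x \<star> s" "ext_proj W w = cnj"
proof -
  have "ext_proj W w = (\<lambda>x. x) \<or> ext_proj W w = cnj"
    using proj.hom_closed[OF w] by (simp add: carrier_galois_UNIV)
  then show ?thesis
  proof
    assume p: "ext_proj W w = (\<lambda>x. x)"
    then have "w \<in> inc ` carrier u_grp" unfolding kernel_proj using w by (simp add: kernel_def restrict_UNIV)
    then show ?thesis using that(1) p by blast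
  next
    assume p: "ext_proj W w = cnj"
    have "ext_proj W (w \<star> inv\<^bsub>E\<^esub> s) = (\<lambda>x. x)"
      using w s p proj_s by (simp add: inv_galois_cnj)
    then have "w \<star> inv\<^bsub>E\<^esub> s \<in> inc ` carrier u_grp"
      unfolding kernel_proj using w s by (simp add: kernel_def restrict_UNIV)
    then obtain x where x: "x \<in> carrier u_grp" "w \<star> inv\<^bsub>E\<^esub> s = inc x" by blast
    have "w = inc x \<star> s" using w s by (simp add: x(2)[symmetric] E.m_assoc)
    then show ?thesis using that(2) p x(1) by blast
  qed
qed

text \<open>With \<open>E_cases\<close>, the complete multiplication table of W: s commutes with u,
  and the square of s contributes the only extra factor.\<close>

lemma mult_cases:
  assumes x: "x \<in> carrier u_grp" and y: "y \<in> carrier u_grp"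
  shows "inc x \<star> inc y = inc (x *\<^sub>u y)"
    and "inc x \<star> (inc y \<star> s) = inc (x *\<^sub>u y) \<star> s"
    and "(inc x \<star> s) \<star> inc y = inc (x *\<^sub>u y) \<star> s"
    and "(inc x \<star> s) \<star> (inc y \<star> s) = inc (x *\<^sub>u y *\<^sub>u u_of zeta)"
proof -
  have c: "inc x \<in> carrier E" "inc y \<in> carrier E" "u_of zeta \<in> carrier u_grp"
    using x y u_of_carrier[OF mu_system_zeta] by simp_all
  show 1: "inc x \<star> inc y = inc (x *\<^sub>u y)" using x y by simp
  show "inc x \<star> (inc y \<star> s) = inc (x *\<^sub>u y) \<star> s"
    unfolding 1[symmetric] using c s by (simp add: E.m_assoc)
  show 3: "(inc x \<star> s) \<star> inc y = inc (x *\<^sub>u y) \<star> s"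
    unfolding 1[symmetric] using c s inc_commutes[OF s y] by (simp add: E.m_assoc)
  have "(inc x \<star> s) \<star> (inc y \<star> s) = ((inc x \<star> s) \<star> inc y) \<star> s"
    using c s by (simp add: E.m_assoc)
  also have "\<dots> = inc (x *\<^sub>u y) \<star> (s \<star> s)"
    unfolding 3 using x y s inc.hom_closed[of "x *\<^sub>u y"] by (simp add: E.m_assoc del: inc.hom_mult)
  also have "\<dots> = inc (x *\<^sub>u y *\<^sub>u u_of zeta)"
    unfolding s_square using x y c(3) by simp
  finally show "(inc x \<star> s) \<star> (inc y \<star> s) = inc (x *\<^sub>u y *\<^sub>u u_of zeta)" .
qed

end

lemma map_mat_id: "map_mat (\<lambda>x. x) A = A"
  by (intro eq_matI) auto

locale rigid_group = cnj_lift W s + real_group G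
  for W :: "'w extension" and s :: 'w and G :: lin_group
begin

section \<open>Determination of a rigid cocycle by its value at s\<close>

lemma u_zeta: "u_of zeta \<in> carrier u_grp"
  by (rule u_of_carrier[OF mu_system_zeta])

lemma rigid_cocycleD:
  assumes z: "rigid_cocycle G W Z z"
  shows "w \<in> carrier E \<Longrightarrow> z w \<in> carrier (pts G)"
    and "w \<in> carrier E \<Longrightarrow> w' \<in> carrier E \<Longrightarrow> z (w \<star> w') = z w \<cdot> map_mat (ext_proj W w) (z w')"
    and "x \<in> carrier u_grp \<Longrightarrow> z (inc x) \<in> Z"
    and "\<exists>i\<in>u_index. \<forall>x\<in>carrier u_grp. \<forall>y\<in>carrier u_grp. x i = y i \<longrightarrow> z (inc x) = z (inc y)"
proof -
  show "w \<in> carrier E \<Longrightarrow> z w \<in> carrier (pts G)"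
    using z by (auto simp: rigid_cocycle_def)
  show "w \<in> carrier E \<Longrightarrow> w' \<in> carrier E \<Longrightarrow> z (w \<star> w') = z w \<cdot> map_mat (ext_proj W w) (z w')"
    using z unfolding rigid_cocycle_def by blast
  obtain i \<phi> where i: "i \<in> u_index" "\<phi> \<in> hom (u_level i) ((pts G)\<lparr>carrier := Z\<rparr>)"
    "\<And>x. x \<in> carrier u_grp \<Longrightarrow> z (inc x) = \<phi> (x i)"
    using z unfolding rigid_cocycle_def by blast
  have "x i \<in> carrier (u_level i)" if "x \<in> carrier u_grp" for x
    using that i(1) by (auto simp: u_grp_def)
  then show "x \<in> carrier u_grp \<Longrightarrow> z (inc x) \<in> Z"
    using i(2,3) by (auto simp: hom_def)
  show "\<exists>i\<in>u_index. \<forall>x\<in>carrier u_grp. \<forall>y\<in>carrier u_grp. x i = y i \<longrightarrow> z (inc x) = z (inc y)"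
    using i by metis
qed

lemma rigid_cocycle_inc_mult:
  assumes z: "rigid_cocycle G W Z z" and xy: "x \<in> carrier u_grp" "y \<in> carrier u_grp"
  shows "z (inc (x *\<^sub>u y)) = z (inc x) \<cdot> z (inc y)"
  using rigid_cocycleD(2)[OF z, of "inc x" "inc y"] xy by (simp add: proj_inc map_mat_id)

lemma rigid_cocycle_square:
  assumes z: "rigid_cocycle G W Z z"
  shows "z (inc (u_of zeta)) = z s \<cdot> map_mat cnj (z s)"
  using rigid_cocycleD(2)[OF z s s] by (simp only: s_square proj_s)

lemma mu_system_zeta_power: "mu_system (\<lambda>n. zeta n ^ t)"
proof (induction t)
  case (Suc t)
  then show ?case using mu_system_mult[OF mu_system_zeta Suc] by simp
qed (simp add: mu_system_one)

lemma rigid_cocycle_power: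
  assumes z: "rigid_cocycle G W Z z"
  shows "z (inc (u_of (\<lambda>n. zeta n ^ t))) = z (inc (u_of zeta)) [^]\<^bsub>pts G\<^esub> t"
proof (induction t)
  case 0
  have "z (inc \<one>\<^bsub>u_grp\<^esub>) \<cdot> z (inc \<one>\<^bsub>u_grp\<^esub>) = z (inc \<one>\<^bsub>u_grp\<^esub>)"
    using rigid_cocycle_inc_mult[OF z, of "\<one>\<^bsub>u_grp\<^esub>" "\<one>\<^bsub>u_grp\<^esub>"] by simp
  then have "z (inc \<one>\<^bsub>u_grp\<^esub>) = \<one>\<^bsub>pts G\<^esub>"
    using rigid_cocycleD(1)[OF z, of "inc \<one>\<^bsub>u_grp\<^esub>"] G.r_cancel_one[of "z (inc \<one>\<^bsub>u_grp\<^esub>)" "z (inc \<one>\<^bsub>u_grp\<^esub>)"]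
    by (simp del: pts_simps)
  then show ?case by (simp add: u_of_one del: inc.hom_one pts_simps)
next
  case (Suc t)
  have e: "u_of (\<lambda>n. zeta n ^ Suc t) = u_of (\<lambda>n. zeta n ^ t) *\<^sub>u u_of zeta"
    unfolding u_of_mult[OF mu_system_zeta_power mu_system_zeta] by (simp add: mult.commute)
  show ?case
    unfolding e rigid_cocycle_inc_mult[OF z u_of_carrier[OF mu_system_zeta_power] u_zeta] Suc
    by (simp del: pts_simps)
qed

text \<open>Each cocycle sees x only at one finite level, where x coincides with a power of the
  generator. Powers of the generator have known images because a cocycle is multiplicative on
  u.\<close>

lemma rigid_cocycle_inc_determined:
  assumes z1: "rigid_cocycle G W Z1 z1" and z2: "rigid_cocycle G W Z2 z2"
    and eq: "z1 (inc (u_of zeta)) = z2 (inc (u_of zeta))" and x: "x \<in> carrier u_grp"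
  shows "z1 (inc x) = z2 (inc x)"
proof -
  obtain a where a: "mu_system a" "x = u_of a" using x by (rule carrier_u_grpE)
  obtain i1 where i1: "i1 \<in> u_index" "\<And>x y. x \<in> carrier u_grp \<Longrightarrow> y \<in> carrier u_grp \<Longrightarrow> x i1 = y i1 \<Longrightarrow> z1 (inc x) = z1 (inc y)"
    using rigid_cocycleD(4)[OF z1] by blast
  obtain i2 where i2: "i2 \<in> u_index" "\<And>x y. x \<in> carrier u_grp \<Longrightarrow> y \<in> carrier u_grp \<Longrightarrow> x i2 = y i2 \<Longrightarrow> z2 (inc x) = z2 (inc y)"
    using rigid_cocycleD(4)[OF z2] by blast
  \<comment> \<open>A common multiple of the two levels, so that one exponent \<open>t\<close>
    approximates x for both cocycles at once.\<close>
  define N where "N = snd i1 * snd i2"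
  have pos: "snd i1 \<ge> 1" "snd i2 \<ge> 1" using i1(1) i2(1) by (auto simp: u_index_def)
  have N: "N \<ge> 1" "snd i1 dvd N" "snd i2 dvd N" using pos by (auto simp: N_def)
  obtain t where t: "a N = zeta N ^ t"
    using zeta_generates[OF mu_systemD(1)[OF a(1) N(1)] N(1)] by blast
  let ?b = "\<lambda>n. zeta n ^ t"
  have e: "a n = ?b n" if "n \<ge> 1" "n dvd N" for n
  proof -
    have "a n = a N ^ (N div n)" using mu_systemD(2)[OF a(1) that(1) N(1) that(2)] by simp
    also have "\<dots> = ?b n"
      unfolding t using mu_systemD(2)[OF mu_system_zeta_power[of t] that(1) N(1) that(2)] by simp
    finally show ?thesis .
  qed
  have b: "u_of ?b \<in> carrier u_grp" by (rule u_of_carrier[OF mu_system_zeta_power])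
  have "z1 (inc x) = z1 (inc (u_of ?b))"
    using i1(2)[OF x b] e[OF pos(1) N(2)] i1(1) by (simp add: a(2) u_of_apply)
  also have "\<dots> = z2 (inc (u_of ?b))"
    unfolding rigid_cocycle_power[OF z1] rigid_cocycle_power[OF z2] eq ..
  also have "\<dots> = z2 (inc x)"
    using i2(2)[OF x b] e[OF pos(2) N(3)] i2(1) by (simp add: a(2) u_of_apply)
  finally show ?thesis .
qed

text \<open>Twisted conjugacy at s gives conjugacy by g at s^2, where the values are central and
  hence equal. So the cocycles agree on u, and the relation spreads to u s, because central factors
  pass through g.\<close>

lemma rigid_cocycle_determined:
  assumes z1: "rigid_cocycle G W Z1 z1" and z2: "rigid_cocycle G W Z2 z2"
    and Z: "Z1 \<subseteq> center_of (pts G)" and g: "g \<in> snd G"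
    and eq: "z2 s = g \<cdot> z1 s \<cdot> map_mat cnj (inv\<^sub>G g)"
    and w: "w \<in> carrier E"
  shows "z2 w = g \<cdot> z1 w \<cdot> map_mat (ext_proj W w) (inv\<^sub>G g)"
proof -
  have gc: "g \<in> carrier (pts G)" using g by simp
  define h where "h = z1 s"
  have h: "h \<in> carrier (pts G)" unfolding h_def by (rule rigid_cocycleD(1)[OF z1 s])
  have central: "z1 (inc x) \<cdot> y = y \<cdot> z1 (inc x)"
    if "x \<in> carrier u_grp" "y \<in> carrier (pts G)" for x y
    using rigid_cocycleD(3)[OF z1 that(1)] Z that(2) unfolding center_of_def by blast
  have cg: "map_mat cnj g \<in> carrier (pts G)" "map_mat cnj h \<in> carrier (pts G)"
    using cnj.hom_closed gc h by simp_all
  have cancel: "inv\<^sub>G a \<cdot> (a \<cdot> b) = b"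
    if "a \<in> carrier (pts G)" "b \<in> carrier (pts G)" for a b
    using that by (simp add: G.m_assoc[symmetric] del: pts_simps)
  have "z2 (inc (u_of zeta)) = Ad g (h \<cdot> map_mat cnj h)"
    unfolding rigid_cocycle_square[OF z2] eq h_def[symmetric] using gc h cg
    by (simp add: G.m_assoc cnj.hom_mult cnj.hom_inv cancel del: pts_simps)
  also have "\<dots> = z1 (inc (u_of zeta)) \<cdot> g \<cdot> inv\<^sub>G g"
    unfolding rigid_cocycle_square[OF z1, folded h_def, symmetric] central[OF u_zeta gc] ..
  also have "\<dots> = z1 (inc (u_of zeta))"
    using gc rigid_cocycleD(1)[OF z1, of "inc (u_of zeta)"] u_zeta by (simp add: G.m_assoc del: pts_simps)
  finally have e: "z1 (inc x) = z2 (inc x)" if "x \<in> carrier u_grp" for x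
    using rigid_cocycle_inc_determined[OF z1 z2 _ that] by simp
  have zc: "z1 (inc x) \<in> carrier (pts G)" if "x \<in> carrier u_grp" for x
    using rigid_cocycleD(1)[OF z1] that by simp
  from w show ?thesis
  proof (cases rule: E_cases)
    case (1 x)
    have "g \<cdot> z1 (inc x) \<cdot> inv\<^sub>G g = z1 (inc x)"
      unfolding central[OF 1(1) gc, symmetric] using gc zc[OF 1(1)] by (simp add: G.m_assoc del: pts_simps)
    then show ?thesis unfolding 1(3) unfolding 1(2) map_mat_id e[OF 1(1), symmetric] by simp
  next
    case (2 x)
    have p: "z (inc x \<star> s) = z (inc x) \<cdot> z s" if "rigid_cocycle G W Z z" for Z z
      using rigid_cocycleD(2)[OF that _ s, of "inc x"] 2(1) by (simp add: proj_inc map_mat_id del: pts_simps)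
    have "z2 (inc x \<star> s) = (z1 (inc x) \<cdot> g) \<cdot> h \<cdot> map_mat cnj (inv\<^sub>G g)"
      unfolding p[OF z2] e[OF 2(1), symmetric] eq h_def[symmetric]
      using gc h cg zc[OF 2(1)] by (simp add: G.m_assoc cnj.hom_inv del: pts_simps)
    also have "\<dots> = g \<cdot> z1 (inc x \<star> s) \<cdot> map_mat cnj (inv\<^sub>G g)"
      unfolding p[OF z1] central[OF 2(1) gc] h_def[symmetric]
      using gc h cg zc[OF 2(1)] by (simp add: G.m_assoc cnj.hom_inv del: pts_simps)
    finally show ?thesis unfolding 2(3) unfolding 2(2) .
  qed
qed

end

section \<open>Exponents of zeta, compactness of u, and finite closed sets\<close>

lemma zeta_power_mod: "n \<ge> 1 \<Longrightarrow> zeta n ^ t = zeta n ^ (t mod n)"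
proof -
  assume n: "n \<ge> 1"
  have "zeta n ^ t = zeta n ^ (n * (t div n) + t mod n)" by simp
  also have "\<dots> = (zeta n ^ n) ^ (t div n) * zeta n ^ (t mod n)"
    by (simp only: power_add power_mult)
  finally show ?thesis using mu_systemD(1)[OF mu_system_zeta n] by simp
qed

lemma zeta_power_eqD:
  assumes n: "n \<ge> 1" and eq: "zeta n ^ t = zeta n ^ t'"
  shows "t mod n = t' mod n"
proof -
  have "inj_on (\<lambda>k. zeta n ^ k) {..<n}"
    using bij_betw_roots_unity[of n] n unfolding zeta_power by (simp add: bij_betw_def)
  moreover have "zeta n ^ (t mod n) = zeta n ^ (t' mod n)"
    using eq zeta_power_mod[OF n] by metis
  ultimately show ?thesis using n by (auto dest: inj_onD)
qed

text \<open>Tychonoff for finite discrete levels. Each compatibility condition involves just two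
  coordinates and is closed because the product of two discrete spaces is discrete.\<close>

lemma compact_space_u_top: "compact_space u_top"
proof -
  let ?X = "product_topology (\<lambda>i. discrete_topology (carrier (u_level i))) u_index"
  have fin: "finite (carrier (u_level i))" if i: "i \<in> u_index" for i
  proof -
    have "snd i \<ge> 1" using i by (auto simp: u_index_def)
    then show ?thesis unfolding carrier_u_level[OF i] by (intro finite_imageI finite_roots_unity)
  qed
  have "compact_space ?X"
    unfolding compact_space_product_topology using fin by (auto simp: compact_space_discrete_topology)
  have X: "topspace ?X = (\<Pi>\<^sub>E i\<in>u_index. carrier (u_level i))" by simp
  have cl: "closedin ?X {x \<in> topspace ?X. u_trans j i (x j) = x i}"
    if ij: "i \<in> u_index" "j \<in> u_index" for i j
  proof -
    let ?D = "prod_topology (discrete_topology (carrier (u_level i))) (discrete_topology (carrier (u_level j)))"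
    have "continuous_map ?X ?D (\<lambda>x. (x i, x j))"
      using ij by (intro continuous_map_pairedI continuous_map_product_projection)
    moreover have "?D = discrete_topology (carrier (u_level i) \<times> carrier (u_level j))"
      by (rule prod_topology_discrete_topology[symmetric])
    ultimately have "closedin ?X {x \<in> topspace ?X. (x i, x j) \<in> {(p, q) \<in> carrier (u_level i) \<times> carrier (u_level j). u_trans j i q = p}}"
      by (intro closedin_continuous_map_preimage) (auto simp: closedin_discrete_topology)
    also have "{x \<in> topspace ?X. (x i, x j) \<in> {(p, q) \<in> carrier (u_level i) \<times> carrier (u_level j). u_trans j i q = p}} =
        {x \<in> topspace ?X. u_trans j i (x j) = x i}"
      using ij by (auto simp: PiE_iff)
    finally show ?thesis .
  qed
  let ?F = "(\<lambda>(i, j). {x \<in> topspace ?X. u_trans j i (x j) = x i}) ` {(i, j). i \<in> u_index \<and> j \<in> u_index \<and> u_le i j}"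
  \<comment> \<open>A witness that the family of conditions is nonempty; an empty intersection would
    be the universal set instead of the whole product.\<close>
  have "((\<real>, 1), (\<real>, 1)) \<in> {(i, j). i \<in> u_index \<and> j \<in> u_index \<and> u_le i j}"
    by (simp add: u_index_def u_le_def)
  then have ne: "?F \<noteq> {}" by blast
  then have "closedin ?X (\<Inter>?F)" using cl by (intro closedin_Inter) auto
  moreover have "\<Inter>?F = carrier u_grp"
  proof (intro equalityI subsetI)
    fix x assume x: "x \<in> \<Inter>?F"
    then have "x \<in> topspace ?X" using ne by fast
    moreover have "u_trans j i (x j) = x i" if "i \<in> u_index" "j \<in> u_index" "u_le i j" for i j
    proof -
      have "{x \<in> topspace ?X. u_trans j i (x j) = x i} \<in> ?F"
        using that by (intro image_eqI[of _ _ "(i, j)"]) auto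
      then have "x \<in> {x \<in> topspace ?X. u_trans j i (x j) = x i}" using x by (rule InterD[rotated])
      then show ?thesis by simp
    qed
    ultimately show "x \<in> carrier u_grp" unfolding X by (simp add: u_grp_def)
  next
    fix x assume "x \<in> carrier u_grp"
    then show "x \<in> \<Inter>?F" unfolding X by (auto simp: u_grp_def)
  qed
  ultimately have "closedin ?X (carrier u_grp)" by simp
  then have "compactin ?X (carrier u_grp)" using \<open>compact_space ?X\<close> by (rule closedin_compact_space[rotated])
  then show ?thesis
    unfolding u_top_def by (rule compact_space_subtopology)
qed

lemma topspace_u_top: "topspace u_top = carrier u_grp"
  unfolding u_top_def by (auto simp: u_grp_def)

lemma closedin_u_level_preimage:
  assumes i: "i \<in> u_index"
  shows "closedin u_top {x \<in> carrier u_grp. x i \<in> C}"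
proof -
  have "continuous_map u_top (discrete_topology (carrier (u_level i))) (\<lambda>x. x i)"
    unfolding u_top_def using i by (intro continuous_map_from_subtopology continuous_map_product_projection)
  then have "closedin u_top {x \<in> topspace u_top. x i \<in> C \<inter> carrier (u_level i)}"
    by (rule closedin_continuous_map_preimage) (simp add: closedin_discrete_topology)
  also have "{x \<in> topspace u_top. x i \<in> C \<inter> carrier (u_level i)} = {x \<in> carrier u_grp. x i \<in> C}"
    using i by (auto simp: topspace_u_top u_grp_def)
  finally show ?thesis .
qed

text \<open>To separate A from \<open>Z\<close>, choose for every B in \<open>Z\<close> an entry in
  which A and B differ, and multiply the corresponding differences.\<close>

lemma zariski_closed_finite:
  assumes Z: "finite Z" "Z \<subseteq> carrier (GL n)"
  shows "zariski_closed UNIV n Z"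
proof (rule zariski_closedI[OF Z(2)])
  fix A assume A: "A \<in> carrier (GL n)" "A \<notin> Z"
  have "\<exists>i j. i < n \<and> j < n \<and> A $$ (i, j) \<noteq> B $$ (i, j)" if "B \<in> Z" for B
  proof (rule ccontr)
    assume "\<not> ?thesis"
    then have "A = B" using A that Z(2) by (intro eq_matI) (auto simp: carrier_GL)
    then show False using A that by simp
  qed
  then obtain i j where ij: "\<And>B. B \<in> Z \<Longrightarrow> i B < n \<and> j B < n \<and> A $$ (i B, j B) \<noteq> B $$ (i B, j B)"
    by metis
  let ?f = "\<lambda>X. \<Prod>B\<in>Z. X $$ (i B, j B) - B $$ (i B, j B)"
  have "regular_on UNIV n UNIV ?f"
    using ij by (intro regular_on_prod regular_on_diff regular_on_entry regular_on_const) auto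
  then obtain p where p: "p \<in> coord_ring UNIV n" "\<And>X. ?f X = p X" unfolding regular_on_def by auto
  moreover have "?f A \<noteq> 0" using ij Z(1) by auto
  moreover have "?f B = 0" if "B \<in> Z" for B using that Z(1) by auto
  ultimately show "\<exists>p\<in>coord_ring UNIV n. p A \<noteq> 0 \<and> (\<forall>B\<in>Z. p B = 0)" by metis
qed

context rigid_group
begin

text \<open>The cocycle takes its values on u in the finite cyclic group generated by c = h
  \<sigma>(h). This group is defined over the reals because c is fixed by conjugation.\<close>

lemma exists_rigid_cocycle:
  assumes h: "h \<in> snd G" and c: "h \<cdot> map_mat cnj h \<in> center_of (pts G)"
    and k: "k \<ge> 1" "(h \<cdot> map_mat cnj h) [^]\<^bsub>pts G\<^esub> (k::nat) = \<one>\<^bsub>pts G\<^esub>"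
  obtains Z z where "finite_central_subgroup G Z" "rigid_cocycle G W Z z" "z s = h"
proof -
  define c where "c = h \<cdot> map_mat cnj h"
  let ?h' = "map_mat cnj h"
  have hc: "h \<in> carrier (pts G)" "?h' \<in> carrier (pts G)" using h cnj.hom_closed[of h] by simp_all
  have cc: "c \<in> carrier (pts G)" unfolding c_def using hc by (rule G.m_closed)
  have comm: "c \<cdot> x = x \<cdot> c" if "x \<in> carrier (pts G)" for x
    using c that unfolding center_of_def c_def by blast
  have cpow: "c [^]\<^bsub>pts G\<^esub> t \<in> carrier (pts G)" for t :: nat using cc by (rule G.nat_pow_closed)
  have comm_pow: "c [^]\<^bsub>pts G\<^esub> (t::nat) \<cdot> x = x \<cdot> c [^]\<^bsub>pts G\<^esub> t" if "x \<in> carrier (pts G)" for x t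
    using G.group_commutes_pow[OF comm[OF that] cc that] .
  \<comment> \<open>\<sigma>(c) = \<sigma>(h) h, so h \<sigma>(c) = c h, which is h c by centrality;
    cancel h.\<close>
  have cnj_c: "map_mat cnj c = c"
  proof -
    have "h \<cdot> map_mat cnj c = h \<cdot> (?h' \<cdot> h)"
      unfolding c_def using hc by (simp add: cnj.hom_mult del: pts_simps)
    also have "\<dots> = c \<cdot> h" unfolding c_def using hc by (simp add: G.m_assoc del: pts_simps)
    also have "\<dots> = h \<cdot> c" using comm[OF hc(1)] .
    finally show ?thesis using hc cc cnj.hom_closed[OF cc] G.Units_l_cancel[of h "map_mat cnj c" c]
      by (simp del: pts_simps)
  qed
  have cnj_pow: "map_mat cnj (c [^]\<^bsub>pts G\<^esub> (t::nat)) = c [^]\<^bsub>pts G\<^esub> t" for t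
    using cnj.hom_nat_pow[OF cc, of t] by (simp add: cnj_c del: pts_simps)
  have pow_mod: "c [^]\<^bsub>pts G\<^esub> t = c [^]\<^bsub>pts G\<^esub> (t mod k)" for t :: nat
  proof -
    have "c [^]\<^bsub>pts G\<^esub> t = c [^]\<^bsub>pts G\<^esub> (k * (t div k) + t mod k)" by simp
    also have "\<dots> = (c [^]\<^bsub>pts G\<^esub> k) [^]\<^bsub>pts G\<^esub> (t div k) \<cdot> c [^]\<^bsub>pts G\<^esub> (t mod k)"
      by (simp only: G.nat_pow_pow[OF cc] G.nat_pow_mult[OF cc])
    finally show ?thesis using k(2) cpow by (simp add: c_def[symmetric] del: pts_simps)
  qed
  \<comment> \<open>Natural exponents give a subgroup, inverses included, because c has finite
    order.\<close>
  define Z where "Z = range (\<lambda>t::nat. c [^]\<^bsub>pts G\<^esub> t)"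
  have Z: "finite_central_subgroup G Z"
  proof -
    have "Z \<subseteq> (\<lambda>t. c [^]\<^bsub>pts G\<^esub> t) ` {..<k}"
    proof
      fix x assume "x \<in> Z"
      then obtain t :: nat where t: "x = c [^]\<^bsub>pts G\<^esub> t" by (auto simp: Z_def)
      then show "x \<in> (\<lambda>t. c [^]\<^bsub>pts G\<^esub> t) ` {..<k}" using pow_mod[of t] k(1) by auto
    qed
    then have fin: "finite Z" by (rule finite_subset) simp
    have ZG: "Z \<subseteq> carrier (pts G)" using cpow by (auto simp: Z_def)
    have "subgroup Z (pts G)"
    proof (rule G.subgroupI[OF ZG])
      fix a assume "a \<in> Z"
      then obtain t :: nat where t: "a = c [^]\<^bsub>pts G\<^esub> t" by (auto simp: Z_def)
      have "c [^]\<^bsub>pts G\<^esub> (t * (k - 1)) \<cdot> c [^]\<^bsub>pts G\<^esub> t = c [^]\<^bsub>pts G\<^esub> (t * (k - 1) + t)"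
        using cc by (rule G.nat_pow_mult)
      also have "t * (k - 1) + t = t * k" using k(1) by (cases k) auto
      also have "c [^]\<^bsub>pts G\<^esub> (t * k) = \<one>\<^bsub>pts G\<^esub>" using pow_mod[of "t * k"] by simp
      finally have "inv\<^sub>G a = c [^]\<^bsub>pts G\<^esub> (t * (k - 1))"
        unfolding t using cpow by (intro G.inv_equality) simp_all
      then show "inv\<^sub>G a \<in> Z" by (auto simp: Z_def)
      fix b assume "b \<in> Z"
      then obtain t' :: nat where t': "b = c [^]\<^bsub>pts G\<^esub> t'" by (auto simp: Z_def)
      show "a \<cdot> b \<in> Z" unfolding t t' G.nat_pow_mult[OF cc] by (auto simp: Z_def)
    qed (auto simp: Z_def)
    moreover have "Z \<subseteq> center_of (pts G)" using cpow comm_pow by (auto simp: Z_def center_of_def)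
    moreover have "zariski_closed \<real> (fst G) Z"
    proof (rule zariski_closed_real_of_cnj)
      show "zariski_closed UNIV (fst G) Z"
        using fin ZG real_alg_group_GL[OF real_alg] by (intro zariski_closed_finite) auto
    qed (auto simp: Z_def cnj_pow simp del: pts_simps)
    ultimately show ?thesis using fin by (simp add: finite_central_subgroup_def)
  qed
  define i where "i = (UNIV :: complex set, k)"
  have i: "i \<in> u_index" using k(1) by (simp add: i_def u_index_def)
  \<comment> \<open>The homomorphism sending the class of \<open>zeta k\<close> to c. The exponent
    is determined modulo k only, and the relation c^k = 1 makes the arbitrary choice
    harmless.\<close>
  define \<phi> where "\<phi> C = c [^]\<^bsub>pts G\<^esub> (SOME t::nat. C = u_coset i (zeta k ^ t))" for C
  have root: "(zeta k ^ t) ^ k = 1" for t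
    using mu_systemD(1)[OF mu_system_zeta_power[of t] k(1)] .
  have \<phi>: "\<phi> (u_coset i (zeta k ^ t)) = c [^]\<^bsub>pts G\<^esub> t" for t
  proof -
    define t' where "t' = (SOME t'. u_coset i (zeta k ^ t) = u_coset i (zeta k ^ t'))"
    have "u_coset i (zeta k ^ t) = u_coset i (zeta k ^ t')"
      unfolding t'_def by (rule someI[of _ t]) (rule refl)
    then have "zeta k ^ t = zeta k ^ t'"
      unfolding i_def by (rule u_coset_inject[OF root root])
    then have m: "t mod k = t' mod k" by (rule zeta_power_eqD[OF k(1)])
    have "c [^]\<^bsub>pts G\<^esub> t = c [^]\<^bsub>pts G\<^esub> (t mod k)" by (rule pow_mod)
    also have "\<dots> = c [^]\<^bsub>pts G\<^esub> t'" unfolding m by (rule pow_mod[symmetric])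
    finally show ?thesis unfolding \<phi>_def t'_def[symmetric] ..
  qed
  have level: "\<exists>t. C = u_coset i (zeta k ^ t)" if "C \<in> carrier (u_level i)" for C
  proof -
    have "C \<in> u_coset i ` {a. a ^ snd i = 1}" using that unfolding carrier_u_level[OF i] .
    then obtain a where C: "C = u_coset i a" and "a ^ snd i = 1" by blast
    then have "a ^ k = 1" by (simp add: i_def)
    then obtain t where "a = zeta k ^ t" using k(1) by (rule zeta_generates)
    then show ?thesis using C by blast
  qed
  have mult_level: "C \<otimes>\<^bsub>u_level i\<^esub> D = C <#>\<^bsub>res_mu i\<^esub> D" for C D
    by (simp add: u_level_def FactGroup_def)
  have \<phi>_mult: "\<phi> (C <#>\<^bsub>res_mu i\<^esub> D) = \<phi> C \<cdot> \<phi> D"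
    if C: "C \<in> carrier (u_level i)" and D: "D \<in> carrier (u_level i)" for C D
  proof -
    obtain t t' where t: "C = u_coset i (zeta k ^ t)" "D = u_coset i (zeta k ^ t')"
      using level[OF C] level[OF D] by blast
    have "C <#>\<^bsub>res_mu i\<^esub> D = u_coset i (zeta k ^ t * zeta k ^ t')"
      unfolding t using root by (intro u_coset_mult[OF i]) (simp_all add: i_def)
    also have "\<dots> = u_coset i (zeta k ^ (t + t'))" by (simp add: power_add)
    finally show ?thesis unfolding \<phi> t by (simp add: \<phi> G.nat_pow_mult[OF cc] del: pts_simps)
  qed
  have \<phi>_Z: "\<phi> C \<in> Z" for C by (auto simp: \<phi>_def Z_def)
  have \<phi>_hom: "\<phi> \<in> hom (u_level i) ((pts G)\<lparr>carrier := Z\<rparr>)"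
    using \<phi>_Z \<phi>_mult by (auto simp: hom_def mult_level)
  have ui: "x i \<in> carrier (u_level i)" if "x \<in> carrier u_grp" for x
    using that i by (auto simp: u_grp_def)
  define e where "e x = \<phi> (x i)" for x :: u_elem
  have e_mult: "e (x *\<^sub>u y) = e x \<cdot> e y" if "x \<in> carrier u_grp" "y \<in> carrier u_grp" for x y
    using that i \<phi>_mult[OF ui ui] by (simp add: e_def u_grp_simps del: pts_simps)
  have e_unity: "e (u_of zeta) = c"
    using \<phi>[of 1] i cc by (simp add: e_def u_of_apply i_def del: pts_simps)
  have e_one: "e \<one>\<^bsub>u_grp\<^esub> = \<one>\<^bsub>pts G\<^esub>"
    using \<phi>[of 0] i by (simp add: e_def u_of_one u_of_apply del: pts_simps)
  have e_pow: "\<exists>t::nat. e x = c [^]\<^bsub>pts G\<^esub> t" for x by (auto simp: e_def \<phi>_def)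
  have ec: "e x \<in> carrier (pts G)" for x using e_pow[of x] cpow by metis
  have e_cnj: "map_mat cnj (e x) = e x" for x using e_pow[of x] cnj_pow by metis
  have e_comm: "e x \<cdot> y = y \<cdot> e x" if "y \<in> carrier (pts G)" for x y
    using e_pow[of x] comm_pow[OF that] by metis
  \<comment> \<open>On the two cosets of u this is \<open>inc x\<close> -> \<open>e x\<close> and
    \<open>inc x \<star> s\<close> -> \<open>e x \<cdot> h\<close>; x has to be recovered by
    inverting \<open>inc\<close>.\<close>
  define z where "z = (\<lambda>w\<in>carrier E. if ext_proj W w = (\<lambda>x. x)
    then e (the_inv_into (carrier u_grp) inc w)
    else e (the_inv_into (carrier u_grp) inc (w \<star> inv\<^bsub>E\<^esub> s)) \<cdot> h)"
  have z1: "z (inc x) = e x" if "x \<in> carrier u_grp" for x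
    using that proj_inc[OF that] the_inv_into_f_f[OF inc_inj that] by (simp add: z_def)
  have z2: "z (inc x \<star> s) = e x \<cdot> h" if x: "x \<in> carrier u_grp" for x
  proof -
    have "inc x \<star> s \<star> inv\<^bsub>E\<^esub> s = inc x" using x s by (simp add: E.m_assoc)
    then show ?thesis
      using x s proj_inc_s[OF x] the_inv_into_f_f[OF inc_inj x] by (simp add: z_def del: pts_simps)
  qed
  have z_s: "z s = h"
    using z2[of "\<one>\<^bsub>u_grp\<^esub>"] s hc by (simp add: e_one del: pts_simps)
  have z_carrier: "z w \<in> carrier (pts G)" if "w \<in> carrier E" for w
    using that
  proof (cases rule: E_cases)
    case (1 x) then show ?thesis using z1 ec by simp
  next
    case (2 x) then show ?thesis using z2 G.m_closed[OF ec hc(1)] by simp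
  qed
  have cocycle: "z (w \<star> w') = z w \<cdot> map_mat (ext_proj W w) (z w')"
    if w: "w \<in> carrier E" and w': "w' \<in> carrier E" for w w'
    using w
  proof (cases rule: E_cases)
    case w: (1 x)
    from w' show ?thesis
    proof (cases rule: E_cases)
      case (1 y)
      show ?thesis unfolding w(3) unfolding w(2) 1(2) map_mat_id
        using mult_cases(1)[OF w(1) 1(1)] w(1) 1(1) by (simp add: z1 e_mult del: pts_simps inc.hom_mult)
    next
      case (2 y)
      show ?thesis unfolding w(3) unfolding w(2) 2(2) map_mat_id mult_cases(2)[OF w(1) 2(1)]
        using w(1) 2(1) ec hc by (simp add: z1 z2 e_mult G.m_assoc del: pts_simps inc.hom_mult)
    qed
  next
    case w: (2 x)
    from w' show ?thesis
    proof (cases rule: E_cases)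
      case (1 y)
      show ?thesis unfolding w(3) unfolding w(2) 1(2) mult_cases(3)[OF w(1) 1(1)]
        using w(1) 1(1) ec hc by (simp add: z1 z2 e_mult e_cnj G.m_assoc e_comm[OF hc(1), of y] del: pts_simps inc.hom_mult)
    next
      case (2 y)
      \<comment> \<open>The only case in which s meets s. The new factor s^2 is sent to c = h
        \<sigma>(h), the product that the cocycle rule produces, since the values of
        \<open>e\<close> are central and fixed by conjugation.\<close>
      have "z (w \<star> w') = e x \<cdot> e y \<cdot> c"
        unfolding w(2) 2(2) mult_cases(4)[OF w(1) 2(1)]
        using w(1) 2(1) u_zeta by (simp add: z1 e_mult e_unity del: pts_simps inc.hom_mult)
      also have "\<dots> = e x \<cdot> (e y \<cdot> h) \<cdot> ?h'"
        unfolding c_def using ec hc by (simp add: G.m_assoc del: pts_simps)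
      also have "\<dots> = e x \<cdot> h \<cdot> map_mat cnj (e y \<cdot> h)"
        using ec hc by (subst e_comm[OF hc(1), of y]) (simp add: G.m_assoc cnj.hom_mult e_cnj del: pts_simps)
      also have "\<dots> = z w \<cdot> map_mat (ext_proj W w) (z w')"
        unfolding w(3) unfolding w(2) 2(2) z2[OF w(1)] z2[OF 2(1)] ..
      finally show ?thesis .
    qed
  qed
  \<comment> \<open>The preimage of any set is a union of two pieces, one in u and one in u s. Each
    is the continuous image of a closed subset of the compact group u, hence closed in the Hausdorff
    group W.\<close>
  have cont: "continuous_map (ext_top W) (discrete_topology (snd G)) z"
  proof -
    have TG: "topological_group E (ext_top W)" and haus: "Hausdorff_space (ext_top W)"
      and inc_cont: "continuous_map u_top (ext_top W) inc"
      using profinite by (simp_all add: profinite_extension_def profinite_group_def)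
    have top: "topspace (ext_top W) = carrier E" using TG by (simp add: topological_group_def)
    have "continuous_map (ext_top W) (ext_top W) (\<lambda>w. w \<star> s)"
    proof -
      have "continuous_map (ext_top W) (prod_topology (ext_top W) (ext_top W)) (\<lambda>w. (w, s))"
        using s top by (intro continuous_map_pairedI) simp_all
      then show ?thesis
        using TG continuous_map_compose[of _ _ "\<lambda>w. (w, s)" _ "\<lambda>(x, y). x \<star> y"]
        by (simp add: topological_group_def o_def)
    qed
    then have incs_cont: "continuous_map u_top (ext_top W) (\<lambda>x. inc x \<star> s)"
      using continuous_map_compose[OF inc_cont] by (simp add: o_def)
    have closed_image: "closedin (ext_top W) (f ` {x \<in> carrier u_grp. x i \<in> C})"
      if f: "continuous_map u_top (ext_top W) f" for f C
      using compactin_imp_closedin[OF haus] image_compactin[OF _ f]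
        closedin_compact_space[OF compact_space_u_top closedin_u_level_preimage[OF i]] by blast
    have "closedin (ext_top W) {w \<in> carrier E. z w \<in> C}" for C
    proof -
      have "{w \<in> carrier E. z w \<in> C} = inc ` {x \<in> carrier u_grp. x i \<in> {D. \<phi> D \<in> C}} \<union>
          (\<lambda>x. inc x \<star> s) ` {x \<in> carrier u_grp. x i \<in> {D. \<phi> D \<cdot> h \<in> C}}" (is "?L = ?R")
      proof (intro equalityI subsetI)
        fix w assume w: "w \<in> ?L"
        then have "w \<in> carrier E" by simp
        then show "w \<in> ?R"
        proof (cases rule: E_cases)
          case (1 x)
          then show ?thesis using w z1[OF 1(1)] by (auto simp: e_def)
        next
          case (2 x)
          then show ?thesis using w z2[OF 2(1)] by (auto simp: e_def simp del: pts_simps)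
        qed
      qed (use z1 z2 s in \<open>auto simp: e_def simp del: pts_simps\<close>)
      then show ?thesis
        by (simp only: closedin_Un[OF closed_image[OF inc_cont] closed_image[OF incs_cont]])
    qed
    then show ?thesis
      using z_carrier by (auto simp: continuous_map_closedin top)
  qed
  have "rigid_cocycle G W Z z"
    unfolding rigid_cocycle_def
  proof (intro conjI ballI)
    show "z \<in> carrier E \<rightarrow>\<^sub>E snd G" using z_carrier by (auto simp: z_def)
    show "\<exists>i\<in>u_index. \<exists>\<phi>\<in>hom (u_level i) ((pts G)\<lparr>carrier := Z\<rparr>). \<forall>x\<in>carrier u_grp. z (inc x) = \<phi> (x i)"
      using i \<phi>_hom z1 by (auto simp: e_def)
  qed (use cont cocycle in auto)
  then show ?thesis using that Z z_s by blast
qed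

end

section \<open>The equivalence\<close>

lemma semidirect_galois_simps [simp]:
  "carrier (semidirect_galois G) = snd G \<times> carrier \<Gamma>"
  "(g, a) \<otimes>\<^bsub>semidirect_galois G\<^esub> (h, b) = (g \<otimes>\<^bsub>pts G\<^esub> map_mat a h, a \<otimes>\<^bsub>\<Gamma>\<^esub> b)"
  "\<one>\<^bsub>semidirect_galois G\<^esub> = (\<one>\<^bsub>pts G\<^esub>, \<one>\<^bsub>\<Gamma>\<^esub>)"
  by (simp_all add: semidirect_galois_def)

context rigid_group
begin

abbreviation SD where "SD \<equiv> semidirect_galois G"

lemma inv_semidirect_galois:
  assumes g: "g \<in> snd G"
  shows "inv\<^bsub>SD\<^esub> (g, \<lambda>x. x) = (inv\<^sub>G g, \<lambda>x. x)"
proof (subst m_inv_def, rule the_equality)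
  have gc: "g \<in> carrier (pts G)" using g by simp
  show "(inv\<^sub>G g, \<lambda>x. x) \<in> carrier SD \<and>
      (g, \<lambda>x. x) \<otimes>\<^bsub>SD\<^esub> (inv\<^sub>G g, \<lambda>x. x) = \<one>\<^bsub>SD\<^esub> \<and>
      (inv\<^sub>G g, \<lambda>x. x) \<otimes>\<^bsub>SD\<^esub> (g, \<lambda>x. x) = \<one>\<^bsub>SD\<^esub>"
    using G.inv_closed[OF gc] G.l_inv[OF gc] G.r_inv[OF gc] by (simp add: map_mat_id restrict_UNIV)
  fix p assume p: "p \<in> carrier SD \<and>
      (g, \<lambda>x. x) \<otimes>\<^bsub>SD\<^esub> p = \<one>\<^bsub>SD\<^esub> \<and>
      p \<otimes>\<^bsub>SD\<^esub> (g, \<lambda>x. x) = \<one>\<^bsub>SD\<^esub>"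
  obtain y b where yb: "p = (y, b)" by (cases p)
  have b: "b = (\<lambda>x. x)" using p by (simp add: yb restrict_UNIV)
  have "y \<cdot> g = \<one>\<^bsub>pts G\<^esub>" "y \<in> carrier (pts G)" using p by (simp_all add: yb b map_mat_id)
  then have "inv\<^sub>G g = y" by (intro G.inv_equality gc)
  then show "p = (inv\<^sub>G g, \<lambda>x. x)" by (simp add: yb b)
qed

lemma strong_real_form_iff:
  "strong_real_form G (h, a) \<longleftrightarrow> h \<in> snd G \<and> a = cnj \<and>
     h \<cdot> map_mat cnj h \<in> center_of (pts G) \<and>
     (\<exists>k::nat. k > 0 \<and> (h \<cdot> map_mat cnj h) [^]\<^bsub>pts G\<^esub> k = \<one>\<^bsub>pts G\<^esub>)"
  by (auto simp: strong_real_form_def restrict_UNIV simp del: pts_simps)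

text \<open>Moving \<open>cnj\<close> past the inverse of g turns conjugation in the semidirect
  product into twisted conjugation, the relation that morphisms of rigid inner twists impose at
  s.\<close>

lemma Hom_strong_real_forms:
  assumes "h \<in> snd G"
  shows "Hom (strong_real_forms G) (h, cnj) (h', cnj) =
    {g \<in> snd G. h' = g \<cdot> h \<cdot> map_mat cnj (inv\<^sub>G g)}"
  by (auto simp: strong_real_forms_def inv_semidirect_galois map_mat_id restrict_UNIV
      simp del: pts_simps)

lemma category_strong_real_forms: "category (strong_real_forms G)"
  unfolding category_def
proof (intro conjI ballI)
  let ?C = "strong_real_forms G"
  have obj: "\<exists>h. X = (h, cnj) \<and> h \<in> carrier (pts G)" if "X \<in> Obj ?C" for X
    using that by (cases X) (auto simp: strong_real_forms_def strong_real_form_iff)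
  have Ident: "Ident ?C X = \<one>\<^bsub>pts G\<^esub>" for X by (simp add: strong_real_forms_def)
  have Comp: "Comp ?C X Y Z g f = g \<cdot> f" for X Y Z g f by (simp add: strong_real_forms_def)
  have carr: "f \<in> carrier (pts G)" if "f \<in> Hom ?C X Y" for X Y f
    using that by (simp add: strong_real_forms_def)
  {
    fix X assume "X \<in> Obj ?C"
    then obtain h where h: "X = (h, cnj)" "h \<in> carrier (pts G)" using obj by blast
    show "Ident ?C X \<in> Hom ?C X X"
      using h(2) G.one_closed unfolding h(1) Ident by (subst Hom_strong_real_forms) (simp_all del: pts_simps(2,3))
  next
    fix X Y Z f g assume o: "X \<in> Obj ?C" "Y \<in> Obj ?C" "Z \<in> Obj ?C" and f: "f \<in> Hom ?C X Y" and g: "g \<in> Hom ?C Y Z"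
    obtain h where h: "X = (h, cnj)" "h \<in> carrier (pts G)" using obj o by blast
    obtain h' where h': "Y = (h', cnj)" "h' \<in> carrier (pts G)" using obj o by blast
    obtain h'' where h'': "Z = (h'', cnj)" "h'' \<in> carrier (pts G)" using obj o by blast
    have hs: "h \<in> snd G" "h' \<in> snd G" using h h' by simp_all
    have fc: "f \<in> carrier (pts G)" "g \<in> carrier (pts G)" using carr f g by blast+
    have "h' = f \<cdot> h \<cdot> map_mat cnj (inv\<^sub>G f)"
      "h'' = g \<cdot> h' \<cdot> map_mat cnj (inv\<^sub>G g)"
      using f g unfolding h h' h'' Hom_strong_real_forms[OF hs(1)] Hom_strong_real_forms[OF hs(2)] by blast+
    then have "h'' = (g \<cdot> f) \<cdot> h \<cdot> map_mat cnj (inv\<^sub>G (g \<cdot> f))"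
      using fc h(2) cnj.hom_closed by (simp add: G.m_assoc G.inv_mult_group cnj.hom_mult del: pts_simps)
    moreover have "g \<cdot> f \<in> snd G" using G.m_closed[OF fc(2,1)] by simp
    ultimately show "Comp ?C X Y Z g f \<in> Hom ?C X Z"
      unfolding Comp h h'' Hom_strong_real_forms[OF hs(1)] by blast
  next
    fix X Y f assume "f \<in> Hom ?C X Y"
    then have "f \<in> carrier (pts G)" by (rule carr)
    then show "Comp ?C X Y Y (Ident ?C Y) f = f" "Comp ?C X X Y f (Ident ?C X) = f"
      by (simp_all add: Ident Comp del: pts_simps)
  next
    fix X Y Z V f g h assume "f \<in> Hom ?C X Y" "g \<in> Hom ?C Y Z" "h \<in> Hom ?C Z V"
    then have "f \<in> carrier (pts G)" "g \<in> carrier (pts G)" "h \<in> carrier (pts G)"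
      using carr by blast+
    then show "Comp ?C X Z V h (Comp ?C X Y Z g f) = Comp ?C X Y V (Comp ?C Y Z V h g) f"
      by (simp add: Comp G.m_assoc del: pts_simps)
  }
qed

lemma rigid_inner_twistD:
  assumes "rigid_inner_twist G W Z (G', \<psi>, z)"
  shows "connected_reductive G'" "alg_iso UNIV G G' \<psi>" "rigid_cocycle G W Z z" "z s \<in> snd G"
    "x \<in> snd G \<Longrightarrow> map_mat cnj (\<psi> x) = \<psi> (z s \<cdot> map_mat cnj x \<cdot> inv\<^sub>G (z s))"
proof -
  show G': "connected_reductive G'" and \<psi>: "alg_iso UNIV G G' \<psi>" and z: "rigid_cocycle G W Z z"
    using assms by (simp_all add: rigid_inner_twist_def)
  show "z s \<in> snd G" using rigid_cocycleD(1)[OF z s] by simp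
  assume x: "x \<in> snd G"
  have x': "map_mat cnj x \<in> snd G" by (rule real_alg_group_cnj[OF real_alg x])
  \<comment> \<open>The defining relation is taken at w = s and at the conjugate of x, so that the
    inner conjugation cancels and \<psi> is evaluated at x itself.\<close>
  have "inv_into (snd G) \<psi> (map_mat (ext_proj W s) (\<psi> (map_mat (inv\<^bsub>\<Gamma>\<^esub> (ext_proj W s)) (map_mat cnj x)))) =
      z s \<cdot> map_mat cnj x \<cdot> inv\<^sub>G (z s)"
    using assms s x' unfolding rigid_inner_twist_def by blast
  then have e: "inv_into (snd G) \<psi> (map_mat cnj (\<psi> x)) = z s \<cdot> map_mat cnj x \<cdot> inv\<^sub>G (z s)"
    by (simp add: proj_s inv_galois_cnj del: pts_simps)
  have "map_mat cnj (\<psi> x) \<in> snd G'"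
    by (rule real_alg_group_cnj[OF connected_reductive_real_alg_group[OF G'] alg_isoD(6)[OF \<psi> x]])
  then show "map_mat cnj (\<psi> x) = \<psi> (z s \<cdot> map_mat cnj x \<cdot> inv\<^sub>G (z s))"
    unfolding e[symmetric] by (rule alg_isoD(9)[OF \<psi>, symmetric])
qed

text \<open>A morphism is determined by its component g, and the cocycle condition on all of W
  follows from its instance at s. The surviving condition on g is the one defining morphisms of
  strong real forms.\<close>

lemma rigid_hom_eq:
  assumes Z: "finite_central_subgroup G Z1" and X1: "rigid_inner_twist G W Z1 (G1, \<psi>1, z1)"
    and X2: "rigid_inner_twist G W Z2 (G2, \<psi>2, z2)"
  shows "rigid_hom G W (G1, \<psi>1, z1) (G2, \<psi>2, z2) =
    (\<lambda>g. (twist_map G (G1, \<psi>1, z1) (G2, \<psi>2, z2) g, g)) ` Hom (strong_real_forms G) (z1 s, cnj) (z2 s, cnj)"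
proof -
  let ?T = "twist_map G (G1, \<psi>1, z1) (G2, \<psi>2, z2)"
  note d1 = rigid_inner_twistD[OF X1] and d2 = rigid_inner_twistD[OF X2]
  note r = connected_reductive_real_alg_group[OF d1(1)] connected_reductive_real_alg_group[OF d2(1)]
  have Zc: "Z1 \<subseteq> center_of (pts G)" using Z by (simp add: finite_central_subgroup_def)
  have H: "Hom (strong_real_forms G) (z1 s, cnj) (z2 s, cnj) =
    {g \<in> snd G. z2 s = g \<cdot> z1 s \<cdot> map_mat cnj (inv\<^sub>G g)}"
    by (rule Hom_strong_real_forms[OF d1(4)])
  show ?thesis
    unfolding H
  proof (intro equalityI subsetI)
    fix p assume "p \<in> rigid_hom G W (G1, \<psi>1, z1) (G2, \<psi>2, z2)"
    then obtain f g where p: "p = (f, g)" "g \<in> snd G" "alg_iso \<real> G1 G2 f"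
      and c: "\<And>w. w \<in> carrier E \<Longrightarrow> z2 w = g \<cdot> z1 w \<cdot> map_mat (ext_proj W w) (inv\<^sub>G g)"
      and f: "\<And>x. x \<in> snd G \<Longrightarrow> f (\<psi>1 x) = \<psi>2 (Ad g x)"
      by (auto simp: rigid_hom_def simp del: pts_simps)
    have "f = ?T g"
      by (rule twist_map_eqI[OF d1(2) alg_isoD(4)[OF p(3)] f])
    then show "p \<in> (\<lambda>g. (?T g, g)) `
        {g \<in> snd G. z2 s = g \<cdot> z1 s \<cdot> map_mat cnj (inv\<^sub>G g)}"
      using p(1,2) c[OF s, unfolded proj_s] by blast
  next
    fix p assume "p \<in> (\<lambda>g. (?T g, g)) `
        {g \<in> snd G. z2 s = g \<cdot> z1 s \<cdot> map_mat cnj (inv\<^sub>G g)}"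
    then obtain g where g: "g \<in> snd G" "z2 s = g \<cdot> z1 s \<cdot> map_mat cnj (inv\<^sub>G g)"
      and p: "p = (?T g, g)" by blast
    note t = twist_map_alg_iso[OF r d1(2) d2(2) d1(4) d2(4) d1(5) d2(5) g]
    have c: "\<And>w. w \<in> carrier E \<Longrightarrow> z2 w = g \<cdot> z1 w \<cdot> map_mat (ext_proj W w) (inv\<^sub>G g)"
      by (rule rigid_cocycle_determined[OF d1(3) d2(3) Zc g])
    show "p \<in> rigid_hom G W (G1, \<psi>1, z1) (G2, \<psi>2, z2)"
      using g(1) t c by (auto simp: p rigid_hom_def simp del: pts_simps)
  qed
qed

text \<open>The square z(s) \<sigma>(z(s)) is the value of z at the generator of u, so it lies in
  the finite central group \<open>Z\<close>, and Lagrange's theorem bounds its order.\<close>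

lemma rigid_inner_twist_strong_real_form:
  assumes Z: "finite_central_subgroup G Z" and X: "rigid_inner_twist G W Z (G', \<psi>, z)"
  shows "strong_real_form G (z s, cnj)"
proof -
  note d = rigid_inner_twistD[OF X]
  let ?c = "z s \<cdot> map_mat cnj (z s)"
  have c: "?c \<in> Z"
    using rigid_cocycleD(3)[OF d(3) u_zeta] unfolding rigid_cocycle_square[OF d(3)] .
  have sub: "subgroup Z (pts G)" "finite Z" "Z \<subseteq> center_of (pts G)"
    using Z by (simp_all add: finite_central_subgroup_def)
  interpret Z: group "(pts G)\<lparr>carrier := Z\<rparr>" by (rule subgroup.subgroup_is_group[OF sub(1) G.is_group])
  have "?c [^]\<^bsub>(pts G)\<lparr>carrier := Z\<rparr>\<^esub> card Z = \<one>\<^bsub>pts G\<^esub>"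
    using Z.pow_order_eq_1[of ?c] c by (simp add: Coset.order_def del: pts_simps)
  then have "?c [^]\<^bsub>pts G\<^esub> card Z = \<one>\<^bsub>pts G\<^esub>"
    using G.nat_pow_consistent[of ?c "card Z" Z] by simp
  moreover have "card Z > 0" using sub(2) c by (auto simp: card_gt_0_iff)
  ultimately show ?thesis
    unfolding strong_real_form_iff using d(4) c sub(3) by blast
qed

text \<open>The cocycle and the twisted form are constructed independently from h. They fit together
  because Ad (z w) is trivial for w in u and equals Ad h for w in u s.\<close>

lemma exists_rigid_inner_twist:
  assumes G: "connected_reductive G" and h: "strong_real_form G (h, cnj)"
  obtains Z G' \<psi> z where "finite_central_subgroup G Z" "rigid_inner_twist G W Z (G', \<psi>, z)" "z s = h"
proof -
  have hG: "h \<in> snd G" and c: "h \<cdot> map_mat cnj h \<in> center_of (pts G)"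
    using h unfolding strong_real_form_iff by blast+
  obtain k :: nat where "k > 0" "(h \<cdot> map_mat cnj h) [^]\<^bsub>pts G\<^esub> k = \<one>\<^bsub>pts G\<^esub>"
    using h unfolding strong_real_form_iff by blast
  then have k: "k \<ge> 1" "(h \<cdot> map_mat cnj h) [^]\<^bsub>pts G\<^esub> k = \<one>\<^bsub>pts G\<^esub>" by simp_all
  obtain Z z where Z: "finite_central_subgroup G Z" and z: "rigid_cocycle G W Z z" and zs: "z s = h"
    using exists_rigid_cocycle[OF hG c k] by blast
  obtain G' \<psi> where G': "connected_reductive G'" and \<psi>: "alg_iso UNIV G G' \<psi>"
    and tw: "\<And>x. x \<in> snd G \<Longrightarrow> map_mat cnj (\<psi> x) = \<psi> (Ad h (map_mat cnj x))"
    using exists_twisted_form[OF G hG c] by blast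
  have hc: "h \<in> carrier (pts G)" using hG by simp
  have Zc: "Z \<subseteq> center_of (pts G)" using Z by (simp add: finite_central_subgroup_def)
  have "inv_into (snd G) \<psi> (map_mat (ext_proj W w) (\<psi> (map_mat (inv\<^bsub>\<Gamma>\<^esub> (ext_proj W w)) x))) =
      z w \<cdot> x \<cdot> inv\<^sub>G (z w)" if w: "w \<in> carrier E" and x: "x \<in> snd G" for w x
  proof -
    have xc: "x \<in> carrier (pts G)" using x by simp
    have central: "z (inc y) \<cdot> v \<cdot> inv\<^sub>G (z (inc y)) = v"
      if y: "y \<in> carrier u_grp" and v: "v \<in> carrier (pts G)" for y v
    proof -
      have zy: "z (inc y) \<in> carrier (pts G)" using rigid_cocycleD(1)[OF z] y by simp
      have "z (inc y) \<cdot> v = v \<cdot> z (inc y)"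
        using rigid_cocycleD(3)[OF z y] Zc v unfolding center_of_def by blast
      then show ?thesis using zy v by (simp add: G.m_assoc del: pts_simps)
    qed
    from w show ?thesis
    proof (cases rule: E_cases)
      case (1 y)
      show ?thesis
        unfolding 1(3) inv_galois_id map_mat_id alg_isoD(8)[OF \<psi> x]
        unfolding 1(2) by (rule central[OF 1(1) xc, symmetric])
    next
      case (2 y)
      have hx: "Ad h x \<in> carrier (pts G)"
        using xc hc by (intro G.m_closed G.inv_closed)
      have zy: "z (inc y) \<in> carrier (pts G)" using rigid_cocycleD(1)[OF z] 2(1) by simp
      have "z w = z (inc y) \<cdot> h"
        unfolding 2(2) using rigid_cocycleD(2)[OF z _ s, of "inc y"] 2(1)
        by (simp add: proj_inc map_mat_id zs del: pts_simps)
      then have "z w \<cdot> x \<cdot> inv\<^sub>G (z w) =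
          z (inc y) \<cdot> (Ad h x) \<cdot> inv\<^sub>G (z (inc y))"
        using zy hc xc by (simp add: G.m_assoc G.inv_mult_group del: pts_simps)
      also have "\<dots> = Ad h x" by (rule central[OF 2(1) hx])
      finally have e: "z w \<cdot> x \<cdot> inv\<^sub>G (z w) = Ad h x" .
      have "inv_into (snd G) \<psi> (map_mat cnj (\<psi> (map_mat cnj x))) = Ad h x"
        unfolding tw[OF real_alg_group_cnj[OF real_alg x]] map_mat_cnj_cnj
        using alg_isoD(8)[OF \<psi>] hx by (simp only: pts_simps(1))
      then show ?thesis unfolding e 2(3) inv_galois_cnj .
    qed
  qed
  then have "rigid_inner_twist G W Z (G', \<psi>, z)"
    unfolding rigid_inner_twist_def using G' \<psi> z by blast
  then show ?thesis using that Z zs by blast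
qed

lemma equivalent_strong_real_forms_RI:
  assumes G: "connected_reductive G"
  shows "equivalent_categories (strong_real_forms G) (RI G W)"
\<comment> \<open>\<open>T\<close> keeps g as its second component, which makes its injectivity
  immediate.\<close>
proof (rule equivalent_categories_transport[where P = "\<lambda>X. (snd (snd X) s, cnj)"
      and T = "\<lambda>X Y g. (twist_map G X Y g, g)"])
  have obj: "\<exists>Z. finite_central_subgroup G Z \<and> rigid_inner_twist G W Z X" if "X \<in> Obj (RI G W)" for X
    using that by (auto simp: RI_def RI_over_def)
  have objI: "X \<in> Obj (RI G W)" if "finite_central_subgroup G Z" "rigid_inner_twist G W Z X" for Z X
    using that by (auto simp: RI_def RI_over_def)
  show "category (strong_real_forms G)" by (rule category_strong_real_forms)
  show "(\<lambda>X. (snd (snd X) s, cnj)) ` Obj (RI G W) = Obj (strong_real_forms G)"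
  proof (intro equalityI subsetI)
    fix \<delta> assume "\<delta> \<in> (\<lambda>X. (snd (snd X) s, cnj)) ` Obj (RI G W)"
    then obtain X where X: "X \<in> Obj (RI G W)" "\<delta> = (snd (snd X) s, cnj)" by blast
    obtain G' \<psi> z where e: "X = (G', \<psi>, z)" by (cases X)
    obtain Z where "finite_central_subgroup G Z" "rigid_inner_twist G W Z (G', \<psi>, z)"
      using obj[OF X(1)] e by blast
    then show "\<delta> \<in> Obj (strong_real_forms G)"
      using rigid_inner_twist_strong_real_form X(2) e by (simp add: strong_real_forms_def)
  next
    fix \<delta> assume d: "\<delta> \<in> Obj (strong_real_forms G)"
    obtain h a where \<delta>: "\<delta> = (h, a)" by (cases \<delta>)
    have "strong_real_form G (h, cnj)" and a: "a = cnj"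
      using d unfolding \<delta> by (auto simp: strong_real_forms_def strong_real_form_iff simp del: pts_simps)
    then obtain Z G' \<psi> z where "finite_central_subgroup G Z" "rigid_inner_twist G W Z (G', \<psi>, z)" "z s = h"
      using exists_rigid_inner_twist[OF G] by blast
    then show "\<delta> \<in> (\<lambda>X. (snd (snd X) s, cnj)) ` Obj (RI G W)"
      unfolding \<delta> a using objI by (intro image_eqI[of _ _ "(G', \<psi>, z)"]) auto
  qed
  fix X Y assume X: "X \<in> Obj (RI G W)" and Y: "Y \<in> Obj (RI G W)"
  obtain G1 \<psi>1 z1 where e1: "X = (G1, \<psi>1, z1)" by (cases X)
  obtain G2 \<psi>2 z2 where e2: "Y = (G2, \<psi>2, z2)" by (cases Y)
  obtain Z1 where Z1: "finite_central_subgroup G Z1" "rigid_inner_twist G W Z1 (G1, \<psi>1, z1)"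
    using obj[OF X] e1 by blast
  obtain Z2 where Z2: "finite_central_subgroup G Z2" "rigid_inner_twist G W Z2 (G2, \<psi>2, z2)"
    using obj[OF Y] e2 by blast
  show "Hom (RI G W) X Y = (\<lambda>g. (twist_map G X Y g, g)) `
      Hom (strong_real_forms G) (snd (snd X) s, cnj) (snd (snd Y) s, cnj)"
    using rigid_hom_eq[OF Z1 Z2(2)] unfolding e1 e2 by (simp add: RI_def)
  show "inj_on (\<lambda>g. (twist_map G X Y g, g)) (Hom (strong_real_forms G) (snd (snd X) s, cnj) (snd (snd Y) s, cnj))"
    by (rule inj_onI) simp
  note d1 = rigid_inner_twistD[OF Z1(2)] and d2 = rigid_inner_twistD[OF Z2(2)]
  show "(twist_map G X X (Ident (strong_real_forms G) (snd (snd X) s, cnj)),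
      Ident (strong_real_forms G) (snd (snd X) s, cnj)) = Ident (RI G W) X"
    using twist_map_one[OF d1(2)] unfolding e1
    by (simp add: strong_real_forms_def RI_def del: pts_simps)
  fix Z :: "'w twist" and f g assume "f \<in> Hom (strong_real_forms G) (snd (snd X) s, cnj) (snd (snd Y) s, cnj)"
    and "g \<in> Hom (strong_real_forms G) (snd (snd Y) s, cnj) (snd (snd Z) s, cnj)"
  then have fg: "f \<in> snd G" "g \<in> snd G" by (simp_all add: strong_real_forms_def)
  obtain G3 \<psi>3 z3 where e3: "Z = (G3, \<psi>3, z3)" by (cases Z)
  show "(twist_map G X Z (Comp (strong_real_forms G) (snd (snd X) s, cnj) (snd (snd Y) s, cnj) (snd (snd Z) s, cnj) g f),
      Comp (strong_real_forms G) (snd (snd X) s, cnj) (snd (snd Y) s, cnj) (snd (snd Z) s, cnj) g f) =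
      Comp (RI G W) X Y Z (twist_map G Y Z g, g) (twist_map G X Y f, f)"
    using twist_map_mult[OF d1(2) d2(2) fg] unfolding e1 e2 e3
    by (simp add: strong_real_forms_def RI_def del: pts_simps)
qed

end

theorem theorem5p2:
  fixes G :: lin_group and W :: "'w extension"
    and \<xi> :: "((complex \<Rightarrow> complex) \<times> (complex \<Rightarrow> complex) \<Rightarrow> u_elem) set"
  assumes "connected_reductive G"
    and "\<xi> \<in> carrier H2_u" and "\<xi> \<noteq> \<one>\<^bsub>H2_u\<^esub>"
    and "extension_of_class W \<xi>"
  shows "equivalent_categories (strong_real_forms G) (RI G W)"
proof -
  obtain s where s: "s \<in> carrier (ext_grp W)" "ext_proj W s = cnj"
    "s \<otimes>\<^bsub>ext_grp W\<^esub> s = ext_incl W (u_of zeta)"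
    using extension_lift_cnj[OF assms(4,2,3)] by blast
  interpret rigid_group W s G
    using s assms(4) connected_reductive_real_alg_group[OF assms(1)]
    by unfold_locales (simp_all add: extension_of_class_def)
  show ?thesis by (rule equivalent_strong_real_forms_RI[OF assms(1)])
qed

end
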